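(* Let $\phi$, $(\rho^0,u^0)$, $A$, $X$, $\Sigma_\pm$, $L(m)$ be as in the context (in particular, $A$ is convex in a neighborhood of every point of $\partial\Sigma_-$). Fix $m''\in(-\frac12,\frac12]$. If $m'\in(-\frac12,\frac12]$ satisfies $m'<\inf L(m'')$, then there exists a time-independent constant $c>0$ such that $$X(m'',t)-X(m',t)\ge c>0,\qquad\forall\,t\ge0.$$
   Context: Kernel: $\phi:\mathbb{R}\to\mathbb{R}$ is nonnegative, even, locally integrable, and radially nonincreasing (nonincreasing on $(0,\infty)$; it may be unbounded at $0$). $\Phi(x)=\int_0^x\phi(r)\,dr$. Data: $\rho^0$ is a compactly supported Borel probability measure on $\mathbb{R}$ and $u^0\in L^\infty(d\rho^0)$. Set $M^0(x)=-\frac12+\rho^0((-\infty,x])$, $X^0(m)=\inf\{x: M^0(x)\ge m\}$ for $m\in(-\frac12,\frac12]$, $\psi^0=u^0+\Phi*\rho^0$, and define the flux $A:[-\frac12,\frac12]\to\mathbb{R}$, $A(m)=\int_{-1/2}^m\psi^0(X^0(\widetilde m))\,d\widetilde m$ (a Lipschitz function). Entropy solution: $M=M(x,t)$ denotes the unique entropy solution of $\partial_tM+\partial_x(A(M))=(\Phi*\partial_xM)\,\partial_xM$ with $M(\cdot,0)=M^0$. That is: for each $t$, $M(x,t)=-\frac12+\rho(t)((-\infty,x])$ for a probability measure $\rho(t)$ on $\mathbb{R}$, with supports bounded locally uniformly in $t$; $t\mapsto M(\cdot,t)-M^0$ is continuous into $L^1(\mathbb{R})$ and vanishes at $t=0$;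 and for every $\alpha\in[-\frac12,\frac12]$, $\partial_t|M-\alpha|+\partial_x\big(\mathrm{sgn}(M-\alpha)(A(M)-A(\alpha))\big)\le(\Phi*\partial_xM)\,\partial_x|M-\alpha|$ in the sense of distributions on $\mathbb{R}\times(0,\infty)$. Put $X(m,t)=\inf\{x: M(x,t)\ge m\}$ for $m\in(-\frac12,\frac12]$. Regions: $A^{**}$ is the lower convex envelope of $A$ on $[-\frac12,\frac12]$. "Linear" means affine. $\Sigma_+$ is the set of $m\in(-\frac12,\frac12]$ such that $A^{**}$ is not linear on any interval of the form $(m',m]$. $\Sigma_-=\{m\in(-\frac12,\frac12):A(m)>A^{**}(m)\}$. For $m\notin\Sigma_+$, $L(m)$ is the largest half-open interval $(m',m'']$ containing $m$ on which $A^{**}$ is linear; for $m\in\Sigma_+$, $L(m)=\{m\}$. Standing assumption: $A$ is convex in a neighborhood (relative to $[-\frac12,\frac12]$) of every point of the boundary $\partial\Sigma_-$. *)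

theory Defs
  imports "HOL-Probability.Probability"
begin

definition alignment_kernel :: "(real \<Rightarrow> real) \<Rightarrow> bool" where
  "alignment_kernel \<phi> \<longleftrightarrow>
     (\<forall>r. 0 \<le> \<phi> r) \<and> (\<forall>r. \<phi> (- r) = \<phi> r) \<and>
     (\<forall>K. compact K \<longrightarrow> set_integrable lborel K \<phi>) \<and>
     (\<forall>r s. 0 < r \<longrightarrow> r \<le> s \<longrightarrow> \<phi> s \<le> \<phi> r)"

definition Phi :: "(real \<Rightarrow> real) \<Rightarrow> real \<Rightarrow> real" where
  "Phi \<phi> x = (LBINT r=ereal 0..ereal x. \<phi> r)"

definition conv_measure :: "(real \<Rightarrow> real) \<Rightarrow> real measure \<Rightarrow> real \<Rightarrow> real" where
  "conv_measure g \<mu> x = (LINT y|\<mu>. g (x - y))"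

definition borel_prob :: "real measure \<Rightarrow> bool" where
  "borel_prob \<mu> \<longleftrightarrow> prob_space \<mu> \<and> sets \<mu> = sets borel"

definition compactly_supported :: "real measure \<Rightarrow> bool" where
  "compactly_supported \<mu> \<longleftrightarrow> (\<exists>K. compact K \<and> emeasure \<mu> (- K) = 0)"

text \<open>A Borel representative of an element of \<open>L\<^sup>\<infinity>(\<mu>)\<close>.\<close>
definition ess_bounded :: "real measure \<Rightarrow> (real \<Rightarrow> real) \<Rightarrow> bool" where
  "ess_bounded \<mu> u \<longleftrightarrow> u \<in> borel_measurable \<mu> \<and> (\<exists>C. AE x in \<mu>. \<bar>u x\<bar> \<le> C)"

definition shifted_cdf :: "real measure \<Rightarrow> real \<Rightarrow> real" where
  "shifted_cdf \<mu> x = - 1/2 + measure \<mu> {..x}"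

text \<open>Only meaningful for \<open>-1/2 < m \<le> 1/2\<close>, and for \<open>F\<close> the shifted distribution function of a
  compactly supported probability measure: the set is then nonempty and bounded below.\<close>
definition quantile :: "(real \<Rightarrow> real) \<Rightarrow> real \<Rightarrow> real" where
  "quantile F m = Inf {x. m \<le> F x}"

definition psi0 :: "(real \<Rightarrow> real) \<Rightarrow> real measure \<Rightarrow> (real \<Rightarrow> real) \<Rightarrow> real \<Rightarrow> real" where
  "psi0 \<phi> \<rho>0 u0 x = u0 x + conv_measure (Phi \<phi>) \<rho>0 x"

definition flux :: "(real \<Rightarrow> real) \<Rightarrow> real measure \<Rightarrow> (real \<Rightarrow> real) \<Rightarrow> real \<Rightarrow> real" where
  "flux \<phi> \<rho>0 u0 m =
     (LBINT \<mu>=ereal (- 1/2)..ereal m. psi0 \<phi> \<rho>0 u0 (quantile (shifted_cdf \<rho>0) \<mu>))"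

text \<open>Functions on space-time take pairs \<open>(x, t)\<close>.\<close>
definition dx :: "(real \<times> real \<Rightarrow> real) \<Rightarrow> real \<times> real \<Rightarrow> real" where
  "dx \<zeta> = (\<lambda>(x, t). deriv (\<lambda>y. \<zeta> (y, t)) x)"

definition dt :: "(real \<times> real \<Rightarrow> real) \<Rightarrow> real \<times> real \<Rightarrow> real" where
  "dt \<zeta> = (\<lambda>(x, t). deriv (\<lambda>s. \<zeta> (x, s)) t)"

primrec C_k :: "nat \<Rightarrow> (real \<times> real \<Rightarrow> real) \<Rightarrow> bool" where
  "C_k 0 \<zeta> \<longleftrightarrow> continuous_on UNIV \<zeta>"
| "C_k (Suc k) \<zeta> \<longleftrightarrow> \<zeta> differentiable_on UNIV \<and> C_k k (dx \<zeta>) \<and> C_k k (dt \<zeta>)"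

definition test_function :: "(real \<times> real \<Rightarrow> real) \<Rightarrow> bool" where
  "test_function \<zeta> \<longleftrightarrow>
     (\<forall>k. C_k k \<zeta>) \<and>
     (\<exists>K. compact K \<and> K \<subseteq> UNIV \<times> {0<..} \<and> (\<forall>z. z \<notin> K \<longrightarrow> \<zeta> z = 0))"

text \<open>The integral of \<open>g\<close> against the signed measure \<open>\<partial>\<^sub>x\<bar>F - \<alpha>\<bar>\<close>, for \<open>F\<close> nondecreasing and
  right-continuous: \<open>\<bar>F - \<alpha>\<bar> = max (F - \<alpha>) 0 - min (F - \<alpha>) 0\<close> is a difference of two
  nondecreasing right-continuous functions, each of which has a Stieltjes measure as its
  distributional derivative.\<close>
definition integral_deriv_abs :: "(real \<Rightarrow> real) \<Rightarrow> real \<Rightarrow> (real \<Rightarrow> real) \<Rightarrow> real" where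
  "integral_deriv_abs F \<alpha> g =
     (LINT x|interval_measure (\<lambda>x. max (F x - \<alpha>) 0). g x) -
     (LINT x|interval_measure (\<lambda>x. min (F x - \<alpha>) 0). g x)"

text \<open>Distributional form of
  \<open>\<partial>\<^sub>t\<bar>M - \<alpha>\<bar> + \<partial>\<^sub>x(sgn (M - \<alpha>) (A M - A \<alpha>)) \<le> (\<Phi> * \<partial>\<^sub>xM) \<partial>\<^sub>x\<bar>M - \<alpha>\<bar>\<close> on
  \<open>\<real> \<times> (0, \<infinity>)\<close>, where \<open>\<rho> t = \<partial>\<^sub>xM(\<cdot>, t)\<close>.\<close>
definition entropy_inequality ::
    "(real \<Rightarrow> real) \<Rightarrow> (real \<Rightarrow> real) \<Rightarrow> (real \<Rightarrow> real measure) \<Rightarrow> (real \<Rightarrow> real \<Rightarrow> real) \<Rightarrow> real \<Rightarrow> bool" where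
  "entropy_inequality \<phi> A \<rho> M \<alpha> \<longleftrightarrow>
     (\<forall>\<zeta>. test_function \<zeta> \<longrightarrow> (\<forall>z. 0 \<le> \<zeta> z) \<longrightarrow>
        0 \<le> (LBINT t:{0<..}.
               (LBINT x. \<bar>M x t - \<alpha>\<bar> * dt \<zeta> (x, t) +
                         sgn (M x t - \<alpha>) * (A (M x t) - A \<alpha>) * dx \<zeta> (x, t)) +
               integral_deriv_abs (\<lambda>x. M x t) \<alpha>
                 (\<lambda>x. \<zeta> (x, t) * conv_measure (Phi \<phi>) (\<rho> t) x)))"

text \<open>Only the values \<open>M x t\<close> with \<open>t \<ge> 0\<close> matter.\<close>
definition entropy_solution ::
    "(real \<Rightarrow> real) \<Rightarrow> (real \<Rightarrow> real) \<Rightarrow> (real \<Rightarrow> real) \<Rightarrow> (real \<Rightarrow> real \<Rightarrow> real) \<Rightarrow> bool" where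
  "entropy_solution \<phi> A M0 M \<longleftrightarrow>
     (\<exists>\<rho>. (\<forall>t\<ge>0. borel_prob (\<rho> t) \<and> (\<forall>x. M x t = shifted_cdf (\<rho> t) x)) \<and>
          (\<forall>T\<ge>0. \<exists>R. \<forall>t\<in>{0..T}. emeasure (\<rho> t) (- {-R..R}) = 0) \<and>
          (\<forall>t\<ge>0. integrable lborel (\<lambda>x. M x t - M0 x)) \<and>
          (\<forall>t\<ge>0. ((\<lambda>s. LBINT x. \<bar>(M x s - M0 x) - (M x t - M0 x)\<bar>) \<longlongrightarrow> 0) (at t within {0..})) \<and>
          (\<forall>x. M x 0 = M0 x) \<and>
          (\<forall>\<alpha>\<in>{-1/2..1/2}. entropy_inequality \<phi> A \<rho> M \<alpha>))"

text \<open>The largest convex function on \<open>[-1/2, 1/2]\<close> that lies below \<open>A\<close>.\<close>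
definition convex_envelope :: "(real \<Rightarrow> real) \<Rightarrow> real \<Rightarrow> real" where
  "convex_envelope A m =
     Sup {g m | g. convex_on {-1/2..1/2} g \<and> (\<forall>y\<in>{-1/2..1/2}. g y \<le> A y)}"

definition affine_on :: "real set \<Rightarrow> (real \<Rightarrow> real) \<Rightarrow> bool" where
  "affine_on S f \<longleftrightarrow> (\<exists>a b. \<forall>x\<in>S. f x = a * x + b)"

definition Sigma_plus :: "(real \<Rightarrow> real) \<Rightarrow> real set" where
  "Sigma_plus A =
     {m \<in> {-1/2<..1/2}. \<not> (\<exists>m'\<in>{-1/2..<m}. affine_on {m'<..m} (convex_envelope A))}"

definition Sigma_minus :: "(real \<Rightarrow> real) \<Rightarrow> real set" where
  "Sigma_minus A = {m \<in> {-1/2<..<1/2}. convex_envelope A m < A m}"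

text \<open>\<open>GREATEST\<close> refers to inclusion of sets.\<close>
definition linear_piece :: "(real \<Rightarrow> real) \<Rightarrow> real \<Rightarrow> real set" where
  "linear_piece A m =
     (if m \<in> Sigma_plus A then {m}
      else (GREATEST I. m \<in> I \<and> affine_on I (convex_envelope A) \<and>
              (\<exists>a b. - 1/2 \<le> a \<and> a < b \<and> b \<le> 1/2 \<and> I = {a<..b})))"

definition convex_near_frontier :: "(real \<Rightarrow> real) \<Rightarrow> bool" where
  "convex_near_frontier A \<longleftrightarrow>
     (\<forall>z\<in>frontier (Sigma_minus A). \<exists>\<epsilon>>0. convex_on (ball z \<epsilon> \<inter> {-1/2..1/2}) A)"

end

theory Submission
  imports Defs "HOL-Computational_Algebra.Polynomial"
begin

text \<open>
  Since \<open>A\<^sup>*\<^sup>*\<close> is not affine on \<open>(m', m'']\<close>, minimising \<open>A m - p m\<close> for two suitable slopes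
  \<open>p\<^sub>1 < p\<^sub>2\<close> produces levels \<open>m' < n\<^sub>1 \<le> n\<^sub>2 < m''\<close> at which the graph of \<open>A\<close> has supporting lines
  of these slopes. Testing the entropy inequality for \<open>max (M - n\<^sub>2) 0\<close> with functions carried along a line shows that
  the right edge of \<open>{M \<le> n\<^sub>2}\<close> moves at least at speed \<open>p\<^sub>2 - \<Phi> * \<rho>\<close>; symmetrically, the left edge of
  \<open>{M \<ge> n\<^sub>1}\<close> moves at most at speed \<open>p\<^sub>1 - \<Phi> * \<rho>\<close>. As \<open>\<Phi>\<close> varies by at most \<open>2 \<Phi>(d)\<close> over a distance
  \<open>d\<close>, the distance \<open>D\<close> of the two edges satisfies \<open>D' \<ge> p\<^sub>2 - p\<^sub>1 - 2 \<Phi>(D)\<close>, which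
  keeps it away from \<open>0\<close> after any positive time. For small times one uses that all quantiles move
  with finite speed and that \<open>X\<^sup>0(m') < X\<^sup>0(m'')\<close>: otherwise \<open>A\<close> would be affine on \<open>[m', m'']\<close>, which two
  different supporting slopes exclude.
\<close>

section \<open>Smooth test functions\<close>

text \<open>The edges are quantiles of a weak solution that is merely continuous into L1, so no
  differential inequality for their distance is available pointwise. A finite-step comparison
  replaces it: over a short time the drift is frozen at a worst-case value, each edge is compared
  with a straight line, and the price is a small shift of the argument of the drift. The chosen
  edges may coincide initially, so the estimate yields linear growth in time up to a threshold
  determined by the slopes and \<open>\<Psi>\<close> alone. Support radius and propagation speed
  depend on the time horizon but affect only the step size, which is what keeps the constant
  independent of time. Using the mass variable \<open>m\<close> throughout turns the signed measures
  and the convolution into Lebesgue integrals over fixed intervals, so that different times are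
  compared through quantiles.\<close>

definition flat_exp :: "real poly \<Rightarrow> real \<Rightarrow> real" where
  "flat_exp p x = (if 0 < x then poly p (inverse x) * exp (- inverse x) else 0)"

text \<open>The substitution y = 1/x turns the claim into decay of a polynomial times exp (- y) at
  infinity.\<close>

lemma flat_exp_tendsto_0: "(flat_exp p \<longlongrightarrow> 0) (at_right 0)"
proof -
  have "((\<lambda>y. poly p y * exp (- y)) \<longlongrightarrow> 0) at_top"
  proof (induction p)
    case 0
    then show ?case by simp
  next
    case (pCons a p)
    have *: "((\<lambda>y. y * (poly q y * exp (- y))) \<longlongrightarrow> 0) at_top" for q :: "real poly"
    proof -
      have "((\<lambda>y. \<Sum>i\<le>degree q. coeff q i * (y ^ Suc i / exp y)) \<longlongrightarrow> (\<Sum>i\<le>degree q. coeff q i * 0)) at_top"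
        by (intro tendsto_intros tendsto_power_div_exp_0)
      then show ?thesis
        by (simp add: poly_altdef sum_distrib_left sum_distrib_right exp_minus field_simps)
    qed
    have "((\<lambda>y::real. a * (y ^ 0 / exp y)) \<longlongrightarrow> a * 0) at_top"
      by (intro tendsto_intros tendsto_power_div_exp_0)
    then have "((\<lambda>y. a * (y ^ 0 / exp y) + y * (poly p y * exp (- y))) \<longlongrightarrow> a * 0 + 0) at_top"
      by (intro tendsto_add *)
    then show ?case
      by (simp add: algebra_simps exp_minus field_simps)
  qed
  then have "((\<lambda>x. poly p (inverse x) * exp (- inverse x)) \<longlongrightarrow> 0) (at_right 0)"
    by (rule filterlim_compose) (rule filterlim_inverse_at_top_right)
  then show ?thesis
    by (rule Lim_transform_eventually) (auto simp: flat_exp_def eventually_at_filter)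
qed

text \<open>With y = 1/x, differentiating p(y) exp(-y) produces the factor y^2 (p - p')(y). Allowing
  an arbitrary polynomial factor thus makes the family closed under differentiation.\<close>

lemma DERIV_flat_exp:
  "(flat_exp p has_real_derivative flat_exp ([:0, 0, 1:] * (p - pderiv p)) x) (at x)"
proof -
  consider "x < 0" | "x = 0" | "0 < x" by linarith
  then show ?thesis
  proof cases
    case 1
    have "((\<lambda>_. 0) has_real_derivative 0) (at x)" by simp
    then have "(flat_exp p has_real_derivative 0) (at x)"
      by (rule has_field_derivative_transform_within_open[where S = "{..<0}"])
        (use 1 in \<open>auto simp: flat_exp_def\<close>)
    with 1 show ?thesis by (simp add: flat_exp_def)
  next
    case 2
    \<comment> \<open>The difference quotient at 0 is again a member of the family, with polynomial
      \<open>[:0, 1:] * p\<close>.\<close>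
    have "((\<lambda>h. flat_exp p h / h) \<longlongrightarrow> 0) (at_right 0)"
      using flat_exp_tendsto_0[of "[:0, 1:] * p"]
      by (rule Lim_transform_eventually) (auto simp: flat_exp_def eventually_at_filter field_simps)
    moreover have "((\<lambda>h. flat_exp p h / h) \<longlongrightarrow> 0) (at_left 0)"
      by (rule Lim_transform_eventually[OF tendsto_const]) (auto simp: flat_exp_def eventually_at_filter)
    ultimately have "((\<lambda>h. flat_exp p h / h) \<longlongrightarrow> 0) (at 0)"
      by (simp add: filterlim_at_split)
    with 2 show ?thesis by (simp add: DERIV_def flat_exp_def)
  next
    case 3
    have "((\<lambda>x. poly p (inverse x) * exp (- inverse x)) has_real_derivative
        flat_exp ([:0, 0, 1:] * (p - pderiv p)) x) (at x)"
      using 3 by (auto intro!: derivative_eq_intros simp: flat_exp_def field_simps)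
    then show ?thesis
      by (rule has_field_derivative_transform_within_open[where S = "{0<..}"])
        (use 3 in \<open>auto simp: flat_exp_def\<close>)
  qed
qed

text \<open>Closed under partial derivatives, so membership gives \<open>C\<^sup>\<infinity>\<close> without tracking the order of
  differentiability.\<close>
inductive smooth_expr :: "(real \<times> real \<Rightarrow> real) \<Rightarrow> bool" where
  flat: "smooth_expr (\<lambda>z. flat_exp p (a * fst z + b * snd z + c))"
| const: "smooth_expr (\<lambda>_. c)"
| add: "smooth_expr f \<Longrightarrow> smooth_expr g \<Longrightarrow> smooth_expr (\<lambda>z. f z + g z)"
| mult: "smooth_expr f \<Longrightarrow> smooth_expr g \<Longrightarrow> smooth_expr (\<lambda>z. f z * g z)"
| inverse: "smooth_expr f \<Longrightarrow> (\<And>z. f z \<noteq> 0) \<Longrightarrow> smooth_expr (\<lambda>z. inverse (f z))"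

lemma smooth_expr_has_derivative:
  assumes "smooth_expr f"
  shows "\<exists>g h. smooth_expr g \<and> smooth_expr h \<and>
    (\<forall>z. (f has_derivative (\<lambda>w. g z * fst w + h z * snd w)) (at z))"
  using assms
proof induction
  case (flat p a b c)
  let ?q = "[:0, 0, 1:] * (p - pderiv p)"
  let ?f = "\<lambda>z. flat_exp ?q (a * fst z + b * snd z + c)"
  have "((\<lambda>z. flat_exp p (a * fst z + b * snd z + c)) has_derivative
      (\<lambda>w. (a * fst w + b * snd w) * ?f z)) (at z)" for z
  proof -
    have "(flat_exp p has_derivative (\<lambda>w. w * ?f z)) (at (a * fst z + b * snd z + c))"
      using DERIV_flat_exp[of p "a * fst z + b * snd z + c"]
      by (simp add: has_field_derivative_def mult_commute_abs)
    then show ?thesis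
      by (rule has_derivative_compose[rotated]) (auto intro!: derivative_eq_intros)
  qed
  moreover have "smooth_expr (\<lambda>z. a * ?f z)" "smooth_expr (\<lambda>z. b * ?f z)"
    by (intro smooth_expr.intros)+
  ultimately show ?case
    by (intro exI[of _ "\<lambda>z. a * ?f z"] exI[of _ "\<lambda>z. b * ?f z"]) (simp add: algebra_simps)
next
  case (const c)
  then show ?case
    by (intro exI[of _ "\<lambda>_. 0"]) (auto intro: smooth_expr.const)
next
  case (add f1 f2)
  obtain g1 h1 where *: "smooth_expr g1" "smooth_expr h1"
    and 1: "\<And>z. (f1 has_derivative (\<lambda>w. g1 z * fst w + h1 z * snd w)) (at z)"
    using add.IH(1) by blast
  obtain g2 h2 where **: "smooth_expr g2" "smooth_expr h2"
    and 2: "\<And>z. (f2 has_derivative (\<lambda>w. g2 z * fst w + h2 z * snd w)) (at z)"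
    using add.IH(2) by blast
  have "((\<lambda>z. f1 z + f2 z) has_derivative
      (\<lambda>w. (g1 z + g2 z) * fst w + (h1 z + h2 z) * snd w)) (at z)" for z
    using has_derivative_add[OF 1[of z] 2[of z]] by (simp add: algebra_simps)
  moreover have "smooth_expr (\<lambda>z. g1 z + g2 z)" "smooth_expr (\<lambda>z. h1 z + h2 z)"
    by (intro smooth_expr.add * **)+
  ultimately show ?case by blast
next
  case (mult f1 f2)
  obtain g1 h1 where *: "smooth_expr g1" "smooth_expr h1"
    and 1: "\<And>z. (f1 has_derivative (\<lambda>w. g1 z * fst w + h1 z * snd w)) (at z)"
    using mult.IH(1) by blast
  obtain g2 h2 where **: "smooth_expr g2" "smooth_expr h2"
    and 2: "\<And>z. (f2 has_derivative (\<lambda>w. g2 z * fst w + h2 z * snd w)) (at z)"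
    using mult.IH(2) by blast
  have "((\<lambda>z. f1 z * f2 z) has_derivative
      (\<lambda>w. (f1 z * g2 z + g1 z * f2 z) * fst w + (f1 z * h2 z + h1 z * f2 z) * snd w)) (at z)" for z
    using has_derivative_mult[OF 1[of z] 2[of z]] by (simp add: algebra_simps)
  moreover have "smooth_expr (\<lambda>z. f1 z * g2 z + g1 z * f2 z)" "smooth_expr (\<lambda>z. f1 z * h2 z + h1 z * f2 z)"
    by (intro smooth_expr.add smooth_expr.mult mult.hyps * **)+
  ultimately show ?case by blast
next
  case (inverse f)
  obtain g h where *: "smooth_expr g" "smooth_expr h"
    and 1: "\<And>z. (f has_derivative (\<lambda>w. g z * fst w + h z * snd w)) (at z)"
    using inverse.IH by blast
  have "((\<lambda>z. inverse (f z)) has_derivative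
      (\<lambda>w. (- 1 * (inverse (f z) * inverse (f z)) * g z) * fst w +
        (- 1 * (inverse (f z) * inverse (f z)) * h z) * snd w)) (at z)" for z
    using Deriv.has_derivative_inverse[OF inverse.hyps(2)[of z] 1[of z]] by (simp add: algebra_simps)
  moreover have "smooth_expr (\<lambda>z. - 1 * (inverse (f z) * inverse (f z)) * g z)"
    "smooth_expr (\<lambda>z. - 1 * (inverse (f z) * inverse (f z)) * h z)"
    by (intro smooth_expr.mult smooth_expr.inverse smooth_expr.const inverse.hyps *)+
  ultimately show ?case by blast
qed

lemma dx_dt_eqI:
  assumes "\<And>z. (f has_derivative (\<lambda>w. g z * fst w + h z * snd w)) (at z)"
  shows "dx f = g" "dt f = h"
proof -
  have "((\<lambda>y. f (y, t)) has_derivative (\<lambda>w. g (x, t) * fst (w, 0::real) + h (x, t) * snd (w, 0))) (at x)" for x t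
    using assms[of "(x, t)"]
    by (rule has_derivative_compose[rotated]) (auto intro!: derivative_eq_intros)
  then have "((\<lambda>y. f (y, t)) has_real_derivative g (x, t)) (at x)" for x t
    by (simp add: has_field_derivative_def)
  then show "dx f = g"
    by (auto simp: dx_def fun_eq_iff intro!: DERIV_imp_deriv)
  have "((\<lambda>s. f (x, s)) has_derivative (\<lambda>w. g (x, t) * fst (0::real, w) + h (x, t) * snd (0::real, w))) (at t)" for x t
    using assms[of "(x, t)"]
    by (rule has_derivative_compose[rotated]) (auto intro!: derivative_eq_intros)
  then have "((\<lambda>s. f (x, s)) has_real_derivative h (x, t)) (at t)" for x t
    by (simp add: has_field_derivative_def)
  then show "dt f = h"
    by (auto simp: dt_def fun_eq_iff intro!: DERIV_imp_deriv)
qed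

lemma smooth_expr_C_k:
  assumes "smooth_expr f"
  shows "C_k k f"
  using assms
proof (induction k arbitrary: f)
  case 0
  with smooth_expr_has_derivative[OF 0] show ?case
    by (auto simp: continuous_on_eq_continuous_at intro: has_derivative_continuous)
next
  case (Suc k)
  obtain g h where gh: "smooth_expr g" "smooth_expr h"
    and *: "\<And>z. (f has_derivative (\<lambda>w. g z * fst w + h z * snd w)) (at z)"
    using smooth_expr_has_derivative[OF Suc.prems] by metis
  have "f differentiable_on UNIV"
    using * by (auto simp: differentiable_on_def differentiable_def)
  with gh Suc.IH dx_dt_eqI[OF *] show ?case by simp
qed

text \<open>Since x or 1 - x is positive, the denominator never vanishes, so the quotient stays
  within \<open>smooth_expr\<close>.\<close>

definition smooth_step :: "real \<Rightarrow> real" where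
  "smooth_step x = flat_exp 1 x * inverse (flat_exp 1 x + flat_exp 1 (1 - x))"

lemma flat_exp_1: "flat_exp 1 x = (if 0 < x then exp (- inverse x) else 0)"
  by (simp add: flat_exp_def)

lemma smooth_step_denom_pos: "0 < flat_exp 1 x + flat_exp 1 (1 - x)"
  by (auto simp: flat_exp_1 intro: add_pos_nonneg)

lemma smooth_step_bounds: "0 \<le> smooth_step x" "smooth_step x \<le> 1"
  using smooth_step_denom_pos[of x] by (auto simp: smooth_step_def flat_exp_1 field_simps)

lemma smooth_step_eq: "x \<le> 0 \<Longrightarrow> smooth_step x = 0" "1 \<le> x \<Longrightarrow> smooth_step x = 1"
  by (auto simp: smooth_step_def flat_exp_1)

lemma smooth_expr_step: "smooth_expr (\<lambda>z. smooth_step (a * fst z + b * snd z + c))"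
proof -
  have "smooth_expr (\<lambda>z. flat_exp 1 (1 - (a * fst z + b * snd z + c)))"
    using smooth_expr.flat[of 1 "- a" "- b" "1 - c"] by (simp add: algebra_simps)
  moreover have "smooth_expr (\<lambda>z. flat_exp 1 (a * fst z + b * snd z + c))"
    by (rule smooth_expr.flat)
  moreover have "flat_exp 1 x + flat_exp 1 (1 - x) \<noteq> 0" for x
    using smooth_step_denom_pos[of x] by simp
  ultimately show ?thesis
    unfolding smooth_step_def by (intro smooth_expr.mult smooth_expr.inverse smooth_expr.add) auto
qed

text \<open>The sign of the derivative is what the time cut-offs need later: it tells where a weight
  rises and where it falls.\<close>

lemma smooth_step_DERIV:
  obtains s' where "\<And>x. (smooth_step has_real_derivative s' x) (at x)" "continuous_on UNIV s'" "\<And>x. 0 \<le> s' x"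
proof -
  let ?e = "flat_exp 1" and ?e' = "flat_exp ([:0, 0, 1:] * (1 - pderiv 1))"
  let ?s' = "\<lambda>x. (?e' x * ?e (1 - x) + ?e x * ?e' (1 - x)) * inverse (?e x + ?e (1 - x)) ^ 2"
  have cont: "continuous_on UNIV (flat_exp p)" for p
    using DERIV_flat_exp by (blast intro: DERIV_continuous_on has_field_derivative_at_within)
  have cont': "continuous_on UNIV (\<lambda>x. flat_exp p (1 - x))" for p
    by (rule continuous_on_compose2[OF cont]) (auto intro!: continuous_intros)
  have ne: "?e x + ?e (1 - x) \<noteq> 0" for x
    using smooth_step_denom_pos[of x] by simp
  have d2: "((\<lambda>x. ?e (1 - x)) has_real_derivative - ?e' (1 - x)) (at x)" for x
    using DERIV_chain2[of "flat_exp 1" _ "\<lambda>x. 1 - x" x "-1" UNIV] DERIV_flat_exp[of 1 "1 - x"]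
    by (fastforce intro!: derivative_eq_intros)
  have "((\<lambda>x. ?e x * inverse (?e x + ?e (1 - x))) has_real_derivative ?s' x) (at x)" for x
  proof -
    have D: "((\<lambda>x. ?e x * inverse (?e x + ?e (1 - x))) has_real_derivative
        ?e' x * inverse (?e x + ?e (1 - x)) +
        - (inverse (?e x + ?e (1 - x)) * (?e' x + - ?e' (1 - x)) * inverse (?e x + ?e (1 - x))) * ?e x) (at x)"
      by (intro DERIV_mult DERIV_inverse' DERIV_add DERIV_flat_exp d2 ne)
    have alg: "a' * inverse (a + b) + - (inverse (a + b) * (a' + - b') * inverse (a + b)) * a =
        (a' * b + a * b') * inverse (a + b) ^ 2" if "a + b \<noteq> 0" for a b a' b' :: real
    proof -
      have "(a + b) * inverse (a + b) = 1" using that by simp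
      then show ?thesis by algebra
    qed
    show ?thesis using D by (simp only: alg[OF ne[of x]])
  qed
  moreover have "smooth_step = (\<lambda>x. ?e x * inverse (?e x + ?e (1 - x)))"
    by (rule ext) (rule smooth_step_def)
  ultimately have "(smooth_step has_real_derivative ?s' x) (at x)" for x
    by (simp only:)
  moreover have "continuous_on UNIV ?s'"
    by (intro continuous_intros cont cont') (use ne in auto)
  moreover have "0 \<le> ?s' x" for x
    by (intro mult_nonneg_nonneg add_nonneg_nonneg) (auto simp: flat_exp_def)
  ultimately show ?thesis by (rule that)
qed

section \<open>The kernel and its primitive\<close>

locale alignment_potential =
  fixes \<phi> :: "real \<Rightarrow> real"
  assumes kernel: "alignment_kernel \<phi>"
begin

lemma kernel_integrable: "set_integrable lborel {a..b} \<phi>"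
  using kernel by (auto simp: alignment_kernel_def)

text \<open>Only local integrability is assumed, so measurability is read off the truncations to
  [-n, n], which are eventually equal to \<open>\<phi>\<close> at each point.\<close>

lemma kernel_measurable [measurable]: "\<phi> \<in> borel_measurable borel"
proof -
  have "(\<lambda>x. indicator {- real n..real n} x *\<^sub>R \<phi> x) \<in> borel_measurable lborel" for n
    using kernel_integrable[of "- real n" "real n"] by (auto simp: set_integrable_def)
  then have m: "(\<lambda>x. indicator {- real n..real n} x *\<^sub>R \<phi> x) \<in> borel_measurable borel" for n
    by simp
  show ?thesis
  proof (rule borel_measurable_LIMSEQ_real[OF _ m])
    fix x :: real
    obtain N where "\<bar>x\<bar> \<le> real N" using real_arch_simple by blast
    then have "eventually (\<lambda>n. indicator {- real n..real n} x *\<^sub>R \<phi> x = \<phi> x) sequentially"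
      by (intro eventually_sequentiallyI[of N]) (auto simp: abs_le_iff split: split_indicator)
    then show "(\<lambda>n. indicator {- real n..real n} x *\<^sub>R \<phi> x) \<longlonglongrightarrow> \<phi> x"
      by (rule tendsto_eventually)
  qed
qed

lemma kernel_nonneg: "0 \<le> \<phi> r"
  and kernel_even: "\<phi> (- r) = \<phi> r"
  and kernel_antimono: "0 < r \<Longrightarrow> r \<le> s \<Longrightarrow> \<phi> s \<le> \<phi> r"
  using kernel by (auto simp: alignment_kernel_def)

lemma kernel_interval_integrable: "interval_lebesgue_integrable lborel (ereal a) (ereal b) \<phi>"
  using kernel_integrable[of "min a b" "max a b"]
  by (auto simp: interval_lebesgue_integrable_def einterval_eq intro: set_integrable_subset)

abbreviation "\<Psi> \<equiv> Phi \<phi>"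

lemma Phi_diff: "\<Psi> b - \<Psi> a = (LBINT r=ereal a..ereal b. \<phi> r)"
proof -
  have "(LBINT r=ereal 0..ereal a. \<phi> r) + (LBINT r=ereal a..ereal b. \<phi> r) = (LBINT r=ereal 0..ereal b. \<phi> r)"
    by (rule interval_integral_sum) (auto simp flip: ereal_min ereal_max intro: kernel_interval_integrable)
  then show ?thesis by (simp add: Phi_def)
qed

lemma Phi_0 [simp]: "\<Psi> 0 = 0"
  by (simp add: Phi_def)

lemma Phi_mono: "a \<le> b \<Longrightarrow> \<Psi> a \<le> \<Psi> b"
proof -
  assume "a \<le> b"
  then have "0 \<le> (LBINT r=ereal a..ereal b. \<phi> r)"
    by (simp add: interval_integral_Icc set_lebesgue_integral_def kernel_nonneg)
  then show ?thesis using Phi_diff[of b a] by simp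
qed

lemma Phi_minus: "\<Psi> (- x) = - \<Psi> x"
proof -
  have "\<Psi> (- x) = (LBINT r=ereal 0..ereal (- x). \<phi> r)" by (simp add: Phi_def)
  also have "\<dots> = (LBINT r=ereal x..ereal 0. \<phi> (- r))"
    by (subst interval_integral_reflect) simp
  also have "\<dots> = - (LBINT r=ereal 0..ereal x. \<phi> r)"
    by (subst interval_integral_endpoints_reverse) (simp add: kernel_even)
  finally show ?thesis by (simp add: Phi_def)
qed

lemma Phi_nonneg: "0 \<le> x \<Longrightarrow> 0 \<le> \<Psi> x"
  using Phi_mono[of 0 x] by simp

text \<open>Translating [a, a + h] to [0, h] can only increase the integral of a kernel that is
  nonincreasing on the positive half-line.\<close>

lemma Phi_subadditive:
  assumes "0 \<le> a" "0 \<le> h"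
  shows "\<Psi> (a + h) - \<Psi> a \<le> \<Psi> h"
proof -
  have "\<Psi> (a + h) - \<Psi> a = (LBINT r=ereal a..ereal (a + h). \<phi> r)" by (rule Phi_diff)
  also have "\<dots> = (LBINT r:{a..a + h}. \<phi> r)"
    using assms by (simp add: interval_integral_Icc)
  also have "\<dots> = (\<integral>r. indicator {a..a + h} (a + r) * \<phi> (a + r) \<partial>lborel)"
    unfolding set_lebesgue_integral_def
    by (subst lborel_integral_real_affine[where c = 1 and t = a]) simp_all
  also have "\<dots> = (LBINT r:{0..h}. \<phi> (a + r))"
    unfolding set_lebesgue_integral_def
    by (intro Bochner_Integration.integral_cong) (auto split: split_indicator)
  also have "\<dots> \<le> (LBINT r:{0..h}. \<phi> r)"
    unfolding set_lebesgue_integral_def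
  proof (rule integral_mono_AE)
    have "integrable lborel (\<lambda>r. indicator {a..a + h} (a + 1 * r) *\<^sub>R \<phi> (a + 1 * r))"
      using kernel_integrable[of a "a + h"]
      by (intro lborel_integrable_real_affine) (auto simp: set_integrable_def)
    then show "integrable lborel (\<lambda>r. indicator {0..h} r *\<^sub>R \<phi> (a + r))"
      by (rule back_subst[where P = "integrable lborel"]) (auto split: split_indicator)
    show "integrable lborel (\<lambda>r. indicator {0..h} r *\<^sub>R \<phi> r)"
      using kernel_integrable by (simp add: set_integrable_def)
    show "AE r in lborel. indicator {0..h} r *\<^sub>R \<phi> (a + r) \<le> indicator {0..h} r *\<^sub>R \<phi> r"
      \<comment> \<open>Monotonicity of the kernel says nothing about its value at 0, so that point
        is discarded.\<close>
      using AE_lborel_singleton[of "0::real"]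
    proof (rule AE_mp, intro AE_I2 impI)
      fix r :: real assume "r \<noteq> 0"
      with assms show "indicator {0..h} r *\<^sub>R \<phi> (a + r) \<le> indicator {0..h} r *\<^sub>R \<phi> r"
        by (auto split: split_indicator intro: kernel_antimono)
    qed
  qed
  also have "\<dots> = \<Psi> h"
    using assms by (simp add: Phi_def interval_integral_Icc)
  finally show ?thesis .
qed

text \<open>On one side of the origin, one copy of \<open>\<Psi> (b - a)\<close> suffices by
  subadditivity and oddness; an interval around the origin is cut there, which accounts for the
  factor 2. This modulus takes the place of a Lipschitz constant.\<close>

lemma Phi_diff_le:
  assumes "a \<le> b"
  shows "\<Psi> b - \<Psi> a \<le> 2 * \<Psi> (b - a)"
proof -
  have nn: "0 \<le> \<Psi> (b - a)" using assms by (intro Phi_nonneg) simp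
  consider "0 \<le> a" | "b \<le> 0" | "a < 0" "0 < b" by linarith
  then show ?thesis
  proof cases
    case 1
    with assms Phi_subadditive[of a "b - a"] nn show ?thesis by simp
  next
    case 2
    with assms Phi_subadditive[of "- b" "b - a"] nn show ?thesis by (simp add: Phi_minus)
  next
    case 3
    then have "\<Psi> b \<le> \<Psi> (b - a)" "\<Psi> (- a) \<le> \<Psi> (b - a)" by (auto intro: Phi_mono)
    then show ?thesis by (simp add: Phi_minus)
  qed
qed

lemma Phi_tendsto_0: "(\<Psi> \<longlongrightarrow> 0) (at_right 0)"
proof -
  have "\<phi> integrable_on {0..1}"
    using set_borel_integral_eq_integral(1)[OF kernel_integrable] .
  then have "continuous_on {0..1} (\<lambda>x. integral {0..x} \<phi>)"
    by (rule indefinite_integral_continuous_1)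
  moreover have "integral {0..x} \<phi> = \<Psi> x" if "0 \<le> x" for x
    using that set_borel_integral_eq_integral(2)[OF kernel_integrable[of 0 x]]
    by (simp add: Phi_def interval_integral_Icc)
  ultimately have "continuous_on {0..1} \<Psi>"
    by (subst (asm) continuous_on_cong[OF refl]) auto
  then have "(\<Psi> \<longlongrightarrow> \<Psi> 0) (at 0 within {0..1})"
    unfolding continuous_on_def by (rule bspec) simp
  then have "(\<Psi> \<longlongrightarrow> \<Psi> 0) (at_right 0)"
    by (subst (asm) at_within_Icc_at_right) auto
  then show ?thesis by simp
qed

text \<open>Provides the distance below which the difference of drifts cannot outweigh the
  difference of slopes.\<close>

lemma Phi_small:
  assumes "0 < \<epsilon>"
  obtains c where "0 < c" "\<Psi> c < \<epsilon>"
proof -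
  have "eventually (\<lambda>c. \<Psi> c < \<epsilon>) (at_right 0)"
    using order_tendstoD(2)[OF Phi_tendsto_0 assms] .
  then obtain b where "0 < b" "\<And>c. 0 < c \<Longrightarrow> c < b \<Longrightarrow> \<Psi> c < \<epsilon>"
    by (auto simp: eventually_at_right_field)
  then show ?thesis using that[of "b / 2"] by simp
qed

lemma Phi_measurable [measurable]: "\<Psi> \<in> borel_measurable borel"
  by (intro borel_measurable_mono monoI Phi_mono)

end

section \<open>Supporting slopes and the convex envelope\<close>

abbreviation "J \<equiv> {- 1/2..1/2::real}"

locale lipschitz_flux =
  fixes A :: "real \<Rightarrow> real" and \<Lambda> :: real
  assumes flux_lipschitz: "\<And>x y. x \<in> J \<Longrightarrow> y \<in> J \<Longrightarrow> \<bar>A x - A y\<bar> \<le> \<Lambda> * \<bar>x - y\<bar>"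
begin

lemma Lip_nonneg: "0 \<le> \<Lambda>"
  using flux_lipschitz[of "-1/2" "1/2"] by simp

lemma flux_continuous: "continuous_on J A"
  by (rule lipschitz_on_continuous_on[of \<Lambda>], rule lipschitz_onI)
    (auto simp: dist_real_def Lip_nonneg intro: flux_lipschitz)

abbreviation "env \<equiv> convex_envelope A"

lemma envelope_le:
  assumes "m \<in> J"
  shows "env m \<le> A m"
proof -
  \<comment> \<open>A supremum of reals is meaningful only over a nonempty set; the constant minimum
    of \<open>A\<close> is an admissible minorant.\<close>
  obtain n where n: "n \<in> J" "\<forall>y\<in>J. A n \<le> A y"
    using continuous_attains_inf[OF compact_Icc _ flux_continuous] by auto
  have "convex_on J (\<lambda>_. A n)"
    by (simp add: convex_on_const)
  with n have "{g m |g. convex_on J g \<and> (\<forall>y\<in>J. g y \<le> A y)} \<noteq> {}"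
    by blast
  then show ?thesis
    unfolding convex_envelope_def using assms by (intro cSup_least) auto
qed

lemma envelope_ge:
  assumes "m \<in> J" "convex_on J g" "\<And>y. y \<in> J \<Longrightarrow> g y \<le> A y"
  shows "g m \<le> env m"
  unfolding convex_envelope_def using assms by (intro cSup_upper bdd_aboveI[of _ "A m"]) auto

lemma envelope_ge_affine:
  assumes "m \<in> J" "\<And>y. y \<in> J \<Longrightarrow> a * y + b \<le> A y"
  shows "a * m + b \<le> env m"
proof (rule envelope_ge[of m "\<lambda>y. a * y + b"])
  show "convex_on J (\<lambda>y. a * y + b)"
    by (auto simp: convex_on_def algebra_simps simp flip: distrib_right)
qed (use assms in auto)

text \<open>Each convex minorant is bounded at the intermediate point by the combination of envelope
  values; taking the supremum gives the claim.\<close>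

lemma envelope_convex: "convex_on J env"
  unfolding convex_on_def
proof (intro conjI ballI allI impI)
  fix x y u v :: real
  assume xy: "x \<in> J" "y \<in> J" and uv: "0 \<le> u" "0 \<le> v" "u + v = 1"
  then have z: "u *\<^sub>R x + v *\<^sub>R y \<in> J"
    using convexD[OF convex_real_interval(5)] by blast
  obtain n where n: "n \<in> J" "\<forall>y\<in>J. A n \<le> A y"
    using continuous_attains_inf[OF compact_Icc _ flux_continuous] by auto
  have "convex_on J (\<lambda>_. A n)"
    by (simp add: convex_on_const)
  then have ne: "{g (u *\<^sub>R x + v *\<^sub>R y) |g. convex_on J g \<and> (\<forall>y\<in>J. g y \<le> A y)} \<noteq> {}"
    using n by blast
  have "g (u *\<^sub>R x + v *\<^sub>R y) \<le> u * env x + v * env y"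
    if g: "convex_on J g" "\<forall>y\<in>J. g y \<le> A y" for g
  proof -
    have "g (u *\<^sub>R x + v *\<^sub>R y) \<le> u * g x + v * g y"
      using g(1) xy uv by (auto simp: convex_on_def)
    also have "\<dots> \<le> u * env x + v * env y"
      using g xy uv by (intro add_mono mult_left_mono envelope_ge) auto
    finally show ?thesis .
  qed
  then show "env (u *\<^sub>R x + v *\<^sub>R y) \<le> u * env x + v * env y"
    unfolding convex_envelope_def[of A "u *\<^sub>R x + v *\<^sub>R y"] by (intro cSup_least ne) auto
qed simp

lemma envelope_chord:
  assumes "x \<in> J" "z \<in> J" "x < z" "x \<le> y" "y \<le> z"
  shows "env y * (z - x) \<le> env x * (z - y) + env z * (y - x)"
proof -
  have "env y \<le> (env z - env x) / (z - x) * (y - x) + env x"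
    by (rule convex_onD_Icc') (use assms envelope_convex in \<open>auto intro: convex_on_subset\<close>)
  then have "env y * (z - x) \<le> ((env z - env x) / (z - x) * (y - x) + env x) * (z - x)"
    using assms by (intro mult_right_mono) auto
  also have "\<dots> = env x * (z - y) + env z * (y - x)"
    using assms by (simp add: divide_simps) (simp add: algebra_simps)
  finally show ?thesis .
qed

section \<open>Supporting lines and maximal affine pieces of the envelope\<close>

definition supporting_slope :: "real \<Rightarrow> real \<Rightarrow> bool" where
  "supporting_slope n p \<longleftrightarrow> (\<forall>m\<in>J. A n + p * (m - n) \<le> A m)"

text \<open>A minimiser \<open>n\<close> of \<open>A m - p m\<close> has \<open>p\<close> as a supporting slope; strict convexity of the envelope
  around \<open>b\<close> keeps \<open>n\<close> inside the interval.\<close>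
lemma supporting_point_between:
  assumes J: "m1 \<in> J" "m2 \<in> J" and b: "m1 < b" "b < m2"
    and p: "env b - env m1 < p * (b - m1)" "p * (m2 - b) < env m2 - env b"
  obtains n where "m1 < n" "n < m2" "supporting_slope n p"
proof -
  have cont: "continuous_on J (\<lambda>m. A m - p * m)"
    by (intro continuous_intros flux_continuous)
  obtain n where n: "n \<in> J" "\<forall>m\<in>J. A n - p * n \<le> A m - p * m"
    using continuous_attains_inf[OF compact_Icc _ cont] by auto
  have bJ: "b \<in> J" using J b by auto
  \<comment> \<open>The line touching \<open>A\<close> at \<open>n\<close> is a minorant, so
    minimality passes to the envelope: \<open>env m - p * m\<close> is at \<open>n\<close> no larger
    than at \<open>b\<close>. If \<open>n\<close> lay outside the interval, the chord inequality
    would make it at \<open>m1\<close> or \<open>m2\<close> no larger than at \<open>b\<close>,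
    against \<open>p\<close>.\<close>
  have "p * b + (A n - p * n) \<le> env b"
    by (rule envelope_ge_affine) (use n bJ in \<open>auto simp: algebra_simps\<close>)
  moreover have "env n \<le> A n" by (rule envelope_le) fact
  ultimately have *: "env n - p * n \<le> env b - p * b" by simp
  have "m1 < n"
  proof (rule ccontr)
    assume "\<not> m1 < n"
    then have "env m1 * (b - n) \<le> env n * (b - m1) + env b * (m1 - n)"
      using n bJ b by (intro envelope_chord) auto
    also have "env n * (b - m1) \<le> (env b - p * b + p * n) * (b - m1)"
      using * b by (intro mult_right_mono) auto
    also have "(env b - p * b + p * n) * (b - m1) + env b * (m1 - n) = (env b - p * (b - m1)) * (b - n)"
      by (simp add: algebra_simps)
    finally have "env m1 \<le> env b - p * (b - m1)"
      using \<open>\<not> m1 < n\<close> b by (simp add: mult_le_cancel_right)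
    with p show False by simp
  qed
  moreover have "n < m2"
  proof (rule ccontr)
    assume "\<not> n < m2"
    then have "env m2 * (n - b) \<le> env b * (n - m2) + env n * (m2 - b)"
      using n bJ b by (intro envelope_chord) auto
    also have "env n * (m2 - b) \<le> (env b - p * b + p * n) * (m2 - b)"
      using * b by (intro mult_right_mono) auto
    also have "env b * (n - m2) + (env b - p * b + p * n) * (m2 - b) = (env b + p * (m2 - b)) * (n - b)"
      by (simp add: algebra_simps)
    finally have "env m2 \<le> env b + p * (m2 - b)"
      using \<open>\<not> n < m2\<close> b by (simp add: mult_le_cancel_right)
    with p show False by simp
  qed
  moreover have "supporting_slope n p"
    using n by (auto simp: supporting_slope_def algebra_simps)
  ultimately show ?thesis by (rule that)
qed

text \<open>A convex function that is never strictly below its chord coincides with it. At a point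
  \<open>b\<close> strictly below, the chord on the left is less steep than the one on the right,
  and every slope strictly between the two touches inside the interval.\<close>

lemma supporting_slopes_if_not_affine:
  assumes J: "m1 \<in> J" "m2 \<in> J" and less: "m1 < m2" and nonaffine: "\<not> affine_on {m1<..m2} env"
  obtains n1 n2 p1 p2 where "m1 < n1" "n1 \<le> n2" "n2 < m2" "p1 < p2"
    "supporting_slope n1 p1" "supporting_slope n2 p2"
proof -
  have "\<exists>b. m1 < b \<and> b < m2 \<and> env b * (m2 - m1) < env m1 * (m2 - b) + env m2 * (b - m1)"
  proof (rule ccontr)
    assume no: "\<not> ?thesis"
    have eq: "env b * (m2 - m1) = env m1 * (m2 - b) + env m2 * (b - m1)" if "m1 < b" "b \<le> m2" for b
    proof (cases "b = m2")
      case False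
      with that have "b < m2" by simp
      with that(1) no have "env m1 * (m2 - b) + env m2 * (b - m1) \<le> env b * (m2 - m1)"
        by (meson not_less)
      moreover have "env b * (m2 - m1) \<le> env m1 * (m2 - b) + env m2 * (b - m1)"
        using that by (intro envelope_chord[OF J less]) auto
      ultimately show ?thesis by (rule antisym[rotated])
    qed simp
    have "env b = (env m2 - env m1) / (m2 - m1) * b + (env m1 * m2 - env m2 * m1) / (m2 - m1)"
      if "m1 < b" "b \<le> m2" for b
    proof -
      have "env b * (m2 - m1) = (env m2 - env m1) * b + (env m1 * m2 - env m2 * m1)"
        unfolding eq[OF that] by (simp add: algebra_simps)
      then have "env b = ((env m2 - env m1) * b + (env m1 * m2 - env m2 * m1)) / (m2 - m1)"
        using less by (simp add: eq_divide_eq)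
      then show ?thesis by (simp add: add_divide_distrib)
    qed
    then have "affine_on {m1<..m2} env"
      unfolding affine_on_def by (meson greaterThanAtMost_iff)
    with nonaffine show False ..
  qed
  then obtain b where b: "m1 < b" "b < m2" "env b * (m2 - m1) < env m1 * (m2 - b) + env m2 * (b - m1)"
    by blast
  let ?\<alpha> = "(env b - env m1) / (b - m1)" and ?\<beta> = "(env m2 - env b) / (m2 - b)"
  have "(env b - env m1) * (m2 - b) < (env m2 - env b) * (b - m1)"
    using b(3) by (simp add: algebra_simps)
  then have "?\<alpha> < ?\<beta>"
    using b(1,2) by (simp add: pos_divide_less_eq pos_less_divide_eq)
  then obtain p1 p2 where p: "?\<alpha> < p1" "p1 < p2" "p2 < ?\<beta>"
    by (meson dense)
  have between: "env b - env m1 < p * (b - m1)" "p * (m2 - b) < env m2 - env b"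
    if "?\<alpha> < p" "p < ?\<beta>" for p
    using that b(1,2) by (auto simp: pos_divide_less_eq pos_less_divide_eq)
  obtain n1 where n1: "m1 < n1" "n1 < m2" "supporting_slope n1 p1"
    using supporting_point_between[OF J b(1,2) between[of p1]] p by auto
  obtain n2 where n2: "m1 < n2" "n2 < m2" "supporting_slope n2 p2"
    using supporting_point_between[OF J b(1,2) between[of p2]] p by auto
  have "n1 \<in> J" "n2 \<in> J" using J n1 n2 by auto
  \<comment> \<open>Monotonicity of subgradients: adding the two supporting inequalities shows that
    the larger slope touches no further to the left.\<close>
  then have "A n1 + p1 * (n2 - n1) \<le> A n2" "A n2 + p2 * (n1 - n2) \<le> A n1"
    using n1 n2 by (auto simp: supporting_slope_def)
  then have "(p2 - p1) * (n1 - n2) \<le> 0" by (simp add: algebra_simps)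
  then have "n1 \<le> n2" using p by (simp add: mult_le_0_iff)
  with n1 n2 p that show ?thesis by blast
qed

text \<open>Convexity gives continuity in the interior but would allow an upward jump at 1/2. There
  the Lipschitz bound yields a minorant of slope \<open>\<Lambda>\<close> touching \<open>A\<close>,
  and the envelope is squeezed between it and \<open>A\<close>.\<close>

lemma envelope_tendsto_left:
  assumes "- 1/2 < b" "b \<le> 1/2"
  shows "(env \<longlongrightarrow> env b) (at_left b)"
proof (cases "b < 1/2")
  case True
  have "convex_on {- 1/2<..<1/2} env"
    by (rule convex_on_subset[OF envelope_convex]) auto
  then have "continuous_on {- 1/2<..<1/2} env"
    by (intro convex_on_continuous) auto
  with assms True have "isCont env b"
    by (simp add: continuous_on_eq_continuous_at)
  then show ?thesis
    by (auto simp: isCont_def filterlim_at_split)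
next
  case False
  with assms have b: "b = 1/2" by simp
  have lower: "\<Lambda> * x + (A b - \<Lambda> * b) \<le> env x" if "x \<in> J" for x
  proof (rule envelope_ge_affine[OF that])
    fix y assume "y \<in> J"
    then have "A b - A y \<le> \<Lambda> * (b - y)"
      using flux_lipschitz[of "1/2" y] unfolding b by (auto simp: abs_le_iff)
    then show "\<Lambda> * y + (A b - \<Lambda> * b) \<le> A y"
      by (simp add: algebra_simps)
  qed
  have "env b = A b"
    using lower[of b] envelope_le[of b] unfolding b by simp
  have ev: "eventually (\<lambda>x. x \<in> J) (at_left b)"
    using eventually_at_left_real[of "- 1/2" b] unfolding b by (rule eventually_mono) auto
  show ?thesis
    unfolding \<open>env b = A b\<close>
  proof (rule tendsto_sandwich)
    show "eventually (\<lambda>x. \<Lambda> * x + (A b - \<Lambda> * b) \<le> env x) (at_left b)"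
      using ev by eventually_elim (rule lower)
    show "eventually (\<lambda>x. env x \<le> A x) (at_left b)"
      using ev by eventually_elim (rule envelope_le)
    have "((\<lambda>x. \<Lambda> * x + (A b - \<Lambda> * b)) \<longlongrightarrow> \<Lambda> * b + (A b - \<Lambda> * b)) (at_left b)"
      by (intro tendsto_intros)
    then show "((\<lambda>x. \<Lambda> * x + (A b - \<Lambda> * b)) \<longlongrightarrow> A b) (at_left b)" by simp
    have "(A \<longlongrightarrow> A b) (at b within J)"
      using flux_continuous b by (auto simp: continuous_on_def)
    then show "(A \<longlongrightarrow> A b) (at_left b)"
      unfolding b by (subst (asm) at_within_Icc_at_left) auto
  qed
qed

text \<open>\<open>GREATEST\<close> has content only if a largest interval exists. The union of all
  admissible intervals around \<open>m2\<close> is one: they overlap to the left of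
  \<open>m2\<close>, so all carry the same line, and continuity from the left adds the right
  endpoint.\<close>

lemma affine_envelope_imp_linear_piece:
  assumes less: "- 1/2 \<le> m1" "m1 < m2" "m2 \<le> 1/2" and aff: "affine_on {m1<..m2} env"
  shows "Inf (linear_piece A m2) \<le> m1"
proof -
  obtain \<alpha> \<beta> where line: "\<And>x. m1 < x \<Longrightarrow> x \<le> m2 \<Longrightarrow> env x = \<alpha> * x + \<beta>"
    using aff by (auto simp: affine_on_def)
  define S where "S = {(a, b). - 1/2 \<le> a \<and> a < b \<and> b \<le> 1/2 \<and> a < m2 \<and> m2 \<le> b \<and> affine_on {a<..b} env}"
  have S_line: "env x = \<alpha> * x + \<beta>" if "(a, b) \<in> S" "a < x" "x \<le> b" for a b x
  proof -
    obtain \<alpha>' \<beta>' where line': "\<And>x. a < x \<Longrightarrow> x \<le> b \<Longrightarrow> env x = \<alpha>' * x + \<beta>'"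
      using \<open>(a, b) \<in> S\<close> by (auto simp: affine_on_def S_def)
    \<comment> \<open>Two points common to both intervals, \<open>y\<close> and \<open>m2\<close>,
      determine the line.\<close>
    obtain y where y: "max a m1 < y" "y < m2"
      using dense[of "max a m1" m2] \<open>(a, b) \<in> S\<close> less by (auto simp: S_def)
    have "\<alpha>' * y + \<beta>' = \<alpha> * y + \<beta>" "\<alpha>' * m2 + \<beta>' = \<alpha> * m2 + \<beta>"
      using that less y line[of y] line'[of y] line[of m2] line'[of m2] by (auto simp: S_def)
    then have "(\<alpha>' - \<alpha>) * (m2 - y) = 0" by (simp add: algebra_simps)
    then have "\<alpha>' = \<alpha>" using y by simp
    moreover from this have "\<beta>' = \<beta>" using \<open>\<alpha>' * m2 + \<beta>' = \<alpha> * m2 + \<beta>\<close> by simp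
    ultimately show ?thesis using line' that by simp
  qed
  have mem: "(m1, m2) \<in> S" using assms by (auto simp: S_def)
  define a where "a = Inf (fst ` S)"
  define b where "b = Sup (snd ` S)"
  have bdd: "bdd_below (fst ` S)" "bdd_above (snd ` S)"
    by (auto simp: S_def intro!: bdd_belowI[of _ "-1/2"] bdd_aboveI[of _ "1/2"])
  have S_sub: "a \<le> x \<and> y \<le> b" if "(x, y) \<in> S" for x y
    unfolding a_def b_def using that bdd
    by (metis cInf_lower cSup_upper fst_conv image_eqI snd_conv)
  have ab: "- 1/2 \<le> a" "a \<le> m1" "m2 \<le> b" "b \<le> 1/2"
  proof -
    show "- 1/2 \<le> a" unfolding a_def using mem by (intro cInf_greatest) (auto simp: S_def)
    show "b \<le> 1/2" unfolding b_def using mem by (intro cSup_least) (auto simp: S_def)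
  qed (use S_sub[OF mem] in auto)
  have open_line: "env x = \<alpha> * x + \<beta>" if x: "a < x" "x < b" for x
  proof (cases "x \<le> m2")
    case True
    obtain y z where "(y, z) \<in> S" "y < x"
      using x mem cInf_lessD[of "fst ` S" x] unfolding a_def by force
    with True S_line[of y z x] show ?thesis by (auto simp: S_def)
  next
    case False
    obtain y z where "(y, z) \<in> S" "x < z"
      using x mem less_cSupD[of "snd ` S" x] unfolding b_def by force
    with False S_line[of y z x] show ?thesis by (auto simp: S_def)
  qed
  have "env b = \<alpha> * b + \<beta>"
  proof (rule tendsto_unique[of "at_left b"])
    show "(env \<longlongrightarrow> env b) (at_left b)"
      using ab less by (intro envelope_tendsto_left) auto
    have "eventually (\<lambda>x. x \<in> {a<..<b}) (at_left b)"
      using ab less by (intro eventually_at_left_real) auto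
    then have "eventually (\<lambda>x. \<alpha> * x + \<beta> = env x) (at_left b)"
      by eventually_elim (simp add: open_line)
    moreover have "((\<lambda>x. \<alpha> * x + \<beta>) \<longlongrightarrow> \<alpha> * b + \<beta>) (at_left b)"
      by (intro tendsto_intros)
    ultimately show "(env \<longlongrightarrow> \<alpha> * b + \<beta>) (at_left b)"
      using Lim_transform_eventually by blast
  qed simp
  with open_line have "env x = \<alpha> * x + \<beta>" if "a < x" "x \<le> b" for x
    using that by (cases "x = b") auto
  then have aff_ab: "affine_on {a<..b} env"
    by (auto simp: affine_on_def)
  have "m2 \<notin> Sigma_plus A"
    using aff less by (auto simp: Sigma_plus_def)
  moreover have "(GREATEST I. m2 \<in> I \<and> affine_on I env \<and>
      (\<exists>a b. - 1/2 \<le> a \<and> a < b \<and> b \<le> 1/2 \<and> I = {a<..b})) = {a<..b}"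
  proof (rule Greatest_equality)
    show "m2 \<in> {a<..b} \<and> affine_on {a<..b} env \<and>
      (\<exists>a' b'. - 1/2 \<le> a' \<and> a' < b' \<and> b' \<le> 1/2 \<and> {a<..b} = {a'<..b'})"
      using ab less aff_ab by (intro conjI exI[of _ a] exI[of _ b]) auto
  next
    fix I
    assume "m2 \<in> I \<and> affine_on I env \<and> (\<exists>a b. - 1/2 \<le> a \<and> a < b \<and> b \<le> 1/2 \<and> I = {a<..b})"
    then obtain x y where "I = {x<..y}" "(x, y) \<in> S"
      by (auto simp: S_def)
    with S_sub[of x y] show "I \<subseteq> {a<..b}" by auto
  qed
  ultimately have "linear_piece A m2 = {a<..b}"
    by (simp add: linear_piece_def)
  then show ?thesis
    using ab less by simp
qed

text \<open>Testing the support at \<open>n2\<close> further right, at \<open>m2\<close>, forces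
  \<open>p2 \<le> q\<close>; testing the one at \<open>n1\<close> further left, at
  \<open>m1\<close>, forces \<open>q \<le> p1\<close>.\<close>

lemma no_two_slopes_if_affine:
  assumes "supporting_slope n1 p1" "supporting_slope n2 p2" "p1 < p2"
    and J: "m1 \<in> J" "m2 \<in> J" and n: "m1 < n1" "n1 \<le> n2" "n2 < m2"
    and aff: "\<And>m. m1 \<le> m \<Longrightarrow> m \<le> m2 \<Longrightarrow> A m = q * m + r"
  shows False
proof -
  have "A n1 + p1 * (m2 - n1) \<le> A m2" "A n2 + p2 * (m2 - n2) \<le> A m2"
    "A n1 + p1 * (m1 - n1) \<le> A m1" "A n2 + p2 * (m1 - n2) \<le> A m1"
    using assms(1,2) J unfolding supporting_slope_def by blast+
  moreover have "A n1 = q * n1 + r" "A n2 = q * n2 + r" "A m1 = q * m1 + r" "A m2 = q * m2 + r"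
    using n by (auto intro: aff)
  ultimately have "0 \<le> (q - p2) * (m2 - n2)" "0 \<le> (p1 - q) * (n1 - m1)"
    by (simp_all add: algebra_simps)
  then have "p2 \<le> q" "q \<le> p1"
    using n by (auto simp: zero_le_mult_iff)
  with \<open>p1 < p2\<close> show False by simp
qed

end

section \<open>Quantile representation\<close>

text \<open>Strict inequality on the left and weak inequality on the right fit the right-continuous
  distribution function of a measure on [-R, R] that may have atoms at both ends.\<close>

locale distribution_profile =
  fixes F :: "real \<Rightarrow> real" and R :: real
  assumes profile_mono: "mono F"
    and profile_right_cont: "continuous (at_right x) F"
    and profile_left: "x < - R \<Longrightarrow> F x = - 1/2"
    and profile_right: "R \<le> x \<Longrightarrow> F x = 1/2"
begin

lemma profile_le: "x \<le> y \<Longrightarrow> F x \<le> F y"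
  using profile_mono by (rule monoD)

lemma profile_bounds: "- 1/2 \<le> F x" "F x \<le> 1/2"
proof -
  have "F (min x (- R - 1)) = - 1/2" "F (max x R) = 1/2"
    by (subst profile_left profile_right; simp)+
  then show "- 1/2 \<le> F x" "F x \<le> 1/2"
    using profile_le[of "min x (- R - 1)" x] profile_le[of x "max x R"] by auto
qed

lemma profile_in_J: "F x \<in> J"
  using profile_bounds[of x] by simp

lemma radius_nonneg: "0 \<le> R"
  using profile_right[of R] profile_left[of R] by force

abbreviation "Q \<equiv> quantile F"

text \<open>Right continuity makes the infimum attained, so \<open>Q\<close> is a lower adjoint of
  \<open>F\<close>. Statements about quantiles and about values of \<open>F\<close> are exchanged
  through this equivalence.\<close>

lemma quantile_le_iff:
  assumes "- 1/2 < m" "m \<le> 1/2"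
  shows "Q m \<le> x \<longleftrightarrow> m \<le> F x"
proof
  let ?S = "{x. m \<le> F x}"
  have bdd: "bdd_below ?S"
  proof (rule bdd_belowI)
    fix x assume "x \<in> ?S"
    with assms profile_left[of x] show "- R \<le> x" by force
  qed
  have ne: "?S \<noteq> {}"
    using assms profile_right[of R] by (auto intro!: exI[of _ R])
  show "m \<le> F x \<Longrightarrow> Q m \<le> x"
    unfolding quantile_def using bdd by (intro cInf_lower) auto
  assume le: "Q m \<le> x"
  have "m \<le> (INF s\<in>?S. F s)"
    by (rule cINF_greatest[OF ne]) auto
  also have "\<dots> = F (Inf ?S)"
    using continuous_at_Inf_mono[OF profile_mono profile_right_cont ne bdd] ..
  also have "\<dots> \<le> F x"
    using le by (intro profile_le) (simp add: quantile_def)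
  finally show "m \<le> F x" .
qed

lemma less_quantile_iff:
  assumes "- 1/2 < m" "m \<le> 1/2"
  shows "x < Q m \<longleftrightarrow> F x < m"
  using quantile_le_iff[OF assms, of x] by linarith

lemma quantile_bounds:
  assumes "- 1/2 < m" "m \<le> 1/2"
  shows "- R \<le> Q m" "Q m \<le> R"
proof -
  show "Q m \<le> R"
    using assms profile_right[of R] by (subst quantile_le_iff) auto
  show "- R \<le> Q m"
  proof (rule ccontr)
    assume "\<not> - R \<le> Q m"
    then have "F (Q m) = - 1/2" by (intro profile_left) simp
    with assms quantile_le_iff[of m "Q m"] show False by simp
  qed
qed

lemma quantile_mono:
  assumes "- 1/2 < m" "m \<le> n" "n \<le> 1/2"
  shows "Q m \<le> Q n"
proof -
  have "n \<le> F (Q n)"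
    using assms quantile_le_iff[of n "Q n"] by simp
  then show ?thesis
    using assms by (subst quantile_le_iff) auto
qed

lemma quantile_measurable:
  assumes "a \<in> J" "b \<in> J"
  shows "Q \<in> borel_measurable (restrict_space lborel {a<..b})"
proof -
  have "Q \<in> borel_measurable (restrict_space borel {a<..b})"
    by (intro borel_measurable_mono_on_fnc mono_onI quantile_mono) (use assms in auto)
  then show ?thesis
    by (simp cong: measurable_cong_sets)
qed

text \<open>Up to an additive constant, this is the distribution function of the image under
  \<open>Q\<close> of Lebesgue measure on (a, b].\<close>

definition clamp_profile :: "real \<Rightarrow> real \<Rightarrow> real \<Rightarrow> real" where
  "clamp_profile a b x = max a (min b (F x))"

text \<open>Within (a, b], the preimage of (x, y] under \<open>Q\<close> is the interval between the
  two clamped values, so both measures agree on a generator.\<close>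

lemma distr_quantile:
  assumes J: "a \<in> J" "b \<in> J" "a \<le> b"
    and N: "sets N = sets borel"
      "\<And>x y. x \<le> y \<Longrightarrow> emeasure N {x<..y} = ennreal (clamp_profile a b y - clamp_profile a b x)"
  shows "N = distr (restrict_space lborel {a<..b}) borel Q"
proof (rule measure_eqI_generator_eq[where \<Omega> = UNIV and E = "range (\<lambda>(x, y). {x<..y::real})"
      and A = "\<lambda>i. {- real i<..real i}"])
  show "Int_stable (range (\<lambda>(x, y). {x<..y::real}))"
    by (auto simp: Int_stable_def)
  show "sets N = sigma_sets UNIV (range (\<lambda>(x, y). {x<..y}))"
    "sets (distr (restrict_space lborel {a<..b}) borel Q) = sigma_sets UNIV (range (\<lambda>(x, y). {x<..y}))"
    using N by (simp_all add: borel_sigma_sets_Ioc)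
  show "(\<Union>i. {- real i<..real i}) = UNIV"
    by (rule UN_Ioc_eq_UNIV)
  show "emeasure N {- real i<..real i} \<noteq> \<infinity>" for i
    by (subst N) auto
next
  fix I assume "I \<in> range (\<lambda>(x, y). {x<..y::real})"
  then obtain x y where I: "I = {x<..y}" by auto
  show "emeasure N I = emeasure (distr (restrict_space lborel {a<..b}) borel Q) I"
  proof (cases "x \<le> y")
    case True
    have "Q -` {x<..y} \<inter> {a<..b} = {clamp_profile a b x<..clamp_profile a b y}"
    proof (rule set_eqI)
      fix m
      show "m \<in> Q -` {x<..y} \<inter> {a<..b} \<longleftrightarrow> m \<in> {clamp_profile a b x<..clamp_profile a b y}"
        using J quantile_le_iff[of m y] less_quantile_iff[of m x]
        by (auto simp: clamp_profile_def)
    qed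
    moreover have "{clamp_profile a b x<..clamp_profile a b y} \<subseteq> {a<..b}"
      using J by (auto simp: clamp_profile_def)
    ultimately have "emeasure (distr (restrict_space lborel {a<..b}) borel Q) I
        = emeasure lborel {clamp_profile a b x<..clamp_profile a b y}"
      unfolding I using J
      by (subst emeasure_distr)
        (simp_all add: quantile_measurable emeasure_restrict_space space_restrict_space)
    then show ?thesis
      using True I J N(2)[of x y] profile_le[of x y] by (auto simp: clamp_profile_def)
  next
    case False
    then have "I = {}" using I by auto
    then show ?thesis by simp
  qed
qed auto

lemma integral_distr_quantile:
  fixes g :: "real \<Rightarrow> real"
  assumes "a \<in> J" "b \<in> J" "g \<in> borel_measurable borel"
  shows "(\<integral>x. g x \<partial>distr (restrict_space lborel {a<..b}) borel Q) = (LBINT m:{a<..b}. g (Q m))"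
  using assms quantile_measurable[of a b]
  by (subst integral_distr) (auto simp: integral_restrict_space set_lebesgue_integral_def)

section \<open>Stieltjes measures as images of Lebesgue measure\<close>

lemma interval_measure_quantile:
  assumes "a \<in> J" "b \<in> J" "a \<le> b"
  shows "interval_measure (\<lambda>x. clamp_profile a b x + c) = distr (restrict_space lborel {a<..b}) borel Q"
proof (rule distr_quantile)
  fix x y :: real assume "x \<le> y"
  then have "emeasure (interval_measure (\<lambda>x. clamp_profile a b x + c)) {x<..y} =
      ennreal ((clamp_profile a b y + c) - (clamp_profile a b x + c))"
    unfolding clamp_profile_def[abs_def]
    by (intro emeasure_interval_measure_Ioc add_mono max.mono min.mono profile_le
        continuous_intros profile_right_cont) auto
  then show "emeasure (interval_measure (\<lambda>x. clamp_profile a b x + c)) {x<..y} =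
      ennreal (clamp_profile a b y - clamp_profile a b x)" by simp
qed (use assms in auto)

text \<open>Both monotone parts of \<bar>F - \<alpha>\<bar> are clamped profiles minus a constant.
  Hence the signed measure becomes Lebesgue measure on the levels above \<open>\<alpha>\<close>
  minus that on the levels below.\<close>

lemma integral_deriv_abs_quantile:
  assumes "\<alpha> \<in> J" and g: "g \<in> borel_measurable borel"
  shows "integral_deriv_abs F \<alpha> g = (LBINT m:{\<alpha><..1/2}. g (Q m)) - (LBINT m:{-1/2<..\<alpha>}. g (Q m))"
proof -
  have "max (F x - \<alpha>) 0 = clamp_profile \<alpha> (1/2) x + - \<alpha>" for x
    using profile_bounds[of x] assms by (auto simp: clamp_profile_def)
  moreover have "min (F x - \<alpha>) 0 = clamp_profile (-1/2) \<alpha> x + - \<alpha>" for x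
    using profile_bounds[of x] assms by (auto simp: clamp_profile_def)
  ultimately show ?thesis
    unfolding integral_deriv_abs_def using assms
    by (simp add: interval_measure_quantile integral_distr_quantile del: add_uminus_conv_diff)
qed

lemma distr_quantile_prob:
  assumes N: "borel_prob N" "\<And>x. F x = shifted_cdf N x"
  shows "N = distr (restrict_space lborel {-1/2<..1/2}) borel Q"
proof (rule distr_quantile)
  interpret prob_space N using N by (simp add: borel_prob_def)
  have s: "sets N = sets borel" using N by (simp add: borel_prob_def)
  fix x y :: real assume "x \<le> y"
  then have "{x<..y} = {..y} - {..x}" by auto
  then have "measure N {x<..y} = measure N {..y} - measure N {..x}"
    using \<open>x \<le> y\<close> s by (simp add: finite_measure_Diff)
  then show "emeasure N {x<..y} = ennreal (clamp_profile (-1/2) (1/2) y - clamp_profile (-1/2) (1/2) x)"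
    using profile_bounds[of x] profile_bounds[of y] N(2)[of x] N(2)[of y]
    by (simp add: emeasure_eq_measure clamp_profile_def shifted_cdf_def)
qed (use assms in \<open>auto simp: borel_prob_def\<close>)

end

lemma distribution_profile_shifted_cdf:
  assumes N: "borel_prob N" "emeasure N (- {-R..R}) = 0" and F: "\<And>x. F x = shifted_cdf N x"
  shows "distribution_profile F R"
proof
  interpret prob_space N using N by (simp add: borel_prob_def)
  have s: "sets N = sets borel" using N by (simp add: borel_prob_def)
  have sp: "space N = UNIV" using sets_eq_imp_space_eq[OF s] by simp
  have Feq: "F = shifted_cdf N" using F by auto
  interpret real_distribution N
    by (rule real_distribution.intro) (unfold_locales, use s sp in auto)
  have null: "- {-R..R} \<in> null_sets N"
    using N s by (auto simp: null_sets_def)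
  show "mono F"
    unfolding Feq shifted_cdf_def using s by (intro monoI add_mono finite_measure_mono) auto
  show "continuous (at_right x) F" for x
    using cdf_is_right_cont[of x] unfolding Feq shifted_cdf_def[abs_def] cdf_def[abs_def]
    by (intro continuous_intros)
  show "F x = - 1/2" if "x < - R" for x
  proof -
    have "{..x} \<in> null_sets N"
      using null that by (rule_tac null_sets_subset[OF null]) (auto simp: s)
    then show ?thesis by (simp add: F shifted_cdf_def null_sets_def measure_def)
  qed
  show "F x = 1/2" if "R \<le> x" for x
  proof -
    have "{x<..} \<in> null_sets N"
      using null that by (rule_tac null_sets_subset[OF null]) (auto simp: s)
    then have "measure N {x<..} = 0" by (simp add: null_sets_def measure_def)
    moreover have "{..x} = space N - {x<..}" by (auto simp: sp)
    ultimately have "measure N {..x} = 1"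
      using prob_compl[of "{x<..}"] s by simp
    then show ?thesis by (simp add: F shifted_cdf_def)
  qed
qed

section \<open>Drift and initial flux\<close>

lemma set_integrable_bounded:
  fixes g :: "real \<Rightarrow> real"
  assumes "S \<in> sets borel" "emeasure lborel S < \<infinity>" "g \<in> borel_measurable (restrict_space lborel S)"
    and "AE x in lborel. x \<in> S \<longrightarrow> \<bar>g x\<bar> \<le> B"
  shows "set_integrable lborel S g"
  unfolding set_integrable_def
proof (rule integrableI_bounded_set[where A = S and B = B])
  show "(\<lambda>x. indicator S x *\<^sub>R g x) \<in> borel_measurable lborel"
    using assms by (subst (asm) borel_measurable_restrict_space_iff) auto
  show "AE x in lborel. x \<in> S \<longrightarrow> norm (indicator S x *\<^sub>R g x) \<le> B"
    using assms(4) by eventually_elim auto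
qed (use assms in auto)

lemma set_integral_abs_le:
  fixes g :: "real \<Rightarrow> real"
  assumes S: "set_integrable lborel S g" "S \<in> sets borel" "emeasure lborel S < \<infinity>"
    and "AE x in lborel. x \<in> S \<longrightarrow> \<bar>g x\<bar> \<le> B"
  shows "\<bar>LBINT x:S. g x\<bar> \<le> B * measure lborel S"
proof -
  have "\<bar>LBINT x:S. g x\<bar> \<le> (LBINT x. \<bar>indicator S x *\<^sub>R g x\<bar>)"
    unfolding set_lebesgue_integral_def by (rule integral_abs_bound)
  also have "\<dots> \<le> (LBINT x. B * indicator S x)"
  proof (rule integral_mono_AE)
    show "integrable lborel (\<lambda>x. \<bar>indicator S x *\<^sub>R g x\<bar>)"
      using S(1) by (auto simp: set_integrable_def)
    show "AE x in lborel. \<bar>indicator S x *\<^sub>R g x\<bar> \<le> B * indicator S x"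
      using assms(4) by eventually_elim (auto simp: abs_mult split: split_indicator)
  qed (use S in auto)
  also have "\<dots> = B * measure lborel S"
    using S by simp
  finally show ?thesis .
qed

locale aligned_profile = alignment_potential \<phi> + distribution_profile F R
  for \<phi> F :: "real \<Rightarrow> real" and R :: real
begin

text \<open>The convolution of \<open>\<Psi>\<close> with the underlying measure, written in the
  mass variable. Comparing drifts of two profiles then amounts to comparing their quantiles level by
  level.\<close>

definition drift :: "real \<Rightarrow> real" where
  "drift x = (LBINT m:{-1/2<..1/2}. \<Psi> (x - Q m))"

lemma drift_integrable: "set_integrable lborel {-1/2<..1/2} (\<lambda>m. \<Psi> (x - Q m))"
proof (rule set_integrable_bounded[where B = "\<Psi> (\<bar>x\<bar> + R)"])
  show "(\<lambda>m. \<Psi> (x - Q m)) \<in> borel_measurable (restrict_space lborel {-1/2<..1/2})"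
    using quantile_measurable[of "-1/2" "1/2"] by measurable
  have "\<bar>\<Psi> (x - Q m)\<bar> \<le> \<Psi> (\<bar>x\<bar> + R)" if "- 1/2 < m" "m \<le> 1/2" for m
  proof -
    have "\<Psi> (x - Q m) \<le> \<Psi> (\<bar>x\<bar> + R)" "\<Psi> (- (x - Q m)) \<le> \<Psi> (\<bar>x\<bar> + R)"
      using quantile_bounds[OF that] by (auto intro!: Phi_mono)
    then show ?thesis by (simp add: Phi_minus abs_le_iff del: minus_diff_eq)
  qed
  then show "AE m in lborel. m \<in> {-1/2<..1/2} \<longrightarrow> \<bar>\<Psi> (x - Q m)\<bar> \<le> \<Psi> (\<bar>x\<bar> + R)"
    by simp
qed auto

lemma drift_le:
  assumes "\<And>m. - 1/2 < m \<Longrightarrow> m \<le> 1/2 \<Longrightarrow> \<Psi> (x - Q m) \<le> c"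
  shows "drift x \<le> c"
proof -
  have "drift x \<le> (LBINT m:{-1/2<..1/2::real}. c)"
    unfolding drift_def using assms
    by (intro set_integral_mono drift_integrable) (auto simp: set_integrable_def)
  then show ?thesis by (simp add: set_lebesgue_integral_def)
qed

lemma drift_ge:
  assumes "\<And>m. - 1/2 < m \<Longrightarrow> m \<le> 1/2 \<Longrightarrow> c \<le> \<Psi> (x - Q m)"
  shows "c \<le> drift x"
proof -
  have "(LBINT m:{-1/2<..1/2::real}. c) \<le> drift x"
    unfolding drift_def using assms
    by (intro set_integral_mono drift_integrable) (auto simp: set_integrable_def)
  then show ?thesis by (simp add: set_lebesgue_integral_def)
qed

lemma drift_mono: "x \<le> y \<Longrightarrow> drift x \<le> drift y"
  unfolding drift_def by (intro set_integral_mono drift_integrable Phi_mono) auto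

lemma drift_bounds: "drift x \<le> \<Psi> (x + R)" "\<Psi> (x - R) \<le> drift x"
  by (auto intro!: drift_le drift_ge Phi_mono dest: quantile_bounds)

lemma drift_diff_le:
  assumes "x \<le> y"
  shows "drift y - drift x \<le> 2 * \<Psi> (y - x)"
proof -
  have "drift y - drift x = (LBINT m:{-1/2<..1/2}. \<Psi> (y - Q m) - \<Psi> (x - Q m))"
    unfolding drift_def by (intro set_integral_diff(2)[symmetric] drift_integrable)
  also have "\<dots> \<le> (LBINT m:{-1/2<..1/2::real}. 2 * \<Psi> (y - x))"
  proof (rule set_integral_mono)
    show "set_integrable lborel {-1/2<..1/2} (\<lambda>m. \<Psi> (y - Q m) - \<Psi> (x - Q m))"
      by (intro set_integral_diff(1) drift_integrable)
    show "set_integrable lborel {-1/2<..1/2::real} (\<lambda>m. 2 * \<Psi> (y - x))"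
      by (simp add: set_integrable_def)
    show "\<Psi> (y - Q m) - \<Psi> (x - Q m) \<le> 2 * \<Psi> (y - x)" for m
      using Phi_diff_le[of "x - Q m" "y - Q m"] assms by simp
  qed
  also have "\<dots> = 2 * \<Psi> (y - x)"
    by (simp add: set_lebesgue_integral_def)
  finally show ?thesis .
qed

lemma conv_measure_eq_drift:
  assumes "borel_prob N" "\<And>x. F x = shifted_cdf N x"
  shows "conv_measure \<Psi> N x = drift x"
  unfolding conv_measure_def drift_def
  by (subst distr_quantile_prob[OF assms], subst integral_distr_quantile) auto

end

section \<open>Initial data in the mass variable\<close>

locale initial_data = aligned_profile \<phi> "shifted_cdf \<rho>0" R for \<phi> \<rho>0 R +
  fixes u0 :: "real \<Rightarrow> real"
  assumes prob: "borel_prob \<rho>0" and velocity: "ess_bounded \<rho>0 u0"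
begin

abbreviation "\<psi> m \<equiv> psi0 \<phi> \<rho>0 u0 (Q m)"

lemma psi_measurable: "\<psi> \<in> borel_measurable (restrict_space lborel {-1/2<..1/2})"
proof -
  have [measurable]: "u0 \<in> borel_measurable borel"
    using velocity prob by (simp add: ess_bounded_def borel_prob_def cong: measurable_cong_sets)
  have [measurable]: "drift \<in> borel_measurable borel"
    by (intro borel_measurable_mono monoI drift_mono)
  have "psi0 \<phi> \<rho>0 u0 = (\<lambda>x. u0 x + drift x)"
    by (auto simp: psi0_def conv_measure_eq_drift[OF prob])
  then show ?thesis
    using quantile_measurable[of "-1/2" "1/2"] by simp
qed

text \<open>\<open>u0\<close> is bounded only almost everywhere for \<rho>0; since \<rho>0 is the
  image of Lebesgue measure under \<open>Q\<close>, this becomes a bound for almost every level. The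
  convolution is bounded because point and quantiles all lie in the support interval.\<close>

lemma psi_bounded:
  obtains B where "0 \<le> B" "AE m in lborel. m \<in> {-1/2<..1/2} \<longrightarrow> \<bar>\<psi> m\<bar> \<le> B"
proof -
  have [measurable]: "u0 \<in> borel_measurable borel"
    using velocity prob by (simp add: ess_bounded_def borel_prob_def cong: measurable_cong_sets)
  obtain C where "AE x in \<rho>0. \<bar>u0 x\<bar> \<le> C"
    using velocity by (auto simp: ess_bounded_def)
  then have "AE x in distr (restrict_space lborel {-1/2<..1/2}) borel Q. \<bar>u0 x\<bar> \<le> C"
    by (subst (asm) distr_quantile_prob[OF prob refl])
  then have "AE m in restrict_space lborel {-1/2<..1/2}. \<bar>u0 (Q m)\<bar> \<le> C"
    using quantile_measurable[of "-1/2" "1/2"] by (subst (asm) AE_distr_iff) auto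
  then have "AE m in lborel. m \<in> {-1/2<..1/2} \<longrightarrow> \<bar>u0 (Q m)\<bar> \<le> C"
    by (subst (asm) AE_restrict_space_iff) auto
  then have "AE m in lborel. m \<in> {-1/2<..1/2} \<longrightarrow> \<bar>\<psi> m\<bar> \<le> \<bar>C\<bar> + \<Psi> (2 * R)"
  proof eventually_elim
    case (elim m)
    show ?case
    proof
      assume m: "m \<in> {-1/2<..1/2}"
      then have "drift (Q m) \<le> \<Psi> (2 * R)" "\<Psi> (- (2 * R)) \<le> drift (Q m)"
        using quantile_bounds[of m] drift_bounds[of "Q m"]
          Phi_mono[of "Q m + R" "2 * R"] Phi_mono[of "- (2 * R)" "Q m - R"] by auto
      then show "\<bar>\<psi> m\<bar> \<le> \<bar>C\<bar> + \<Psi> (2 * R)"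
        using elim m by (simp add: psi0_def conv_measure_eq_drift[OF prob] Phi_minus)
    qed
  qed
  moreover have "0 \<le> \<bar>C\<bar> + \<Psi> (2 * R)"
    using radius_nonneg by (simp add: Phi_nonneg)
  ultimately show ?thesis using that by blast
qed

lemma psi_integrable: "set_integrable lborel {-1/2<..1/2} \<psi>"
proof -
  obtain B where "AE m in lborel. m \<in> {-1/2<..1/2} \<longrightarrow> \<bar>\<psi> m\<bar> \<le> B"
    using psi_bounded by blast
  then show ?thesis
    by (intro set_integrable_bounded[OF _ _ psi_measurable]) auto
qed

abbreviation "A \<equiv> flux \<phi> \<rho>0 u0"

lemma flux_diff:
  assumes "- 1/2 \<le> x" "x \<le> y" "y \<le> 1/2"
  shows "A y - A x = (LBINT m:{x<..y}. \<psi> m)"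
proof -
  have int: "interval_lebesgue_integrable lborel (ereal a) (ereal b) \<psi>" if "a \<in> J" "b \<in> J" for a b
    using psi_integrable that
    by (auto simp: interval_lebesgue_integrable_def einterval_eq intro!: set_integrable_subset[OF psi_integrable])
  have "(LBINT m=ereal (-1/2)..ereal x. \<psi> m) + (LBINT m=ereal x..ereal y. \<psi> m) =
      (LBINT m=ereal (-1/2)..ereal y. \<psi> m)"
    using assms by (intro interval_integral_sum) (auto simp flip: ereal_min ereal_max intro: int)
  then have "A y - A x = (LBINT m=ereal x..ereal y. \<psi> m)"
    by (simp add: flux_def)
  with assms show ?thesis
    by (simp add: interval_integral_Ioc)
qed

lemma lipschitz_flux: "\<exists>\<Lambda>. lipschitz_flux A \<Lambda>"
proof -
  obtain B where B: "0 \<le> B" "AE m in lborel. m \<in> {-1/2<..1/2} \<longrightarrow> \<bar>\<psi> m\<bar> \<le> B"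
    by (rule psi_bounded)
  have le: "\<bar>A y - A x\<bar> \<le> B * (y - x)" if xy: "- 1/2 \<le> x" "x \<le> y" "y \<le> 1/2" for x y
  proof -
    have "AE m in lborel. m \<in> {x<..y} \<longrightarrow> \<bar>\<psi> m\<bar> \<le> B"
      using B(2) by eventually_elim (use xy in auto)
    moreover have "set_integrable lborel {x<..y} \<psi>"
      by (rule set_integrable_subset[OF psi_integrable]) (use xy in auto)
    ultimately have "\<bar>LBINT m:{x<..y}. \<psi> m\<bar> \<le> B * measure lborel {x<..y}"
      using xy by (intro set_integral_abs_le) auto
    with flux_diff[OF xy] xy show ?thesis by simp
  qed
  have "lipschitz_flux A B"
  proof
    fix x y :: real assume "x \<in> J" "y \<in> J"
    then show "\<bar>A x - A y\<bar> \<le> B * \<bar>x - y\<bar>"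
      using le[of x y] le[of y x] by (cases "x \<le> y") (auto simp: abs_minus_commute)
  qed
  then show ?thesis ..
qed

text \<open>Levels with equal quantile belong to a single atom, where the integrand defining the
  flux is constant.\<close>

lemma flux_affine_on_atom:
  assumes m: "- 1/2 < m1" "m1 \<le> m2" "m2 \<le> 1/2" and eq: "Q m1 = Q m2" and x: "m1 \<le> x" "x \<le> m2"
  shows "A x = \<psi> m1 * x + (A m1 - \<psi> m1 * m1)"
proof -
  have const: "\<psi> m = \<psi> m1" if "m1 < m" "m \<le> x" for m
    using quantile_mono[of m1 m] quantile_mono[of m m2] that m x eq by simp
  have "A x - A m1 = (LBINT m:{m1<..x}. \<psi> m)"
    using m x by (intro flux_diff) auto
  also have "\<dots> = (LBINT m:{m1<..x}. \<psi> m1)"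
    by (intro set_lebesgue_integral_cong) (auto simp: const)
  also have "\<dots> = \<psi> m1 * (x - m1)"
    using x by (simp add: set_lebesgue_integral_def)
  finally show ?thesis by (simp add: algebra_simps)
qed

lemma positive_gap_and_slopes:
  assumes m: "- 1/2 < m'" "m' \<le> 1/2" "- 1/2 < m''" "m'' \<le> 1/2"
    and less: "m' < Inf (linear_piece A m'')"
  obtains n1 n2 p1 p2 where "m' < n1" "n1 \<le> n2" "n2 < m''" "p1 < p2"
    "\<And>m. m \<in> J \<Longrightarrow> A n1 + p1 * (m - n1) \<le> A m" "\<And>m. m \<in> J \<Longrightarrow> A n2 + p2 * (m - n2) \<le> A m"
    "Q m' < Q m''"
proof -
  obtain \<Lambda> where "lipschitz_flux A \<Lambda>" using lipschitz_flux ..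
  then interpret lipschitz_flux A \<Lambda> .
  \<comment> \<open>This orders the two levels. In the second case some affine interval ends at
    \<open>m''\<close>, and the linear piece reaches at least as far to the left.\<close>
  have sub: "Inf (linear_piece A m'') \<le> m''"
  proof (cases "m'' \<in> Sigma_plus A")
    case True
    then show ?thesis by (simp add: linear_piece_def)
  next
    case False
    then obtain m1 where "- 1/2 \<le> m1" "m1 < m''" "affine_on {m1<..m''} (convex_envelope A)"
      using m by (auto simp: Sigma_plus_def)
    then show ?thesis
      using affine_envelope_imp_linear_piece[of m1 m''] m by simp
  qed
  with less have "m' < m''" by simp
  have J: "m' \<in> J" "m'' \<in> J" using m by auto
  have "\<not> affine_on {m'<..m''} (convex_envelope A)"
    using affine_envelope_imp_linear_piece[of m' m''] m less \<open>m' < m''\<close> by auto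
  then obtain n1 n2 p1 p2 where n: "m' < n1" "n1 \<le> n2" "n2 < m''" "p1 < p2"
    and p: "supporting_slope n1 p1" "supporting_slope n2 p2"
    using supporting_slopes_if_not_affine[OF J \<open>m' < m''\<close>] by blast
  have "Q m' \<noteq> Q m''"
  proof
    assume "Q m' = Q m''"
    then have "A x = \<psi> m' * x + (A m' - \<psi> m' * m')" if "m' \<le> x" "x \<le> m''" for x
      using m \<open>m' < m''\<close> that by (intro flux_affine_on_atom) auto
    from no_two_slopes_if_affine[OF p n(4) J n(1-3) this] show False .
  qed
  with quantile_mono[of m' m''] m \<open>m' < m''\<close> have "Q m' < Q m''" by simp
  with n p show ?thesis
    by (intro that[of n1 n2 p1 p2]) (auto simp: supporting_slope_def)
qed

end

section \<open>Cut-off functions\<close>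

lemma smooth_expr_partials:
  assumes f: "smooth_expr f"
  shows "continuous_on UNIV f" "continuous_on UNIV (dx f)" "continuous_on UNIV (dt f)"
    and "((\<lambda>y. f (y, t)) has_real_derivative dx f (x, t)) (at x)"
    and "((\<lambda>s. f (x, s)) has_real_derivative dt f (x, t)) (at t)"
proof -
  have "C_k (Suc 0) f" using f by (rule smooth_expr_C_k)
  then show "continuous_on UNIV f" "continuous_on UNIV (dx f)" "continuous_on UNIV (dt f)"
    by (auto simp: differentiable_imp_continuous_on)
  obtain g h where *: "\<And>z. (f has_derivative (\<lambda>w. g z * fst w + h z * snd w)) (at z)"
    using smooth_expr_has_derivative[OF f] by blast
  note dx_dt = dx_dt_eqI[OF *]
  have "((\<lambda>y. f (y, t)) has_derivative (\<lambda>w. g (x, t) * fst (w, 0::real) + h (x, t) * snd (w, 0))) (at x)"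
    using *[of "(x, t)"] by (rule has_derivative_compose[rotated]) (auto intro!: derivative_eq_intros)
  then show "((\<lambda>y. f (y, t)) has_real_derivative dx f (x, t)) (at x)"
    by (simp add: has_field_derivative_def dx_dt)
  have "((\<lambda>s. f (x, s)) has_derivative (\<lambda>w. g (x, t) * fst (0::real, w) + h (x, t) * snd (0::real, w))) (at t)"
    using *[of "(x, t)"] by (rule has_derivative_compose[rotated]) (auto intro!: derivative_eq_intros)
  then show "((\<lambda>s. f (x, s)) has_real_derivative dt f (x, t)) (at t)"
    by (simp add: has_field_derivative_def dx_dt)
qed

locale cutoff =
  fixes \<zeta> :: "real \<times> real \<Rightarrow> real" and a t1 t2 :: real
  assumes smooth: "smooth_expr \<zeta>"
    and support: "\<And>x t. \<zeta> (x, t) \<noteq> 0 \<Longrightarrow> x \<in> {- a..a} \<and> t \<in> {t1..t2}"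
begin

text \<open>Off the closed box the function vanishes on a neighbourhood along the line, hence so
  does its derivative.\<close>

lemma support_dx:
  assumes "dx \<zeta> (x, t) \<noteq> 0"
  shows "x \<in> {- a..a} \<and> t \<in> {t1..t2}"
proof (rule ccontr)
  assume *: "\<not> (x \<in> {- a..a} \<and> t \<in> {t1..t2})"
  have "((\<lambda>y. \<zeta> (y, t)) has_real_derivative 0) (at x)"
  proof (cases "t \<in> {t1..t2}")
    case True
    with * have "x \<in> - {- a..a}" by auto
    then show ?thesis
    proof (rule has_field_derivative_transform_within_open[rotated 2])
      show "0 = \<zeta> (y, t)" if "y \<in> - {- a..a}" for y
        using support[of y t] that by force
    qed (auto intro: open_Compl)
  next
    case False
    then have "(\<lambda>y. \<zeta> (y, t)) = (\<lambda>_. 0)"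
      using support[of _ t] by (intro ext) blast
    then show ?thesis by simp
  qed
  with smooth_expr_partials(4)[OF smooth] assms show False
    using DERIV_unique by blast
qed

lemma support_dt:
  assumes "dt \<zeta> (x, t) \<noteq> 0"
  shows "x \<in> {- a..a} \<and> t \<in> {t1..t2}"
proof (rule ccontr)
  assume *: "\<not> (x \<in> {- a..a} \<and> t \<in> {t1..t2})"
  have "((\<lambda>s. \<zeta> (x, s)) has_real_derivative 0) (at t)"
  proof (cases "x \<in> {- a..a}")
    case True
    with * have "t \<in> - {t1..t2}" by auto
    then show ?thesis
    proof (rule has_field_derivative_transform_within_open[rotated 2])
      show "0 = \<zeta> (x, s)" if "s \<in> - {t1..t2}" for s
        using support[of x s] that by force
    qed (auto intro: open_Compl)
  next
    case False
    then have "(\<lambda>s. \<zeta> (x, s)) = (\<lambda>_. 0)"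
      using support[of x] by (intro ext) blast
    then show ?thesis by simp
  qed
  with smooth_expr_partials(5)[OF smooth] assms show False
    using DERIV_unique by blast
qed

lemma bounded_if_supported:
  assumes "continuous_on UNIV g" "\<And>x t. g (x, t) \<noteq> 0 \<Longrightarrow> x \<in> {- a..a} \<and> t \<in> {t1..t2}"
  shows "\<exists>B\<ge>0. \<forall>z. \<bar>g z :: real\<bar> \<le> B"
proof -
  have "compact ({- a..a} \<times> {t1..t2})" by (intro compact_Times) auto
  then have "bounded (g ` ({- a..a} \<times> {t1..t2}))"
    by (intro compact_imp_bounded compact_continuous_image continuous_on_subset[OF assms(1)]) auto
  then obtain B where B: "\<And>z. z \<in> {- a..a} \<times> {t1..t2} \<Longrightarrow> \<bar>g z\<bar> \<le> B"
    by (auto simp: bounded_iff)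
  have "\<bar>g z\<bar> \<le> \<bar>B\<bar>" for z
  proof (cases "g z = 0")
    case False
    with assms(2)[of "fst z" "snd z"] B[of z] show ?thesis by (auto simp: mem_Times_iff)
  qed simp
  then show ?thesis by (intro exI[of _ "\<bar>B\<bar>"]) auto
qed

lemma bounds: "\<exists>B\<ge>0. \<forall>z. \<bar>\<zeta> z\<bar> \<le> B \<and> \<bar>dx \<zeta> z\<bar> \<le> B \<and> \<bar>dt \<zeta> z\<bar> \<le> B"
proof -
  obtain B1 B2 B3 where "\<forall>z. \<bar>\<zeta> z\<bar> \<le> B1" "\<forall>z. \<bar>dx \<zeta> z\<bar> \<le> B2" "\<forall>z. \<bar>dt \<zeta> z\<bar> \<le> B3"
    "0 \<le> B1" "0 \<le> B2" "0 \<le> B3"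
    using bounded_if_supported[OF smooth_expr_partials(1)[OF smooth] support]
      bounded_if_supported[OF smooth_expr_partials(2)[OF smooth] support_dx]
      bounded_if_supported[OF smooth_expr_partials(3)[OF smooth] support_dt] by blast
  then show ?thesis
    by (intro exI[of _ "B1 + B2 + B3"]) (smt (verit))
qed

lemma measurable_partials [measurable]:
  "\<zeta> \<in> borel_measurable (borel \<Otimes>\<^sub>M borel)" "dx \<zeta> \<in> borel_measurable (borel \<Otimes>\<^sub>M borel)"
  "dt \<zeta> \<in> borel_measurable (borel \<Otimes>\<^sub>M borel)"
  by (subst borel_prod, rule borel_measurable_continuous_onI, rule smooth_expr_partials[OF smooth])+

lemma test_function: "0 < t1 \<Longrightarrow> test_function \<zeta>"
  unfolding test_function_def
proof (intro conjI allI exI[of _ "{- a..a} \<times> {t1..t2}"])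
  show "C_k k \<zeta>" for k using smooth by (rule smooth_expr_C_k)
  show "compact ({- a..a} \<times> {t1..t2})" by (intro compact_Times) auto
  show "{- a..a} \<times> {t1..t2} \<subseteq> UNIV \<times> {0<..}" if "0 < t1" using that by auto
  show "z \<notin> {- a..a} \<times> {t1..t2} \<longrightarrow> \<zeta> z = 0" for z
    using support[of "fst z" "snd z"] by (auto simp: mem_Times_iff)
qed

lemma integral_dx: "(LBINT x. dx \<zeta> (x, t)) = 0"
proof -
  \<comment> \<open>The added 1 puts both endpoints strictly outside the support, whatever the sign
    of \<open>a\<close>.\<close>
  let ?b = "\<bar>a\<bar> + 1"
  have z: "\<zeta> (?b, t) = 0" "\<zeta> (- ?b, t) = 0"
    using support[of "?b" t] support[of "- ?b" t] by fastforce+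
  have "(LBINT x. dx \<zeta> (x, t)) = (LBINT x. dx \<zeta> (x, t) * indicator {- ?b..?b} x)"
  proof (intro Bochner_Integration.integral_cong refl)
    fix x show "dx \<zeta> (x, t) = dx \<zeta> (x, t) * indicator {- ?b..?b} x"
      using support_dx[of x t] by (cases "dx \<zeta> (x, t) = 0") auto
  qed
  also have "\<dots> = \<zeta> (?b, t) - \<zeta> (- ?b, t)"
  proof (rule integral_FTC_Icc_real[where F = "\<lambda>x. \<zeta> (x, t)"])
    show "isCont (\<lambda>x. dx \<zeta> (x, t)) x" for x
    proof -
      have "continuous_on UNIV (\<lambda>x. dx \<zeta> (x, t))"
        by (rule continuous_on_compose2[OF smooth_expr_partials(2)[OF smooth]]) (auto intro!: continuous_intros)
      then show ?thesis by (simp add: continuous_on_eq_continuous_at)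
    qed
    show "- ?b \<le> ?b" by simp
  qed (rule smooth_expr_partials(4)[OF smooth])
  finally show ?thesis using z by simp
qed

lemma integral_dt: "(LBINT t. dt \<zeta> (x, t)) = 0"
proof -
  let ?b = "max t1 t2 + 1" and ?c = "min t1 t2 - 1"
  have z: "\<zeta> (x, ?b) = 0" "\<zeta> (x, ?c) = 0"
    using support[of x ?b] support[of x ?c] by fastforce+
  have "(LBINT t. dt \<zeta> (x, t)) = (LBINT t. dt \<zeta> (x, t) * indicator {?c..?b} t)"
  proof (intro Bochner_Integration.integral_cong refl)
    fix t show "dt \<zeta> (x, t) = dt \<zeta> (x, t) * indicator {?c..?b} t"
      using support_dt[of x t] by (cases "dt \<zeta> (x, t) = 0") auto
  qed
  also have "\<dots> = \<zeta> (x, ?b) - \<zeta> (x, ?c)"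
  proof (rule integral_FTC_Icc_real[where F = "\<lambda>t. \<zeta> (x, t)"])
    show "isCont (\<lambda>t. dt \<zeta> (x, t)) t" for t
    proof -
      have "continuous_on UNIV (\<lambda>t. dt \<zeta> (x, t))"
        by (rule continuous_on_compose2[OF smooth_expr_partials(3)[OF smooth]]) (auto intro!: continuous_intros)
      then show ?thesis by (simp add: continuous_on_eq_continuous_at)
    qed
    show "?c \<le> ?b" by simp
  qed (rule smooth_expr_partials(5)[OF smooth])
  finally show ?thesis using z by simp
qed

end

lemma
  fixes f :: "real \<Rightarrow> real \<Rightarrow> real"
  assumes f [measurable]: "(\<lambda>(t, x). f t x) \<in> borel_measurable (borel \<Otimes>\<^sub>M borel)"
    and supp: "\<And>t x. f t x \<noteq> 0 \<Longrightarrow> x \<in> {- a..a} \<and> t \<in> {t1..t2}"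
    and bound: "\<And>t x. \<bar>f t x\<bar> \<le> B"
  shows integrable_section: "integrable lborel (f t)"
    and integrable_iterated: "integrable lborel (\<lambda>t. LBINT x. f t x)"
    and integrable_joint: "integrable (lborel \<Otimes>\<^sub>M lborel) (\<lambda>(t, x). f t x)"
proof -
  show sec: "integrable lborel (f t)" for t
  proof (rule integrableI_bounded_set[where A = "{- a..a}" and B = B])
    have "(\<lambda>x. (\<lambda>(t, x). f t x) (t, x)) \<in> borel_measurable borel" by measurable
    then show "f t \<in> borel_measurable lborel" by simp
    show "AE x in lborel. x \<in> {- a..a} \<longrightarrow> norm (f t x) \<le> B"
      using bound by (intro AE_I2) auto
    show "AE x in lborel. x \<notin> {- a..a} \<longrightarrow> f t x = 0"
      using supp by (intro AE_I2) auto
  qed (auto simp: emeasure_lborel_Icc_eq)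
  have meas: "(\<lambda>(t, x). f t x) \<in> borel_measurable (lborel \<Otimes>\<^sub>M lborel)"
    using f by (simp cong: measurable_cong_sets sets_pair_measure_cong)
  show "integrable (lborel \<Otimes>\<^sub>M lborel) (\<lambda>(t, x). f t x)"
  proof (rule integrableI_bounded_set[where A = "{t1..t2} \<times> {- a..a}" and B = B])
    show "emeasure (lborel \<Otimes>\<^sub>M lborel) ({t1..t2} \<times> {- a..a}) < \<infinity>"
      by (subst lborel.emeasure_pair_measure_Times) (auto simp: ennreal_mult_less_top emeasure_lborel_Icc_eq)
    show "{t1..t2} \<times> {- a..a} \<in> sets (lborel \<Otimes>\<^sub>M lborel)" by simp
    show "AE z in lborel \<Otimes>\<^sub>M lborel. z \<in> {t1..t2} \<times> {- a..a} \<longrightarrow> norm (case z of (t, x) \<Rightarrow> f t x) \<le> B"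
      using bound by (intro AE_I2) auto
    show "AE z in lborel \<Otimes>\<^sub>M lborel. z \<notin> {t1..t2} \<times> {- a..a} \<longrightarrow> (case z of (t, x) \<Rightarrow> f t x) = 0"
      using supp by (intro AE_I2) auto
  qed (rule meas)
  then show "integrable lborel (\<lambda>t. LBINT x. f t x)"
    by (rule lborel_pair.integrable_fst)
qed

section \<open>One-sided entropy inequalities\<close>

text \<open>Time is clamped to \<open>[0, T]\<close>, so that a single support radius \<open>R\<close> serves all times.\<close>
locale entropy_flow = alignment_potential \<phi> + lipschitz_flux A \<Lambda>
  for \<phi> A :: "real \<Rightarrow> real" and \<Lambda> :: real +
  fixes N :: "real \<Rightarrow> real \<Rightarrow> real" and R T :: real
  assumes profile: "distribution_profile (N t) R"
    and L1_continuous: "((\<lambda>s. LBINT x. \<bar>N s x - N t x\<bar>) \<longlongrightarrow> 0) (at t)"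
    and entropy: "\<And>\<alpha> \<zeta> a t1 t2. \<alpha> \<in> J \<Longrightarrow> cutoff \<zeta> a t1 t2 \<Longrightarrow> 0 < t1 \<Longrightarrow> t2 < T \<Longrightarrow>
      (\<And>z. 0 \<le> \<zeta> z) \<Longrightarrow>
      0 \<le> (LBINT t.
        (LBINT x. \<bar>N t x - \<alpha>\<bar> * dt \<zeta> (x, t) + sgn (N t x - \<alpha>) * (A (N t x) - A \<alpha>) * dx \<zeta> (x, t)) +
        ((LBINT m:{\<alpha><..1/2}. \<zeta> (quantile (N t) m, t) * aligned_profile.drift \<phi> (N t) (quantile (N t) m)) -
         (LBINT m:{-1/2<..\<alpha>}. \<zeta> (quantile (N t) m, t) * aligned_profile.drift \<phi> (N t) (quantile (N t) m))))"
begin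

sublocale prof: aligned_profile \<phi> "N t" R for t
  by (intro aligned_profile.intro profile alignment_potential_axioms)

abbreviation "Q t \<equiv> quantile (N t)"
abbreviation "V t \<equiv> prof.drift t"

section \<open>Measurability and integrability in space-time\<close>

lemma N_diff_integrable: "integrable lborel (\<lambda>x. \<bar>N s x - N t x\<bar>)"
proof (rule integrableI_bounded_set[where A = "{- R..R}" and B = 1])
  show "(\<lambda>x. \<bar>N s x - N t x\<bar>) \<in> borel_measurable lborel"
    using borel_measurable_mono[OF prof.profile_mono[of s]] borel_measurable_mono[OF prof.profile_mono[of t]]
    by simp
  show "AE x in lborel. x \<in> {- R..R} \<longrightarrow> norm \<bar>N s x - N t x\<bar> \<le> 1"
  proof (intro AE_I2 impI)
    fix x show "norm \<bar>N s x - N t x\<bar> \<le> 1"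
      using prof.profile_bounds[of s x] prof.profile_bounds[of t x] by simp
  qed
  show "AE x in lborel. x \<notin> {- R..R} \<longrightarrow> \<bar>N s x - N t x\<bar> = 0"
    by (intro AE_I2) (auto simp: prof.profile_left prof.profile_right not_le)
qed (auto simp: emeasure_lborel_Icc_eq)

lemma N_integrable: "set_integrable lborel {x..y} (N t)"
proof (rule set_integrable_bounded[where B = "1/2"])
  show "N t \<in> borel_measurable (restrict_space lborel {x..y})"
    using borel_measurable_mono[OF prof.profile_mono[of t]] by (simp add: measurable_restrict_space1)
  show "AE z in lborel. z \<in> {x..y} \<longrightarrow> \<bar>N t z\<bar> \<le> 1/2"
  proof (intro AE_I2 impI)
    show "\<bar>N t z\<bar> \<le> 1/2" for z
      using prof.profile_bounds[of t z] by linarith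
  qed
qed (auto simp: emeasure_lborel_Icc_eq)

text \<open>Continuity in L1 controls averages over intervals, not values at points; these averages
  are the route to measurability in time.\<close>

lemma N_average_continuous: "continuous_on UNIV (\<lambda>t. LBINT y:{x..z}. N t y)"
  unfolding continuous_on_eq_continuous_at[OF open_UNIV]
proof
  fix t :: real
  have "\<bar>(LBINT y:{x..z}. N s y) - (LBINT y:{x..z}. N t y)\<bar> \<le> (LBINT y. \<bar>N s y - N t y\<bar>)" for s
  proof -
    have "(LBINT y:{x..z}. N s y) - (LBINT y:{x..z}. N t y) = (LBINT y:{x..z}. N s y - N t y)"
      by (intro set_integral_diff(2)[symmetric] N_integrable)
    also have "\<bar>\<dots>\<bar> \<le> (LBINT y. \<bar>indicator {x..z} y *\<^sub>R (N s y - N t y)\<bar>)"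
      unfolding set_lebesgue_integral_def by (rule integral_abs_bound)
    also have "\<dots> \<le> (LBINT y. \<bar>N s y - N t y\<bar>)"
    proof (rule integral_mono)
      have "set_integrable lborel {x..z} (\<lambda>y. N s y - N t y)"
        by (intro set_integral_diff(1) N_integrable)
      then show "integrable lborel (\<lambda>y. \<bar>indicator {x..z} y *\<^sub>R (N s y - N t y)\<bar>)"
        unfolding set_integrable_def by (rule integrable_abs)
    qed (auto intro: N_diff_integrable split: split_indicator)
    finally show ?thesis .
  qed
  then have "((\<lambda>s. (LBINT y:{x..z}. N s y) - (LBINT y:{x..z}. N t y)) \<longlongrightarrow> 0) (at t)"
    by (intro tendsto_rabs_zero_cancel[OF tendsto_sandwich[OF _ _ tendsto_const L1_continuous[of t]]]) auto
  then show "isCont (\<lambda>t. LBINT y:{x..z}. N t y) t"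
    unfolding isCont_def using LIM_zero_iff by blast
qed

lemma N_at_right: "(\<lambda>k. N t (x + inverse (real (Suc k)))) \<longlonglongrightarrow> N t x"
proof -
  have "(N t \<longlongrightarrow> N t x) (at_right x)"
    using prof.profile_right_cont[where x = x] by (simp add: continuous_within)
  moreover have "filterlim (\<lambda>k. x + inverse (real (Suc k))) (at_right x) sequentially"
    by (intro tendsto_imp_filterlim_at_right LIMSEQ_inverse_real_of_nat_add always_eventually) simp
  ultimately show ?thesis by (rule filterlim_compose)
qed

text \<open>Averages over [x, x + 1/k] lie between \<open>N t x\<close> and
  \<open>N t (x + 1/k)\<close>, and so converge to \<open>N t x\<close> by right continuity.\<close>

lemma N_measurable_time: "(\<lambda>t. N t x) \<in> borel_measurable borel"
proof (rule borel_measurable_LIMSEQ_real)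
  fix t
  let ?h = "\<lambda>k. inverse (real (Suc k))"
  show "(\<lambda>k. real (Suc k) * (LBINT y:{x..x + ?h k}. N t y)) \<longlonglongrightarrow> N t x"
  proof (rule tendsto_sandwich[OF _ _ tendsto_const N_at_right])
    have c: "(LBINT y:{x..x + ?h k}. c) = ?h k * c" for k and c :: real
      by (simp add: set_lebesgue_integral_def)
    have ci: "set_integrable lborel {x..x + ?h k} (\<lambda>_. c)" for k and c :: real
      by (simp add: set_integrable_def)
    have 1: "?h k * N t x \<le> (LBINT y:{x..x + ?h k}. N t y)" for k
      unfolding c[symmetric] by (intro set_integral_mono ci N_integrable) (simp add: prof.profile_le)
    have 2: "(LBINT y:{x..x + ?h k}. N t y) \<le> ?h k * N t (x + ?h k)" for k
      unfolding c[symmetric] by (intro set_integral_mono ci N_integrable) (simp add: prof.profile_le)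
    have s: "real (Suc k) * (?h k * c) = c" for k and c :: real
      by (simp del: of_nat_Suc)
    show "\<forall>\<^sub>F k in sequentially. N t x \<le> real (Suc k) * (LBINT y:{x..x + ?h k}. N t y)"
      using mult_left_mono[OF 1, of "real (Suc _)"] by (intro always_eventually allI) (metis s of_nat_0_le_iff)
    show "\<forall>\<^sub>F k in sequentially. real (Suc k) * (LBINT y:{x..x + ?h k}. N t y) \<le> N t (x + ?h k)"
      using mult_left_mono[OF 2, of "real (Suc _)"] by (intro always_eventually allI) (metis s of_nat_0_le_iff)
  qed
  show "(\<lambda>t. real (Suc k) * (LBINT y:{x..x + ?h k}. N t y)) \<in> borel_measurable borel" for k
    by (intro borel_measurable_times borel_measurable_const borel_measurable_continuous_onI N_average_continuous)
qed

lemma N_measurable: "(\<lambda>(t, x). N t x) \<in> borel_measurable (borel \<Otimes>\<^sub>M borel)"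
proof (rule borel_measurable_LIMSEQ_real)
  \<comment> \<open>The next grid point to the right of \<open>x\<close>: a function with countably
    many values, approaching \<open>x\<close> from the side on which \<open>N t\<close> is
    continuous.\<close>
  let ?g = "\<lambda>k x. (of_int \<lfloor>real (Suc k) * x\<rfloor> + 1) / real (Suc k)"
  show "(\<lambda>z. N (fst z) (?g k (snd z))) \<in> borel_measurable (borel \<Otimes>\<^sub>M borel)" for k
  proof -
    have "(\<lambda>z::real \<times> real. N (fst z) ((of_int i + 1) / real (Suc k))) \<in> borel_measurable (borel \<Otimes>\<^sub>M borel)" for i
      using N_measurable_time by measurable
    then show ?thesis
      by (rule measurable_compose_countable[where g = "\<lambda>z. \<lfloor>real (Suc k) * snd z\<rfloor>"]) measurable
  qed
  fix z :: "real \<times> real"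
  obtain t x where z: "z = (t, x)" by (cases z)
  have "N t x \<le> N t (?g k x)" "N t (?g k x) \<le> N t (x + inverse (real (Suc k)))" for k
  proof -
    have "real (Suc k) * x \<le> of_int \<lfloor>real (Suc k) * x\<rfloor> + 1" "of_int \<lfloor>real (Suc k) * x\<rfloor> \<le> real (Suc k) * x"
      by linarith+
    then have "x \<le> ?g k x" "?g k x \<le> x + inverse (real (Suc k))"
      by (simp_all add: field_simps del: of_nat_Suc)
    then show "N t x \<le> N t (?g k x)" "N t (?g k x) \<le> N t (x + inverse (real (Suc k)))"
      by (auto intro: prof.profile_le)
  qed
  then have "(\<lambda>k. N t (?g k x)) \<longlonglongrightarrow> N t x"
    by (intro tendsto_sandwich[OF _ _ tendsto_const N_at_right[of t x]]) auto
  then show "(\<lambda>k. N (fst z) (?g k (snd z))) \<longlonglongrightarrow> (case z of (t, x) \<Rightarrow> N t x)"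
    by (simp add: z)
qed

text \<open>Sublevel sets translate to \<open>m \<le> N t c\<close> with \<open>c\<close> fixed, so
  measurability in time alone suffices. Outside (-1/2, 1/2] the quantile is the infimum of an empty
  or unbounded set and is replaced by 0.\<close>

lemma quantile_measurable_joint:
  "(\<lambda>(t, m). if - 1/2 < m \<and> m \<le> 1/2 then Q t m else 0) \<in> borel_measurable (borel \<Otimes>\<^sub>M borel)"
proof (subst borel_measurable_iff_le, intro allI)
  fix c :: real
  have [measurable]: "(\<lambda>z. N (fst z) c) \<in> borel_measurable (borel \<Otimes>\<^sub>M (borel :: real measure))"
    using N_measurable_time[of c] by measurable
  have "{z \<in> space (borel \<Otimes>\<^sub>M borel). (case z of (t, m) \<Rightarrow> if - 1/2 < m \<and> m \<le> 1/2 then Q t m else 0) \<le> c} =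
      {z \<in> space (borel \<Otimes>\<^sub>M borel). if - 1/2 < snd z \<and> snd z \<le> 1/2 then snd z \<le> N (fst z) c else 0 \<le> c}"
    by (auto simp: prof.quantile_le_iff split: if_splits)
  also have "\<dots> \<in> sets (borel \<Otimes>\<^sub>M borel)"
    by measurable
  finally show "{z \<in> space (borel \<Otimes>\<^sub>M borel). (case z of (t, m) \<Rightarrow> if - 1/2 < m \<and> m \<le> 1/2 then Q t m else 0) \<le> c}
      \<in> sets (borel \<Otimes>\<^sub>M borel)" .
qed

lemma drift_measurable: "(\<lambda>(t, x). V t x) \<in> borel_measurable (borel \<Otimes>\<^sub>M borel)"
proof -
  let ?q = "\<lambda>t m. if - 1/2 < m \<and> m \<le> 1/2 then Q t m else 0"
  have [measurable]: "(\<lambda>z :: (real \<times> real) \<times> real. ?q (fst (fst z)) (snd z)) \<in> borel_measurable ((borel \<Otimes>\<^sub>M borel) \<Otimes>\<^sub>M lborel)"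
  proof -
    have "(\<lambda>z :: (real \<times> real) \<times> real. (fst (fst z), snd z)) \<in> (borel \<Otimes>\<^sub>M borel) \<Otimes>\<^sub>M lborel \<rightarrow>\<^sub>M borel \<Otimes>\<^sub>M borel"
      by measurable
    from measurable_compose[OF this quantile_measurable_joint] show ?thesis by simp
  qed
  have "(\<lambda>(t, x). LBINT m. indicator {-1/2<..1/2} m *\<^sub>R \<Psi> (x - ?q t m)) \<in> borel_measurable (borel \<Otimes>\<^sub>M borel)"
    unfolding case_prod_beta
    by (rule lborel.borel_measurable_lebesgue_integral) (unfold case_prod_beta, measurable)
  also have "(\<lambda>(t, x). LBINT m. indicator {-1/2<..1/2} m *\<^sub>R \<Psi> (x - ?q t m)) = (\<lambda>(t, x). V t x)"
    unfolding prof.drift_def set_lebesgue_integral_def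
    by (intro ext, clarify, intro Bochner_Integration.integral_cong refl) (auto split: split_indicator)
  finally show ?thesis .
qed

text \<open>\<open>A\<close> is known to be continuous only on \<open>J\<close>; clamping yields a
  Borel function on the whole line without changing its values along \<open>N\<close>.\<close>

abbreviation "clampJ u \<equiv> max (- 1/2) (min (1/2) (u::real))"

lemma clampJ_N [simp]: "clampJ (N t x) = N t x"
  using prof.profile_bounds[of t x] by simp

lemma flux_clamp_measurable [measurable]: "(\<lambda>u. A (clampJ u)) \<in> borel_measurable borel"
  by (intro borel_measurable_continuous_onI continuous_on_compose2[OF flux_continuous] continuous_intros) auto

lemma
  assumes cut: "cutoff \<zeta> a t1 t2"
    and gh [measurable]: "(\<lambda>u. g (clampJ u)) \<in> borel_measurable borel" "(\<lambda>u. h (clampJ u)) \<in> borel_measurable borel"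
    and bound: "\<And>u. u \<in> J \<Longrightarrow> \<bar>g u\<bar> \<le> C" "\<And>u. u \<in> J \<Longrightarrow> \<bar>h u\<bar> \<le> C"
  shows profile_integrable: "integrable lborel (\<lambda>x. g (N t x) * dt \<zeta> (x, t) + h (N t x) * dx \<zeta> (x, t))"
    and profile_integrable_time: "integrable lborel (\<lambda>t. LBINT x. g (N t x) * dt \<zeta> (x, t) + h (N t x) * dx \<zeta> (x, t))"
proof -
  interpret cutoff \<zeta> a t1 t2 by fact
  let ?f = "\<lambda>t x. g (N t x) * dt \<zeta> (x, t) + h (N t x) * dx \<zeta> (x, t)"
  obtain B where B: "0 \<le> B" "\<And>z. \<bar>dx \<zeta> z\<bar> \<le> B" "\<And>z. \<bar>dt \<zeta> z\<bar> \<le> B"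
    using bounds by blast
  have C: "0 \<le> C" using bound(1)[of 0] by simp
  have m [measurable]: "(\<lambda>z. N (fst z) (snd z)) \<in> borel_measurable (borel \<Otimes>\<^sub>M borel)"
    using N_measurable by (simp add: case_prod_beta)
  have "(\<lambda>z. g (clampJ (N (fst z) (snd z)))) \<in> borel_measurable (borel \<Otimes>\<^sub>M borel)"
    "(\<lambda>z. h (clampJ (N (fst z) (snd z)))) \<in> borel_measurable (borel \<Otimes>\<^sub>M borel)"
    using measurable_compose[OF m gh(1)] measurable_compose[OF m gh(2)] by simp_all
  then have [measurable]: "(\<lambda>z. g (N (fst z) (snd z))) \<in> borel_measurable (borel \<Otimes>\<^sub>M borel)"
    "(\<lambda>z. h (N (fst z) (snd z))) \<in> borel_measurable (borel \<Otimes>\<^sub>M borel)"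
    by (simp_all only: clampJ_N)
  have meas: "(\<lambda>(t, x). ?f t x) \<in> borel_measurable (borel \<Otimes>\<^sub>M borel)"
    unfolding case_prod_beta by measurable
  have supp: "x \<in> {- a..a} \<and> t \<in> {t1..t2}" if "?f t x \<noteq> 0" for t x
    using that support_dx[of x t] support_dt[of x t] by (cases "dx \<zeta> (x, t) = 0") auto
  have bd: "\<bar>?f t x\<bar> \<le> C * B + C * B" for t x
    using bound[OF prof.profile_in_J] B C
    by (intro order_trans[OF abs_triangle_ineq] add_mono) (auto simp: abs_mult intro!: mult_mono)
  show "integrable lborel (?f t)" "integrable lborel (\<lambda>t. LBINT x. ?f t x)"
    using integrable_section[OF meas supp bd] integrable_iterated[OF meas supp bd] by blast+
qed

abbreviation "drift_term \<zeta> t m \<equiv> \<zeta> (Q t m, t) * V t (Q t m)"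

lemma
  assumes cut: "cutoff \<zeta> a t1 t2" and S [measurable]: "S \<in> sets borel" and sub: "S \<subseteq> {-1/2<..1/2}"
  shows drift_term_integrable: "set_integrable lborel S (drift_term \<zeta> t)"
    and drift_term_integrable_time: "integrable lborel (\<lambda>t. LBINT m:S. drift_term \<zeta> t m)"
proof -
  interpret cutoff \<zeta> a t1 t2 by fact
  let ?f = "\<lambda>t m. indicator S m *\<^sub>R drift_term \<zeta> t m"
  let ?q = "\<lambda>t m. if - 1/2 < m \<and> m \<le> 1/2 then Q t m else 0"
  obtain B where B: "0 \<le> B" "\<And>z. \<bar>\<zeta> z\<bar> \<le> B"
    using bounds by blast
  have [measurable]: "(\<lambda>z. ?q (fst z) (snd z)) \<in> borel_measurable (borel \<Otimes>\<^sub>M borel)"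
    using quantile_measurable_joint by (simp add: case_prod_beta)
  have m: "(\<lambda>z. (fst z, ?q (fst z) (snd z))) \<in> borel \<Otimes>\<^sub>M borel \<rightarrow>\<^sub>M borel \<Otimes>\<^sub>M borel"
    by measurable
  have [measurable]: "(\<lambda>z. V (fst z) (?q (fst z) (snd z))) \<in> borel_measurable (borel \<Otimes>\<^sub>M borel)"
    using measurable_compose[OF m drift_measurable] by simp
  have "(\<lambda>(t, m). indicator S m *\<^sub>R (\<zeta> (?q t m, t) * V t (?q t m))) \<in> borel_measurable (borel \<Otimes>\<^sub>M borel)"
    unfolding case_prod_beta by measurable
  also have "(\<lambda>(t, m). indicator S m *\<^sub>R (\<zeta> (?q t m, t) * V t (?q t m))) = (\<lambda>(t, m). ?f t m)"
    using sub by (auto simp: fun_eq_iff split: split_indicator)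
  finally have meas: "(\<lambda>(t, m). ?f t m) \<in> borel_measurable (borel \<Otimes>\<^sub>M borel)" .
  have supp: "m \<in> {- (1/2)..1/2} \<and> t \<in> {t1..t2}" if "?f t m \<noteq> 0" for t m
    using that support[of "Q t m" t] sub by (auto split: split_indicator_asm)
  have bd: "\<bar>?f t m\<bar> \<le> B * \<Psi> (2 * R)" for t m
  proof (cases "m \<in> S")
    case True
    then have m: "- 1/2 < m" "m \<le> 1/2" using sub by auto
    have "V t (Q t m) \<le> \<Psi> (2 * R)" "\<Psi> (- (2 * R)) \<le> V t (Q t m)"
      using prof.quantile_bounds[OF m, of t] prof.drift_bounds[where t = t and x = "Q t m"]
        Phi_mono[of "Q t m + R" "2 * R"] Phi_mono[of "- (2 * R)" "Q t m - R"] by auto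
    then have "\<bar>V t (Q t m)\<bar> \<le> \<Psi> (2 * R)" by (simp add: Phi_minus)
    then show ?thesis using B True by (auto simp: abs_mult intro!: mult_mono)
  next
    case False
    then show ?thesis using B prof.radius_nonneg by (auto simp: Phi_nonneg)
  qed
  show "set_integrable lborel S (drift_term \<zeta> t)" "integrable lborel (\<lambda>t. LBINT m:S. drift_term \<zeta> t m)"
    unfolding set_integrable_def set_lebesgue_integral_def
    using integrable_section[OF meas supp bd] integrable_iterated[OF meas supp bd] by blast+
qed

section \<open>One-sided Kruzkov entropies\<close>

definition half_flux :: "real \<Rightarrow> real \<Rightarrow> real \<Rightarrow> real" where
  "half_flux \<sigma> n u = (if 0 < \<sigma> * (u - n) then \<sigma> * (A u - A n) else 0)"

text \<open>The time slice of the weak inequality for the entropy max (\<sigma> (N - n)) 0, whose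
  flux is \<open>half_flux\<close>. The derivative in x of this entropy is \<sigma> times the image
  of Lebesgue measure on the levels on the \<sigma>-side of \<open>n\<close>, hence the factor in
  front of the drift.\<close>

definition half_entropy :: "real \<Rightarrow> real \<Rightarrow> (real \<times> real \<Rightarrow> real) \<Rightarrow> real \<Rightarrow> real" where
  "half_entropy \<sigma> n \<zeta> t =
    (LBINT x. max (\<sigma> * (N t x - n)) 0 * dt \<zeta> (x, t) + half_flux \<sigma> n (N t x) * dx \<zeta> (x, t)) +
    \<sigma> * (LBINT m:(if \<sigma> = 1 then {n<..1/2} else {-1/2<..n}). drift_term \<zeta> t m)"

lemma integral_dt_dx_0:
  assumes cut: "cutoff \<zeta> a t1 t2"
  shows "integrable lborel (\<lambda>t. LBINT x. c1 * dt \<zeta> (x, t) + c2 * dx \<zeta> (x, t))"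
    and "(LBINT t. LBINT x. c1 * dt \<zeta> (x, t) + c2 * dx \<zeta> (x, t)) = 0"
proof -
  interpret cutoff \<zeta> a t1 t2 by fact
  obtain B where B: "\<And>z. \<bar>dx \<zeta> z\<bar> \<le> B" "\<And>z. \<bar>dt \<zeta> z\<bar> \<le> B"
    using bounds by blast
  have dt: "(\<lambda>(t, x). dt \<zeta> (x, t)) \<in> borel_measurable (borel \<Otimes>\<^sub>M borel)"
    and dx: "(\<lambda>(t, x). dx \<zeta> (x, t)) \<in> borel_measurable (borel \<Otimes>\<^sub>M borel)"
    unfolding case_prod_beta by measurable
  note dtI = dt support_dt B(2) and dxI = dx support_dx B(1)
  have eq: "(LBINT x. c1 * dt \<zeta> (x, t) + c2 * dx \<zeta> (x, t)) = c1 * (LBINT x. dt \<zeta> (x, t))" for t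
    using integrable_section[OF dtI] integrable_section[OF dxI] integral_dx[of t]
    by simp
  show "integrable lborel (\<lambda>t. LBINT x. c1 * dt \<zeta> (x, t) + c2 * dx \<zeta> (x, t))"
    unfolding eq using integrable_iterated[OF dtI] by simp
  have "(LBINT t. LBINT x. dt \<zeta> (x, t)) = (LBINT x. LBINT t. dt \<zeta> (x, t))"
    by (rule lborel_pair.Fubini_integral[symmetric]) (rule integrable_joint[OF dtI])
  also have "\<dots> = 0" by (simp add: integral_dt)
  finally show "(LBINT t. LBINT x. c1 * dt \<zeta> (x, t) + c2 * dx \<zeta> (x, t)) = 0"
    unfolding eq by simp
qed

lemma flux_diff_le:
  assumes "u \<in> J" "\<alpha> \<in> J"
  shows "\<bar>A u - A \<alpha>\<bar> \<le> 1 + \<Lambda>"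
proof -
  have "\<Lambda> * \<bar>u - \<alpha>\<bar> \<le> \<Lambda> * 1"
    using assms by (intro mult_left_mono Lip_nonneg) (auto simp: abs_le_iff)
  with flux_lipschitz[OF assms] show ?thesis by simp
qed

lemma half_profile_integrable:
  assumes \<sigma>: "\<sigma> = 1 \<or> \<sigma> = - 1" and n: "n \<in> J" and cut: "cutoff \<zeta> a t1 t2"
  shows "integrable lborel (\<lambda>x. max (\<sigma> * (N t x - n)) 0 * dt \<zeta> (x, t) + half_flux \<sigma> n (N t x) * dx \<zeta> (x, t))"
proof (rule profile_integrable[OF cut, where g = "\<lambda>u. max (\<sigma> * (u - n)) 0" and h = "half_flux \<sigma> n"])
  show "(\<lambda>u. max (\<sigma> * (clampJ u - n)) 0) \<in> borel_measurable borel"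
    "(\<lambda>u. half_flux \<sigma> n (clampJ u)) \<in> borel_measurable borel"
    unfolding half_flux_def by measurable
  show "\<bar>max (\<sigma> * (u - n)) 0\<bar> \<le> 1 + \<Lambda>" "\<bar>half_flux \<sigma> n u\<bar> \<le> 1 + \<Lambda>" if "u \<in> J" for u
    using that n \<sigma> flux_diff_le[of u n] Lip_nonneg by (auto simp: half_flux_def abs_mult)
qed

text \<open>The Kruzkov inequality at level \<open>n\<close> is added to the one at an extreme
  level, where the sign of N - \<beta> is fixed and the entropy is affine in N. The sum is twice the
  one-sided entropy plus constants, which integrate to zero against derivatives of
  \<open>\<zeta>\<close>.\<close>

lemma half_entropy_nonneg:
  assumes \<sigma>: "\<sigma> = 1 \<or> \<sigma> = - 1" and n: "n \<in> J" and cut: "cutoff \<zeta> a t1 t2"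
    and t12: "0 < t1" "t2 < T" and nonneg: "\<And>z. 0 \<le> \<zeta> z"
  shows "integrable lborel (half_entropy \<sigma> n \<zeta>)" "0 \<le> (LBINT t. half_entropy \<sigma> n \<zeta> t)"
proof -
  define E where "E \<alpha> t = (LBINT x. \<bar>N t x - \<alpha>\<bar> * dt \<zeta> (x, t) + sgn (N t x - \<alpha>) * (A (N t x) - A \<alpha>) * dx \<zeta> (x, t)) +
      ((LBINT m:{\<alpha><..1/2}. drift_term \<zeta> t m) - (LBINT m:{-1/2<..\<alpha>}. drift_term \<zeta> t m))" for \<alpha> t
  \<comment> \<open>The endpoint of \<open>J\<close> opposite to the \<sigma>-side: there \<bar>N -
    \<beta>\<bar> = \<sigma> N + 1/2.\<close>
  define \<beta> where "\<beta> = - \<sigma> / 2"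
  have \<beta>: "\<beta> \<in> J" using \<sigma> by (auto simp: \<beta>_def)
  define K where "K t = (LBINT x. (\<sigma> * n + 1/2) * dt \<zeta> (x, t) + \<sigma> * (A n - A \<beta>) * dx \<zeta> (x, t))" for t
  note A_le = flux_diff_le
  have int_profile: "integrable lborel (\<lambda>x. \<bar>N t x - \<alpha>\<bar> * dt \<zeta> (x, t) + sgn (N t x - \<alpha>) * (A (N t x) - A \<alpha>) * dx \<zeta> (x, t))"
    "integrable lborel (\<lambda>t. LBINT x. \<bar>N t x - \<alpha>\<bar> * dt \<zeta> (x, t) + sgn (N t x - \<alpha>) * (A (N t x) - A \<alpha>) * dx \<zeta> (x, t))"
    if "\<alpha> \<in> J" for \<alpha> t
  proof -
    have m: "(\<lambda>u. \<bar>clampJ u - \<alpha>\<bar>) \<in> borel_measurable borel"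
      "(\<lambda>u. sgn (clampJ u - \<alpha>) * (A (clampJ u) - A \<alpha>)) \<in> borel_measurable borel"
      by measurable
    have b: "\<bar>\<bar>u - \<alpha>\<bar>\<bar> \<le> 1 + \<Lambda>" "\<bar>sgn (u - \<alpha>) * (A u - A \<alpha>)\<bar> \<le> 1 + \<Lambda>" if "u \<in> J" for u
      using that \<open>\<alpha> \<in> J\<close> A_le[of u \<alpha>] Lip_nonneg by (auto simp: abs_mult sgn_if)
    show "integrable lborel (\<lambda>x. \<bar>N t x - \<alpha>\<bar> * dt \<zeta> (x, t) + sgn (N t x - \<alpha>) * (A (N t x) - A \<alpha>) * dx \<zeta> (x, t))"
      by (rule profile_integrable[OF cut, where g = "\<lambda>u. \<bar>u - \<alpha>\<bar>" and h = "\<lambda>u. sgn (u - \<alpha>) * (A u - A \<alpha>)", OF m b])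
    show "integrable lborel (\<lambda>t. LBINT x. \<bar>N t x - \<alpha>\<bar> * dt \<zeta> (x, t) + sgn (N t x - \<alpha>) * (A (N t x) - A \<alpha>) * dx \<zeta> (x, t))"
      by (rule profile_integrable_time[OF cut, where g = "\<lambda>u. \<bar>u - \<alpha>\<bar>" and h = "\<lambda>u. sgn (u - \<alpha>) * (A u - A \<alpha>)", OF m b])
  qed
  note int_half = half_profile_integrable[OF \<sigma> n cut]
  have int_const: "integrable lborel (\<lambda>x. (\<sigma> * n + 1/2) * dt \<zeta> (x, t) + \<sigma> * (A n - A \<beta>) * dx \<zeta> (x, t))" for t
    by (rule profile_integrable[OF cut, where g = "\<lambda>_. \<sigma> * n + 1/2" and h = "\<lambda>_. \<sigma> * (A n - A \<beta>)"
        and C = "max \<bar>\<sigma> * n + 1/2\<bar> \<bar>\<sigma> * (A n - A \<beta>)\<bar>"]) auto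
  have int_E: "integrable lborel (E \<alpha>)" if "\<alpha> \<in> J" for \<alpha>
    unfolding E_def using that
    by (intro Bochner_Integration.integrable_add Bochner_Integration.integrable_diff int_profile
        drift_term_integrable_time[OF cut]) auto
  have int_K: "integrable lborel K" "(LBINT t. K t) = 0"
    unfolding K_def using integral_dt_dx_0[OF cut] by blast+
  have split: "(LBINT m:{-1/2<..1/2}. drift_term \<zeta> t m) =
      (LBINT m:{-1/2<..n}. drift_term \<zeta> t m) + (LBINT m:{n<..1/2}. drift_term \<zeta> t m)" for t
  proof -
    have "{-1/2<..1/2} = {-1/2<..n} \<union> {n<..1/2}" using n by auto
    then show ?thesis
      using n by (simp only:) (intro set_integral_Un drift_term_integrable[OF cut], auto)
  qed
  have sum: "E n t + E \<beta> t = 2 * half_entropy \<sigma> n \<zeta> t + K t" for t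
  proof -
    have "(LBINT x. \<bar>N t x - n\<bar> * dt \<zeta> (x, t) + sgn (N t x - n) * (A (N t x) - A n) * dx \<zeta> (x, t)) +
        (LBINT x. \<bar>N t x - \<beta>\<bar> * dt \<zeta> (x, t) + sgn (N t x - \<beta>) * (A (N t x) - A \<beta>) * dx \<zeta> (x, t)) =
        (LBINT x. (\<bar>N t x - n\<bar> * dt \<zeta> (x, t) + sgn (N t x - n) * (A (N t x) - A n) * dx \<zeta> (x, t)) +
          (\<bar>N t x - \<beta>\<bar> * dt \<zeta> (x, t) + sgn (N t x - \<beta>) * (A (N t x) - A \<beta>) * dx \<zeta> (x, t)))"
      by (intro Bochner_Integration.integral_add[symmetric] int_profile n \<beta>)
    also have "\<dots> = (LBINT x. 2 * (max (\<sigma> * (N t x - n)) 0 * dt \<zeta> (x, t) + half_flux \<sigma> n (N t x) * dx \<zeta> (x, t)) +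
          ((\<sigma> * n + 1/2) * dt \<zeta> (x, t) + \<sigma> * (A n - A \<beta>) * dx \<zeta> (x, t)))"
    proof (intro Bochner_Integration.integral_cong refl)
      fix x
      have u: "- 1/2 \<le> N t x" "N t x \<le> 1/2" by (rule prof.profile_bounds)+
      have "\<bar>N t x - n\<bar> + \<bar>N t x - \<beta>\<bar> = 2 * max (\<sigma> * (N t x - n)) 0 + (\<sigma> * n + 1/2)"
        using \<sigma> u by (auto simp: \<beta>_def max_def abs_if)
      moreover have "sgn (N t x - n) * (A (N t x) - A n) + sgn (N t x - \<beta>) * (A (N t x) - A \<beta>) =
          2 * half_flux \<sigma> n (N t x) + \<sigma> * (A n - A \<beta>)"
      proof -
        have "sgn (N t x - \<beta>) * (A (N t x) - A \<beta>) = \<sigma> * (A (N t x) - A \<beta>)"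
          using \<sigma> u by (cases "N t x = \<beta>") (auto simp: \<beta>_def sgn_if)
        moreover have "sgn (N t x - n) * (A (N t x) - A n) = 2 * half_flux \<sigma> n (N t x) - \<sigma> * (A (N t x) - A n)"
          using \<sigma> by (auto simp: half_flux_def sgn_if)
        ultimately show ?thesis by (simp add: algebra_simps)
      qed
      ultimately show "(\<bar>N t x - n\<bar> * dt \<zeta> (x, t) + sgn (N t x - n) * (A (N t x) - A n) * dx \<zeta> (x, t)) +
          (\<bar>N t x - \<beta>\<bar> * dt \<zeta> (x, t) + sgn (N t x - \<beta>) * (A (N t x) - A \<beta>) * dx \<zeta> (x, t)) =
          2 * (max (\<sigma> * (N t x - n)) 0 * dt \<zeta> (x, t) + half_flux \<sigma> n (N t x) * dx \<zeta> (x, t)) +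
          ((\<sigma> * n + 1/2) * dt \<zeta> (x, t) + \<sigma> * (A n - A \<beta>) * dx \<zeta> (x, t))"
        by algebra
    qed
    also have "\<dots> = 2 * (LBINT x. max (\<sigma> * (N t x - n)) 0 * dt \<zeta> (x, t) + half_flux \<sigma> n (N t x) * dx \<zeta> (x, t)) + K t"
    proof -
      have i: "integrable lborel (\<lambda>x. 2 * (max (\<sigma> * (N t x - n)) 0 * dt \<zeta> (x, t) + half_flux \<sigma> n (N t x) * dx \<zeta> (x, t)))"
        by (intro integrable_mult_right int_half)
      show ?thesis
        unfolding K_def
        by (simp only: Bochner_Integration.integral_add[OF i int_const] integral_mult_right_zero)
    qed
    finally have "(LBINT x. \<bar>N t x - n\<bar> * dt \<zeta> (x, t) + sgn (N t x - n) * (A (N t x) - A n) * dx \<zeta> (x, t)) +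
        (LBINT x. \<bar>N t x - \<beta>\<bar> * dt \<zeta> (x, t) + sgn (N t x - \<beta>) * (A (N t x) - A \<beta>) * dx \<zeta> (x, t)) =
        2 * (LBINT x. max (\<sigma> * (N t x - n)) 0 * dt \<zeta> (x, t) + half_flux \<sigma> n (N t x) * dx \<zeta> (x, t)) + K t" .
    \<comment> \<open>At the extreme level, one of the two intervals of levels is empty.\<close>
    moreover have "(LBINT m:{}. drift_term \<zeta> t m) = 0"
      by (simp add: set_lebesgue_integral_def)
    ultimately show ?thesis
      unfolding E_def half_entropy_def using \<sigma> split[of t] by (auto simp: \<beta>_def)
  qed
  have eq: "half_entropy \<sigma> n \<zeta> = (\<lambda>t. (E n t + E \<beta> t - K t) / 2)"
    using sum by (auto simp: fun_eq_iff)
  show "integrable lborel (half_entropy \<sigma> n \<zeta>)"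
    unfolding eq by (intro integrable_divide Bochner_Integration.integrable_diff
        Bochner_Integration.integrable_add int_E int_K n \<beta>)
  have "0 \<le> (LBINT t. E n t)" "0 \<le> (LBINT t. E \<beta> t)"
    unfolding E_def using entropy[OF _ cut t12 nonneg] n \<beta> by blast+
  then show "0 \<le> (LBINT t. half_entropy \<sigma> n \<zeta> t)"
    unfolding eq using int_E[OF n] int_E[OF \<beta>] int_K by simp
qed

end

section \<open>Monotone weights and integration by parts\<close>

lemma smooth_step_has_derivative: "(smooth_step has_real_derivative deriv smooth_step x) (at x)"
  and smooth_step_deriv_nonneg: "0 \<le> deriv smooth_step x"
  and smooth_step_deriv_continuous: "continuous_on UNIV (deriv smooth_step)"
proof -
  obtain s' where s': "\<And>x. (smooth_step has_real_derivative s' x) (at x)" "continuous_on UNIV s'" "\<And>x. 0 \<le> s' x"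
    using smooth_step_DERIV by blast
  have "deriv smooth_step = s'" using DERIV_imp_deriv[OF s'(1)] by auto
  with s' show "(smooth_step has_real_derivative deriv smooth_step x) (at x)" "0 \<le> deriv smooth_step x"
    "continuous_on UNIV (deriv smooth_step)" by simp_all
qed

lemma smooth_step_deriv_eq_0:
  assumes "x < 0 \<or> 1 < x"
  shows "deriv smooth_step x = 0"
proof -
  have "(smooth_step has_real_derivative 0) (at x)"
    using assms
  proof
    assume "x < 0"
    then show ?thesis
      by (intro has_field_derivative_transform_within_open[OF DERIV_const[of 0], where S = "{..<0}"])
        (auto simp: smooth_step_eq)
  next
    assume "1 < x"
    then show ?thesis
      by (intro has_field_derivative_transform_within_open[OF DERIV_const[of 1], where S = "{1<..}"])
        (auto simp: smooth_step_eq)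
  qed
  then show ?thesis by (rule DERIV_imp_deriv)
qed

text \<open>Despite its name it is monotone: exp (- 1/x) for positive x and 0 otherwise.
  Monotonicity in x gives the flux and drift terms a definite sign.\<close>

abbreviation "bump \<equiv> flat_exp 1"
abbreviation "bump' \<equiv> flat_exp [:0, 0, 1:]"

lemma DERIV_bump: "(bump has_real_derivative bump' x) (at x)"
  using DERIV_flat_exp[of 1 x] by simp

lemma bump_nonneg: "0 \<le> bump x" and bump_le_1: "bump x \<le> 1"
  and bump_pos: "0 < x \<Longrightarrow> 0 < bump x" and bump_eq_0: "x \<le> 0 \<Longrightarrow> bump x = 0"
  and bump'_nonneg: "0 \<le> bump' x" and bump'_eq_0: "x \<le> 0 \<Longrightarrow> bump' x = 0"
  by (auto simp: flat_exp_def)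

lemma bump_mono: "x \<le> y \<Longrightarrow> bump x \<le> bump y"
  by (auto simp: flat_exp_def)

lemma continuous_flat_exp: "continuous_on UNIV (flat_exp p)"
  using DERIV_flat_exp by (blast intro: DERIV_continuous_on has_field_derivative_at_within)

lemma flat_exp_measurable [measurable]: "flat_exp p \<in> borel_measurable borel"
  by (intro borel_measurable_continuous_onI continuous_flat_exp)

lemma bump'_bounded:
  obtains C where "0 \<le> C" "\<And>x. bump' x \<le> C"
proof
  show "0 \<le> (2::real)" by simp
  show "bump' x \<le> 2" for x
  proof (cases "0 < x")
    case True
    let ?y = "inverse x"
    \<comment> \<open>The bound 2 comes from the quadratic Taylor minorant of exp at y =
      1/x.\<close>
    have "?y\<^sup>2 / 2 \<le> exp ?y"
      using exp_lower_Taylor_quadratic[of ?y] positive_imp_inverse_positive[OF True] by linarith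
    then show ?thesis using True
      by (simp add: flat_exp_def exp_minus field_simps power2_eq_square)
  qed (simp add: flat_exp_def)
qed

context distribution_profile
begin

text \<open>Layer-cake formula: integration by parts against the measure \<open>\<partial>\<^sub>x max (\<sigma> (F - n)) 0\<close>.\<close>
lemma layer_cake:
  assumes \<sigma>: "\<sigma> = 1 \<or> \<sigma> = - 1" and n: "n \<in> J"
  shows "(LBINT m:(if \<sigma> = 1 then {n<..1/2} else {-1/2<..n}). bump (\<sigma> * (z - Q m))) =
    (LBINT x. max (\<sigma> * (F x - n)) 0 * bump' (\<sigma> * (z - x)))"
proof -
  let ?S = "if \<sigma> = 1 then {n<..1/2} else {-1/2<..n}"
  \<comment> \<open>The region between the graph of \<open>F\<close> and the level \<open>n\<close>,
    on the \<sigma>-side. Integrating over x first gives the bump at the quantile, over m first the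
    excess; Tonelli equates the two.\<close>
  define k where "k m x \<longleftrightarrow> (\<sigma> = 1 \<and> n < m \<and> m \<le> F x) \<or> (\<sigma> = - 1 \<and> F x < m \<and> m \<le> n)" for m x
  have F [measurable]: "F \<in> borel_measurable borel"
    using profile_mono by (rule borel_measurable_mono)
  have Qm: "Q \<in> borel_measurable (restrict_space lborel ?S)"
    using quantile_measurable[of n "1/2"] quantile_measurable[of "-1/2" n] n by auto
  have inner_x: "(\<integral>\<^sup>+x. indicator {x. k m x} x * ennreal (bump' (\<sigma> * (z - x))) \<partial>lborel) =
      indicator ?S m * ennreal (bump (\<sigma> * (z - Q m)))" for m
  proof (cases "m \<in> ?S")
    case False
    then have "\<not> k m x" for x
      using profile_bounds[of x] n by (auto simp: k_def split: if_splits)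
    with False show ?thesis by simp
  next
    case True
    then have m: "- 1/2 < m" "m \<le> 1/2" using n by (auto split: if_splits)
    show ?thesis
      using \<sigma>
    proof
      assume [simp]: "\<sigma> = 1"
      have k: "k m x \<longleftrightarrow> Q m \<le> x" for x
        using True quantile_le_iff[OF m] by (auto simp: k_def)
      show ?thesis
      proof (cases "Q m \<le> z")
        case le: True
        have "(\<integral>\<^sup>+x. indicator {x. k m x} x * ennreal (bump' (\<sigma> * (z - x))) \<partial>lborel) =
            (\<integral>\<^sup>+x. ennreal (bump' (z - x)) * indicator {Q m..z} x \<partial>lborel)"
          by (intro nn_integral_cong) (auto simp: k bump'_eq_0 split: split_indicator)
        also have "\<dots> = ennreal (- bump (z - z) - - bump (z - Q m))"
        proof (rule nn_integral_FTC_Icc)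
          show "((\<lambda>x. - bump (z - x)) has_real_derivative bump' (z - x)) (at x)" for x
            by (rule derivative_eq_intros DERIV_chain2[OF DERIV_bump] refl)+ simp
        qed (use le in \<open>auto simp: bump'_nonneg\<close>)
        finally show ?thesis using True by (simp add: bump_eq_0)
      next
        case gt: False
        have "(\<integral>\<^sup>+x. indicator {x. k m x} x * ennreal (bump' (\<sigma> * (z - x))) \<partial>lborel) = (\<integral>\<^sup>+x. 0 \<partial>(lborel :: real measure))"
          using gt by (intro nn_integral_cong) (auto simp: k bump'_eq_0 split: split_indicator)
        with gt show ?thesis by (simp add: bump_eq_0)
      qed
    next
      assume [simp]: "\<sigma> = - 1"
      have k: "k m x \<longleftrightarrow> x < Q m" for x
        using True less_quantile_iff[OF m] by (auto simp: k_def)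
      show ?thesis
      proof (cases "z \<le> Q m")
        case le: True
        have "(\<integral>\<^sup>+x. indicator {x. k m x} x * ennreal (bump' (\<sigma> * (z - x))) \<partial>lborel) =
            (\<integral>\<^sup>+x. ennreal (bump' (x - z)) * indicator {z..Q m} x \<partial>lborel)"
        \<comment> \<open>The region is open at \<open>Q m\<close> while the interval is closed; the
          two integrands can differ only at that point.\<close>
        proof (rule nn_integral_cong_AE)
          show "AE x in lborel. indicator {x. k m x} x * ennreal (bump' (\<sigma> * (z - x))) =
              ennreal (bump' (x - z)) * indicator {z..Q m} x"
            using AE_lborel_singleton[of "Q m"]
            by eventually_elim (auto simp: k bump'_eq_0 split: split_indicator)
        qed
        also have "\<dots> = ennreal (bump (Q m - z) - bump (z - z))"
        proof (rule nn_integral_FTC_Icc)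
          show "((\<lambda>x. bump (x - z)) has_real_derivative bump' (x - z)) (at x)" for x
            using DERIV_bump[of "x - z"] DERIV_shift[of bump _ x "- z"] by simp
        qed (use le in \<open>auto simp: bump'_nonneg\<close>)
        finally show ?thesis using True by (simp add: bump_eq_0)
      next
        case gt: False
        have "(\<integral>\<^sup>+x. indicator {x. k m x} x * ennreal (bump' (\<sigma> * (z - x))) \<partial>lborel) = (\<integral>\<^sup>+x. 0 \<partial>(lborel :: real measure))"
          using gt by (intro nn_integral_cong) (auto simp: k bump'_eq_0 split: split_indicator)
        with gt show ?thesis by (simp add: bump_eq_0)
      qed
    qed
  qed
  have inner_m: "(\<integral>\<^sup>+m. indicator {x. k m x} x * ennreal (bump' (\<sigma> * (z - x))) \<partial>lborel) =
      ennreal (max (\<sigma> * (F x - n)) 0 * bump' (\<sigma> * (z - x)))" for x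
  proof -
    have "(\<integral>\<^sup>+m. indicator {x. k m x} x * ennreal (bump' (\<sigma> * (z - x))) \<partial>lborel) =
        (\<integral>\<^sup>+m. ennreal (bump' (\<sigma> * (z - x))) * indicator (if \<sigma> = 1 then {n<..F x} else {F x<..n}) m \<partial>lborel)"
      using \<sigma> by (intro nn_integral_cong) (auto simp: k_def split: split_indicator)
    also have "\<dots> = ennreal (bump' (\<sigma> * (z - x))) * emeasure lborel (if \<sigma> = 1 then {n<..F x} else {F x<..n})"
      by (rule nn_integral_cmult_indicator) auto
    also have "emeasure lborel (if \<sigma> = 1 then {n<..F x} else {F x<..n}) = ennreal (max (\<sigma> * (F x - n)) 0)"
      using \<sigma> by (cases "n \<le> F x") (auto simp: max_def)
    finally show ?thesis
      by (simp add: ennreal_mult bump'_nonneg mult.commute)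
  qed
  have km: "Measurable.pred (lborel \<Otimes>\<^sub>M lborel) (\<lambda>p. k (fst p) (snd p))"
    unfolding k_def by measurable
  have "(LBINT m:?S. bump (\<sigma> * (z - Q m))) = enn2real (\<integral>\<^sup>+m. ennreal (indicator ?S m *\<^sub>R bump (\<sigma> * (z - Q m))) \<partial>lborel)"
    unfolding set_lebesgue_integral_def
  proof (rule integral_eq_nn_integral)
    have "(\<lambda>m. bump (\<sigma> * (z - Q m))) \<in> borel_measurable (restrict_space lborel ?S)"
      using Qm by measurable
    then show "(\<lambda>m. indicator ?S m *\<^sub>R bump (\<sigma> * (z - Q m))) \<in> borel_measurable lborel"
      by (subst (asm) borel_measurable_restrict_space_iff) auto
  qed (auto simp: bump_nonneg)
  also have "(\<integral>\<^sup>+m. ennreal (indicator ?S m *\<^sub>R bump (\<sigma> * (z - Q m))) \<partial>lborel) =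
      (\<integral>\<^sup>+m. \<integral>\<^sup>+x. indicator {x. k m x} x * ennreal (bump' (\<sigma> * (z - x))) \<partial>lborel \<partial>lborel)"
    unfolding inner_x by (intro nn_integral_cong) (auto split: split_indicator)
  also have "\<dots> = (\<integral>\<^sup>+x. \<integral>\<^sup>+m. indicator {x. k m x} x * ennreal (bump' (\<sigma> * (z - x))) \<partial>lborel \<partial>lborel)"
  proof (rule lborel_pair.Fubini'[symmetric])
    have "(\<lambda>p. indicator {p. k (fst p) (snd p)} p * ennreal (bump' (\<sigma> * (z - snd p)))) \<in> borel_measurable (lborel \<Otimes>\<^sub>M lborel)"
      using km by measurable
    then show "(\<lambda>(m, x). indicator {x. k m x} x * ennreal (bump' (\<sigma> * (z - x)))) \<in> borel_measurable (lborel \<Otimes>\<^sub>M lborel)"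
      by (simp add: case_prod_beta indicator_def)
  qed
  also have "enn2real \<dots> = (LBINT x. max (\<sigma> * (F x - n)) 0 * bump' (\<sigma> * (z - x)))"
    unfolding inner_m
    by (rule integral_eq_nn_integral[symmetric]) (auto simp: bump'_nonneg)
  finally show ?thesis .
qed

end

section \<open>Transport of fronts\<close>

context entropy_flow
begin

abbreviation "excess \<sigma> n s x \<equiv> max (\<sigma> * (N s x - n)) 0"

lemma excess_bounded:
  assumes "\<sigma> = 1 \<or> \<sigma> = - 1" "n \<in> J"
  shows "0 \<le> excess \<sigma> n s x" "excess \<sigma> n s x \<le> 1"
  using assms prof.profile_bounds[of s x] by auto

lemma excess_eq_0:
  assumes "\<sigma> = 1 \<or> \<sigma> = - 1" "n \<in> J" "\<sigma> * x < - R"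
  shows "excess \<sigma> n s x = 0"
  using assms prof.profile_left[of x s] prof.profile_right[of x s] by auto

lemma excess_measurable [measurable]: "(\<lambda>x. excess \<sigma> n s x) \<in> borel_measurable borel"
  using borel_measurable_mono[OF prof.profile_mono[of s]] by measurable

lemma excess_integrable:
  assumes \<sigma>: "\<sigma> = 1 \<or> \<sigma> = - 1" and n: "n \<in> J"
    and g [measurable]: "g \<in> borel_measurable borel" and bound: "\<And>x. \<bar>g x\<bar> \<le> C"
    and supp: "\<And>x. b \<le> \<sigma> * x \<Longrightarrow> g x = 0"
  shows "integrable lborel (\<lambda>x. excess \<sigma> n s x * g x)"
proof (rule integrableI_bounded_set[where A = "{- (R + \<bar>b\<bar>)..R + \<bar>b\<bar>}" and B = C])
  show "AE x in lborel. x \<in> {- (R + \<bar>b\<bar>)..R + \<bar>b\<bar>} \<longrightarrow> norm (excess \<sigma> n s x * g x) \<le> C"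
  proof (intro AE_I2 impI)
    fix x
    have "\<bar>excess \<sigma> n s x\<bar> * \<bar>g x\<bar> \<le> 1 * C"
      using excess_bounded[OF \<sigma> n, of s x] bound[of x] by (intro mult_mono) auto
    then show "norm (excess \<sigma> n s x * g x) \<le> C" by (simp add: abs_mult)
  qed
  show "AE x in lborel. x \<notin> {- (R + \<bar>b\<bar>)..R + \<bar>b\<bar>} \<longrightarrow> excess \<sigma> n s x * g x = 0"
  proof (intro AE_I2 impI)
    fix x assume x: "x \<notin> {- (R + \<bar>b\<bar>)..R + \<bar>b\<bar>}"
    have "\<sigma> * x < - R \<or> b \<le> \<sigma> * x"
      using \<sigma> x prof.radius_nonneg by auto
    then show "excess \<sigma> n s x * g x = 0"
      using excess_eq_0[OF \<sigma> n] supp by (metis mult_eq_0_iff)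
  qed
qed (auto simp: emeasure_lborel_Icc_eq)

text \<open>With D the excess weighted by \<open>bump'\<close>, the moving line contributes \<theta>
  \<sigma> w D, the flux at most - \<theta> \<sigma> p D by the supporting slope, and the drift at
  most \<theta> \<sigma> v D by the layer-cake formula. By \<open>speed\<close> their sum is at most
  0, so only the derivative of the time weight survives.\<close>

lemma half_entropy_cutoff_le:
  assumes \<sigma>: "\<sigma> = 1 \<or> \<sigma> = - 1" and n: "n \<in> J"
    and slope: "\<And>m. m \<in> J \<Longrightarrow> 0 < \<sigma> * (m - n) \<Longrightarrow> A n + p * (m - n) \<le> A m"
    and speed: "\<sigma> * w \<le> \<sigma> * (p - v)"
    and drift: "\<And>x. \<sigma> * x < \<sigma> * z \<Longrightarrow> \<sigma> * V s x \<le> \<sigma> * v"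
    and cut: "cutoff \<zeta> a t1 t2" and \<theta>: "0 \<le> \<theta>"
    and \<zeta>: "\<And>x. - R \<le> \<sigma> * x \<Longrightarrow> \<zeta> (x, s) = bump (\<sigma> * (z - x)) * \<theta>"
    and dx: "\<And>x. - R \<le> \<sigma> * x \<Longrightarrow> dx \<zeta> (x, s) = - (\<sigma> * bump' (\<sigma> * (z - x)) * \<theta>)"
    and dt: "\<And>x. - R \<le> \<sigma> * x \<Longrightarrow> dt \<zeta> (x, s) = \<sigma> * w * bump' (\<sigma> * (z - x)) * \<theta> + bump (\<sigma> * (z - x)) * \<theta>'"
  shows "half_entropy \<sigma> n \<zeta> s \<le> \<theta>' * (LBINT x. excess \<sigma> n s x * bump (\<sigma> * (z - x)))"
proof -
  let ?S = "if \<sigma> = 1 then {n<..1/2} else {-1/2<..n}"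
  define I where "I = (LBINT x. excess \<sigma> n s x * bump (\<sigma> * (z - x)))"
  define D where "D = (LBINT x. excess \<sigma> n s x * bump' (\<sigma> * (z - x)))"
  obtain C where C: "\<And>x. bump' x \<le> C" using bump'_bounded by blast
  have int_I: "integrable lborel (\<lambda>x. excess \<sigma> n s x * bump (\<sigma> * (z - x)))"
    by (rule excess_integrable[OF \<sigma> n, where C = 1 and b = "\<sigma> * z"])
      (auto simp: bump_nonneg bump_le_1 intro!: bump_eq_0 simp: right_diff_distrib)
  have int_D: "integrable lborel (\<lambda>x. excess \<sigma> n s x * bump' (\<sigma> * (z - x)))"
    by (rule excess_integrable[OF \<sigma> n, where C = C and b = "\<sigma> * z"])
      (auto simp: bump'_nonneg C intro!: bump'_eq_0 simp: right_diff_distrib)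
  have D: "0 \<le> D"
    unfolding D_def by (intro Bochner_Integration.integral_nonneg mult_nonneg_nonneg excess_bounded[OF \<sigma> n] bump'_nonneg)
  have "(LBINT x. excess \<sigma> n s x * dt \<zeta> (x, s) + half_flux \<sigma> n (N s x) * dx \<zeta> (x, s)) \<le>
      (LBINT x. \<theta>' * (excess \<sigma> n s x * bump (\<sigma> * (z - x))) + \<theta> * \<sigma> * (w - p) * (excess \<sigma> n s x * bump' (\<sigma> * (z - x))))"
  proof (rule integral_mono)
    show "integrable lborel (\<lambda>x. excess \<sigma> n s x * dt \<zeta> (x, s) + half_flux \<sigma> n (N s x) * dx \<zeta> (x, s))"
      by (rule half_profile_integrable[OF \<sigma> n cut])
    show "integrable lborel (\<lambda>x. \<theta>' * (excess \<sigma> n s x * bump (\<sigma> * (z - x))) + \<theta> * \<sigma> * (w - p) * (excess \<sigma> n s x * bump' (\<sigma> * (z - x))))"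
      by (intro Bochner_Integration.integrable_add integrable_mult_right int_I int_D)
    fix x
    let ?e = "bump (\<sigma> * (z - x))" and ?e' = "bump' (\<sigma> * (z - x))"
    show "excess \<sigma> n s x * dt \<zeta> (x, s) + half_flux \<sigma> n (N s x) * dx \<zeta> (x, s) \<le>
        \<theta>' * (excess \<sigma> n s x * ?e) + \<theta> * \<sigma> * (w - p) * (excess \<sigma> n s x * ?e')"
    proof (cases "0 < \<sigma> * (N s x - n)")
      case True
      \<comment> \<open>Where \<sigma> x < - R the excess vanishes, so the formulas for
        \<open>\<zeta>\<close> are required only on the other side.\<close>
      then have "- R \<le> \<sigma> * x"
        using excess_eq_0[OF \<sigma> n, of x s] by (force simp: not_less)
      note d = dx[OF this] dt[OF this]
      have "A n + p * (N s x - n) \<le> A (N s x)"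
        using True by (intro slope prof.profile_in_J)
      then have "p * (N s x - n) * (?e' * \<theta>) \<le> (A (N s x) - A n) * (?e' * \<theta>)"
        using \<theta> by (intro mult_right_mono mult_nonneg_nonneg bump'_nonneg) auto
      moreover have "half_flux \<sigma> n (N s x) * dx \<zeta> (x, s) = - (\<sigma> * \<sigma>) * ((A (N s x) - A n) * (?e' * \<theta>))"
        "\<theta> * \<sigma> * (w - p) * (excess \<sigma> n s x * ?e') =
          \<sigma> * (N s x - n) * (\<sigma> * w * ?e' * \<theta>) - (\<sigma> * \<sigma>) * (p * (N s x - n) * (?e' * \<theta>))"
        using True unfolding d by (simp_all add: half_flux_def algebra_simps)
      moreover have "\<sigma> * \<sigma> = 1" using \<sigma> by auto
      ultimately show ?thesis
        using True unfolding d(2) by (simp add: algebra_simps)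
    next
      case False
      then show ?thesis by (simp add: half_flux_def)
    qed
  qed
  also have "\<dots> = \<theta>' * I + \<theta> * \<sigma> * (w - p) * D"
    unfolding I_def D_def
    using Bochner_Integration.integral_add[OF integrable_mult_right[OF int_I, of \<theta>']
        integrable_mult_right[OF int_D, of "\<theta> * \<sigma> * (w - p)"]]
    by (simp only: integral_mult_right_zero)
  finally have 1: "(LBINT x. excess \<sigma> n s x * dt \<zeta> (x, s) + half_flux \<sigma> n (N s x) * dx \<zeta> (x, s)) \<le>
      \<theta>' * I + \<theta> * \<sigma> * (w - p) * D" .
  have S: "?S \<in> sets borel" "?S \<subseteq> {-1/2<..1/2}" "emeasure lborel ?S < \<infinity>" using n by auto
  have "\<sigma> * (LBINT m:?S. drift_term \<zeta> s m) = (LBINT m:?S. \<sigma> * drift_term \<zeta> s m)"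
    by simp
  also have "\<dots> \<le> (LBINT m:?S. \<theta> * \<sigma> * v * bump (\<sigma> * (z - Q s m)))"
  proof (rule set_integral_mono)
    show "set_integrable lborel ?S (\<lambda>m. \<sigma> * drift_term \<zeta> s m)"
      using drift_term_integrable[OF cut S(1,2)] by simp
    have Qm: "Q s \<in> borel_measurable (restrict_space lborel ?S)"
      using prof.quantile_measurable[of n "1/2" s] prof.quantile_measurable[of "-1/2" n s] n by auto
    have "set_integrable lborel ?S (\<lambda>m. bump (\<sigma> * (z - Q s m)))"
    proof (rule set_integrable_bounded[OF S(1,3), where B = 1])
      show "(\<lambda>m. bump (\<sigma> * (z - Q s m))) \<in> borel_measurable (restrict_space lborel ?S)"
        using Qm by measurable
    qed (auto simp: bump_nonneg bump_le_1)
    then show "set_integrable lborel ?S (\<lambda>m. \<theta> * \<sigma> * v * bump (\<sigma> * (z - Q s m)))"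
      by simp
    fix m assume "m \<in> ?S"
    then have m: "- 1/2 < m" "m \<le> 1/2" using n by (auto split: if_splits)
    have "- R \<le> \<sigma> * Q s m" using prof.quantile_bounds[OF m, of s] \<sigma> by auto
    note z = \<zeta>[OF this]
    show "\<sigma> * drift_term \<zeta> s m \<le> \<theta> * \<sigma> * v * bump (\<sigma> * (z - Q s m))"
    proof (cases "\<sigma> * Q s m < \<sigma> * z")
      case True
      have "bump (\<sigma> * (z - Q s m)) * \<theta> * (\<sigma> * V s (Q s m)) \<le> bump (\<sigma> * (z - Q s m)) * \<theta> * (\<sigma> * v)"
        using \<theta> by (intro mult_left_mono drift[OF True] mult_nonneg_nonneg bump_nonneg)
      then show ?thesis unfolding z by (simp add: algebra_simps)
    next
      case False
      then have "bump (\<sigma> * (z - Q s m)) = 0" by (intro bump_eq_0) (simp add: right_diff_distrib)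
      then show ?thesis unfolding z by simp
    qed
  qed
  also have "\<dots> = \<theta> * \<sigma> * v * D"
    unfolding D_def using prof.layer_cake[OF \<sigma> n, where z = z and t = s] by simp
  finally have 2: "\<sigma> * (LBINT m:?S. drift_term \<zeta> s m) \<le> \<theta> * \<sigma> * v * D" .
  have "\<theta> * D * (\<sigma> * w) \<le> \<theta> * D * (\<sigma> * (p - v))"
    by (rule mult_left_mono[OF speed]) (simp add: \<theta> D)
  then have "\<theta>' * I + \<theta> * \<sigma> * (w - p) * D + \<theta> * \<sigma> * v * D \<le> \<theta>' * I"
    by (simp add: algebra_simps)
  with 1 2 show ?thesis
    unfolding half_entropy_def I_def by linarith
qed

text \<open>If the graph of \<open>A\<close> lies above a line of slope \<open>p\<close> on the \<open>\<sigma>\<close>-side of the level \<open>n\<close>, the front of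
  \<open>{\<sigma> (N - n) > 0}\<close> is not overtaken by a line moving more slowly than \<open>p - V\<close>: the \<open>\<sigma>\<close>-part of the
  entropy inequality, tested with a function that is monotone in \<open>x\<close> and transported along the line, shows
  that the mass beyond the line cannot grow from zero.\<close>
lemma transport:
  assumes \<sigma>: "\<sigma> = 1 \<or> \<sigma> = - 1" and n: "n \<in> J"
    and t: "0 \<le> ti" "ti < t" "t < T"
    and slope: "\<And>m. m \<in> J \<Longrightarrow> 0 < \<sigma> * (m - n) \<Longrightarrow> A n + p * (m - n) \<le> A m"
    and speed: "\<sigma> * w \<le> \<sigma> * (p - v)"
    and drift: "\<And>s x. ti \<le> s \<Longrightarrow> s \<le> t \<Longrightarrow> \<sigma> * x < \<sigma> * (zi + w * (s - ti)) \<Longrightarrow> \<sigma> * V s x \<le> \<sigma> * v"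
    and init: "\<And>x. \<sigma> * x < \<sigma> * zi \<Longrightarrow> \<sigma> * (N ti x - n) \<le> 0"
    and x0: "\<sigma> * x0 < \<sigma> * (zi + w * (t - ti))"
  shows "\<sigma> * (N t x0 - n) \<le> 0"
proof (rule ccontr)
  assume neg: "\<not> \<sigma> * (N t x0 - n) \<le> 0"
  define z where "z s = zi + w * (s - ti)" for s
  define L where "L s s' = (LBINT x. \<bar>N s x - N s' x\<bar>)" for s s'
  define I where "I s = (LBINT x. excess \<sigma> n s x * bump (\<sigma> * (z s - x)))" for s
  have excess_diff: "\<bar>excess \<sigma> n s x - excess \<sigma> n s' x\<bar> \<le> \<bar>N s x - N s' x\<bar>" for s s' x
    using \<sigma> by (auto simp: max_def abs_if)
  have int_I: "integrable lborel (\<lambda>x. excess \<sigma> n s x * bump (\<sigma> * (z s - x)))" for s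
    by (rule excess_integrable[OF \<sigma> n, where C = 1 and b = "\<sigma> * z s"])
      (auto simp: bump_nonneg bump_le_1 intro!: bump_eq_0 simp: right_diff_distrib)
  \<comment> \<open>Initially there is no excess on the side \<sigma> x < \<sigma> zi, so only the
    strip swept by the line and the L1 change since \<open>ti\<close> contribute.\<close>
  have upper: "I s \<le> L s ti + \<bar>w\<bar> * \<bar>s - ti\<bar>" for s
  proof -
    let ?B = "{min zi (z s)..max zi (z s)}"
    have "I s \<le> (LBINT x. \<bar>N s x - N ti x\<bar> + indicator ?B x)"
      unfolding I_def
    proof (rule integral_mono[OF int_I])
      show "integrable lborel (\<lambda>x. \<bar>N s x - N ti x\<bar> + indicator ?B x)"
        by (intro Bochner_Integration.integrable_add N_diff_integrable integrable_real_indicator)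
          (auto simp: emeasure_lborel_Icc_eq)
      fix x
      have "excess \<sigma> n s x * bump (\<sigma> * (z s - x)) \<le>
          (excess \<sigma> n ti x + \<bar>N s x - N ti x\<bar>) * bump (\<sigma> * (z s - x))"
        using excess_diff[of s x ti] by (intro mult_right_mono bump_nonneg) linarith
      also have "\<dots> \<le> excess \<sigma> n ti x * bump (\<sigma> * (z s - x)) + \<bar>N s x - N ti x\<bar>"
        using mult_left_mono[OF bump_le_1[of "\<sigma> * (z s - x)"], of "\<bar>N s x - N ti x\<bar>"]
        by (simp add: distrib_right)
      also have "excess \<sigma> n ti x * bump (\<sigma> * (z s - x)) \<le> indicator ?B x"
      proof (cases "\<sigma> * x < \<sigma> * zi \<or> \<sigma> * z s \<le> \<sigma> * x")
        case True
        then have "excess \<sigma> n ti x = 0 \<or> bump (\<sigma> * (z s - x)) = 0"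
          using init[of x] by (auto intro!: bump_eq_0 simp: right_diff_distrib)
        then show ?thesis by auto
      next
        case False
        then have "x \<in> ?B" using \<sigma> by (auto simp: min_def max_def)
        moreover have "excess \<sigma> n ti x * bump (\<sigma> * (z s - x)) \<le> 1 * 1"
          by (intro mult_mono excess_bounded[OF \<sigma> n] bump_le_1 bump_nonneg) simp
        ultimately show ?thesis by simp
      qed
      finally show "excess \<sigma> n s x * bump (\<sigma> * (z s - x)) \<le> \<bar>N s x - N ti x\<bar> + indicator ?B x"
        by simp
    qed
    also have "\<dots> = L s ti + (max zi (z s) - min zi (z s))"
      unfolding L_def
      by (subst Bochner_Integration.integral_add)
        (auto intro!: N_diff_integrable integrable_real_indicator simp: emeasure_lborel_Icc_eq)
    also have "max zi (z s) - min zi (z s) = \<bar>w * (s - ti)\<bar>"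
      by (auto simp: z_def max_def min_def)
    finally show ?thesis by (simp add: abs_mult)
  qed
  \<comment> \<open>Between \<open>x0\<close> and this midpoint the excess at time \<open>t\<close>
    is at least its positive value at \<open>x0\<close>, and the line is at least \<open>d\<close>
    away. With the remaining distance \<open>d / 2\<close> at nearby times, 4 \<epsilon> bounds the
    weighted mass on the segment from below.\<close>
  define y where "y = (x0 + z t) / 2"
  define d where "d = \<sigma> * (z t - y)"
  have d: "0 < d" and y: "\<sigma> * x0 < \<sigma> * y"
    using x0 \<sigma> by (auto simp: d_def y_def z_def field_simps)
  define c where "c = excess \<sigma> n t x0 * bump (d / 2)"
  define \<epsilon> where "\<epsilon> = c * \<bar>y - x0\<bar> / 4"
  have c: "0 < c" unfolding c_def using neg d by (intro mult_pos_pos bump_pos) auto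
  have \<epsilon>: "0 < \<epsilon>" unfolding \<epsilon>_def using c y by (cases "y = x0") auto
  have lower: "4 * \<epsilon> - L s t \<le> I s" if s: "\<bar>w\<bar> * \<bar>s - t\<bar> \<le> d / 2" for s
  proof -
    let ?B = "{min x0 y..max x0 y}"
    have i: "integrable lborel (\<lambda>x. c * indicator ?B x)"
      by (intro integrable_mult_right integrable_real_indicator) (auto simp: emeasure_lborel_Icc_eq)
    have "4 * \<epsilon> - L s t = (LBINT x. c * indicator ?B x - \<bar>N s x - N t x\<bar>)"
      unfolding L_def \<epsilon>_def Bochner_Integration.integral_diff[OF i N_diff_integrable]
      by (auto simp: max_def min_def abs_if)
    also have "\<dots> \<le> I s"
      unfolding I_def
    proof (rule integral_mono[OF _ int_I])
      show "integrable lborel (\<lambda>x. c * indicator ?B x - \<bar>N s x - N t x\<bar>)"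
        by (intro Bochner_Integration.integrable_diff i N_diff_integrable)
      fix x
      have "c * indicator ?B x \<le> excess \<sigma> n t x * bump (\<sigma> * (z s - x))"
      proof (cases "x \<in> ?B")
        case True
        have *: "\<sigma> * x0 \<le> \<sigma> * x" "\<sigma> * x \<le> \<sigma> * y"
          using \<sigma> y True by (auto simp: min_def max_def split: if_splits)
        then have "\<sigma> * N t x0 \<le> \<sigma> * N t x"
          using \<sigma> prof.profile_le[of x0 x t] prof.profile_le[of x x0 t] by auto
        then have 1: "excess \<sigma> n t x0 \<le> excess \<sigma> n t x"
          by (intro max.mono) (auto simp: right_diff_distrib)
        have "\<sigma> * (w * (s - t)) \<ge> - (d / 2)"
          using s \<sigma> by (auto simp: abs_mult[symmetric] abs_le_iff)
        moreover have "\<sigma> * (z s - x) = d + \<sigma> * (w * (s - t)) + (\<sigma> * y - \<sigma> * x)"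
          by (simp add: d_def z_def algebra_simps)
        ultimately have "d / 2 \<le> \<sigma> * (z s - x)"
          using *(2) by linarith
        then have "c \<le> excess \<sigma> n t x * bump (\<sigma> * (z s - x))"
          unfolding c_def by (intro mult_mono 1 bump_mono bump_nonneg) auto
        then show ?thesis using True by simp
      next
        case False
        then show ?thesis by (auto intro!: mult_nonneg_nonneg bump_nonneg)
      qed
      moreover have "(excess \<sigma> n t x - \<bar>N s x - N t x\<bar>) * bump (\<sigma> * (z s - x)) \<le>
          excess \<sigma> n s x * bump (\<sigma> * (z s - x))"
        using excess_diff[of s x t] by (intro mult_right_mono bump_nonneg) linarith
      moreover have "\<bar>N s x - N t x\<bar> * bump (\<sigma> * (z s - x)) \<le> \<bar>N s x - N t x\<bar>"
        using mult_left_mono[OF bump_le_1[of "\<sigma> * (z s - x)"], of "\<bar>N s x - N t x\<bar>"] by simp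
      ultimately show "c * indicator ?B x - \<bar>N s x - N t x\<bar> \<le> excess \<sigma> n s x * bump (\<sigma> * (z s - x))"
        by (simp add: left_diff_distrib)
    qed
    finally show ?thesis .
  qed
  have L_small: "\<exists>\<delta>>0. \<forall>s. \<bar>s - s'\<bar> < \<delta> \<longrightarrow> L s s' < e" if "0 < e" for e s'
  proof -
    have "eventually (\<lambda>s. L s s' < e) (at s')"
      unfolding L_def using L1_continuous[of s'] that by (rule order_tendstoD(2))
    then obtain \<delta> where "0 < \<delta>" "\<And>s. s \<noteq> s' \<Longrightarrow> \<bar>s - s'\<bar> < \<delta> \<Longrightarrow> L s s' < e"
      by (auto simp: eventually_at dist_real_def)
    moreover have "L s' s' < e" using that by (simp add: L_def)
    ultimately show ?thesis by metis
  qed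
  obtain \<delta>1 where \<delta>1: "0 < \<delta>1" "\<And>s. \<bar>s - ti\<bar> < \<delta>1 \<Longrightarrow> L s ti < \<epsilon> / 2"
    using L_small[of "\<epsilon> / 2" ti] \<epsilon> by auto
  obtain \<delta>2 where \<delta>2: "0 < \<delta>2" "\<And>s. \<bar>s - t\<bar> < \<delta>2 \<Longrightarrow> L s t < 2 * \<epsilon>"
    using L_small[of "2 * \<epsilon>" t] \<epsilon> by auto
  \<comment> \<open>Adding 1 keeps the divisions by \<open>W\<close> legitimate when w = 0. The
    entries of the minimum ensure, in order: L1 closeness near \<open>ti\<close>, the same near
    \<open>t\<close>, disjoint time ramps, a swept strip of width at most \<epsilon> / 2, and a
    displacement of the line by at most d / 2.\<close>
  define W where "W = \<bar>w\<bar> + 1"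
  have W: "0 < W" "\<bar>w\<bar> \<le> W" by (auto simp: W_def)
  define \<delta> where "\<delta> = Min {\<delta>1 / 3, \<delta>2 / 2, (t - ti) / 3, \<epsilon> / (4 * W), d / (2 * W)}"
  have "0 < \<delta>"
    unfolding \<delta>_def using \<delta>1(1) \<delta>2(1) t \<epsilon> d W(1) by (subst Min_gr_iff) auto
  moreover have "\<delta> \<le> \<delta>1 / 3" "\<delta> \<le> \<delta>2 / 2" "\<delta> \<le> (t - ti) / 3" "\<delta> \<le> \<epsilon> / (4 * W)" "\<delta> \<le> d / (2 * W)"
    unfolding \<delta>_def by (rule Min_le; simp)+
  ultimately have \<delta>: "0 < \<delta>" "2 * \<delta> < \<delta>1" "\<delta> < \<delta>2" "3 * \<delta> \<le> t - ti" "W * (2 * \<delta>) \<le> \<epsilon> / 2" "W * \<delta> \<le> d / 2"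
    using \<delta>1(1) \<delta>2(1) W(1) by (auto simp: field_simps)
  have I_small: "I s \<le> \<epsilon>" if "\<bar>s - ti\<bar> \<le> 2 * \<delta>" for s
  proof -
    have "\<bar>w\<bar> * \<bar>s - ti\<bar> \<le> W * (2 * \<delta>)" using W that by (intro mult_mono) auto
    with upper[of s] \<delta>1(2)[of s] that \<delta> show ?thesis by linarith
  qed
  have I_big: "2 * \<epsilon> \<le> I s" if "\<bar>s - t\<bar> \<le> \<delta>" for s
  proof -
    have "\<bar>w\<bar> * \<bar>s - t\<bar> \<le> W * \<delta>" using W that by (intro mult_mono) auto
    with lower[of s] \<delta>2(2)[of s] that \<delta> show ?thesis by linarith
  qed
  \<comment> \<open>\<open>r\<close> rises on [ti + \<delta>, ti + 2 \<delta>] and \<open>q\<close>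
    falls on [t - \<delta>, t]. The delay by \<delta> keeps the support at positive times even if ti
    = 0.\<close>
  define r where "r s = smooth_step ((s - ti) / \<delta> - 1)" for s
  define q where "q s = smooth_step ((t - s) / \<delta>)" for s
  define r' where "r' s = deriv smooth_step ((s - ti) / \<delta> - 1) / \<delta>" for s
  define q' where "q' s = - deriv smooth_step ((t - s) / \<delta>) / \<delta>" for s
  have r_deriv: "(r has_real_derivative r' s) (at s)" for s
  proof -
    have "((\<lambda>s. (s - ti) / \<delta> - 1) has_real_derivative 1 / \<delta>) (at s)"
      using \<delta>(1) by (auto intro!: derivative_eq_intros)
    from DERIV_chain2[OF smooth_step_has_derivative this] show ?thesis
      by (simp add: r_def[abs_def] r'_def)
  qed
  have q_deriv: "(q has_real_derivative q' s) (at s)" for s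
  proof -
    have "((\<lambda>s. (t - s) / \<delta>) has_real_derivative - 1 / \<delta>) (at s)"
      using \<delta>(1) by (auto intro!: derivative_eq_intros)
    from DERIV_chain2[OF smooth_step_has_derivative this] show ?thesis
      by (simp add: q_def[abs_def] q'_def)
  qed
  have rq: "r ti = 0" "r t = 1" "q ti = 1" "q t = 0"
    unfolding r_def q_def using \<delta> by (auto intro!: smooth_step_eq simp: field_simps)
  have nonneg: "0 \<le> r s" "0 \<le> q s" "r s \<le> 1" "q s \<le> 1" "0 \<le> r' s" "q' s \<le> 0" for s
    unfolding r_def q_def r'_def q'_def using \<delta>(1)
    by (auto simp: smooth_step_bounds smooth_step_deriv_nonneg)
  have rise: "r' s * q s * I s \<le> \<epsilon> * r' s" if "ti \<le> s" for s
  proof (cases "r' s = 0")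
    case False
    then have "0 \<le> (s - ti) / \<delta> - 1" "(s - ti) / \<delta> - 1 \<le> 1"
      using smooth_step_deriv_eq_0[of "(s - ti) / \<delta> - 1"] by (force simp: r'_def)+
    then have s: "s - ti \<le> 2 * \<delta>" using \<delta>(1) by (simp add: field_simps)
    then have "q s = 1"
      unfolding q_def using \<delta> by (intro smooth_step_eq) (simp add: field_simps)
    then show ?thesis
      using mult_left_mono[OF I_small[of s] nonneg(5)[of s]] s that by (simp add: mult.commute)
  qed simp
  have fall: "r s * q' s * I s \<le> 2 * \<epsilon> * q' s" if "s \<le> t" for s
  proof (cases "q' s = 0")
    case False
    then have "0 \<le> (t - s) / \<delta>" "(t - s) / \<delta> \<le> 1"
      using smooth_step_deriv_eq_0[of "(t - s) / \<delta>"] by (force simp: q'_def)+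
    then have s: "t - s \<le> \<delta>" using \<delta>(1) by (simp add: field_simps)
    then have "r s = 1"
      unfolding r_def using \<delta> by (intro smooth_step_eq) (simp add: field_simps)
    then show ?thesis
      using mult_left_mono_neg[OF I_big[of s] nonneg(6)[of s]] s that by (simp add: mult.commute)
  qed simp
  \<comment> \<open>The second factor makes the support compact; it equals 1 for \<sigma> x \<ge> -
    R - 1, which covers everywhere the excess lives. The vanishing coefficients match the affine
    form expected by \<open>smooth_expr_step\<close>.\<close>
  define \<zeta> where "\<zeta> = (\<lambda>p. bump ((- \<sigma>) * fst p + (\<sigma> * w) * snd p + \<sigma> * (zi - w * ti)) *
    smooth_step (\<sigma> * fst p + 0 * snd p + (R + 2)) *
    (smooth_step (0 * fst p + inverse \<delta> * snd p + (- ti / \<delta> - 1)) *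
     smooth_step (0 * fst p + (- inverse \<delta>) * snd p + t / \<delta>)))"
  have \<zeta>: "\<zeta> (x, s) = bump (\<sigma> * (z s - x)) * smooth_step (\<sigma> * x + (R + 2)) * (r s * q s)" for x s
  proof -
    have 1: "(- \<sigma>) * x + (\<sigma> * w) * s + \<sigma> * (zi - w * ti) = \<sigma> * (z s - x)"
      by (simp add: z_def algebra_simps)
    have 2: "\<sigma> * x + 0 * s + (R + 2) = \<sigma> * x + (R + 2)"
      by simp
    have 3: "0 * x + inverse \<delta> * s + (- ti / \<delta> - 1) = (s - ti) / \<delta> - 1"
      by (simp add: divide_inverse algebra_simps)
    have 4: "0 * x + (- inverse \<delta>) * s + t / \<delta> = (t - s) / \<delta>"
      by (simp add: divide_inverse algebra_simps)
    show ?thesis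
      unfolding \<zeta>_def r_def q_def fst_conv snd_conv 1 2 3 4 ..
  qed
  have smooth: "smooth_expr \<zeta>"
    unfolding \<zeta>_def by (intro smooth_expr.mult smooth_expr.flat smooth_expr_step)
  define a where "a = R + 2 + \<bar>zi\<bar> + \<bar>w\<bar> * (t - ti)"
  have cut: "cutoff \<zeta> a (ti + \<delta>) t"
  proof
    fix x s assume nz: "\<zeta> (x, s) \<noteq> 0"
    then have "bump (\<sigma> * (z s - x)) \<noteq> 0" "smooth_step (\<sigma> * x + (R + 2)) \<noteq> 0" "r s \<noteq> 0" "q s \<noteq> 0"
      by (auto simp: \<zeta>)
    then have 1: "0 < \<sigma> * (z s - x)" "0 < \<sigma> * x + (R + 2)" "0 < (s - ti) / \<delta> - 1" "0 < (t - s) / \<delta>"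
      unfolding r_def q_def using bump_eq_0 smooth_step_eq(1) by (meson not_less)+
    then have s: "s \<in> {ti + \<delta>..t}" using \<delta>(1) by (auto simp: field_simps)
    have "\<bar>w * (s - ti)\<bar> \<le> \<bar>w\<bar> * (t - ti)"
      unfolding abs_mult using s \<delta>(1) by (intro mult_left_mono) auto
    then have "\<bar>z s\<bar> \<le> \<bar>zi\<bar> + \<bar>w\<bar> * (t - ti)" unfolding z_def by linarith
    moreover have "0 \<le> \<bar>w\<bar> * (t - ti)" using t by simp
    ultimately have "x \<in> {- a..a}"
      using 1(1,2) \<sigma> prof.radius_nonneg unfolding a_def by (auto simp: abs_le_iff)
    with s show "x \<in> {- a..a} \<and> s \<in> {ti + \<delta>..t}" by blast
  qed (rule smooth)
  interpret cutoff \<zeta> a "ti + \<delta>" t by (rule cut)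
  have on: "\<zeta> (x, s) = bump (\<sigma> * (z s - x)) * (r s * q s)" if "- R - 1 < \<sigma> * x" for x s
    using that by (simp add: \<zeta> smooth_step_eq)
  have dx_on: "dx \<zeta> (x, s) = - (\<sigma> * bump' (\<sigma> * (z s - x)) * (r s * q s))" if "- R \<le> \<sigma> * x" for x s
  proof (rule DERIV_unique[OF smooth_expr_partials(4)[OF smooth]])
    have lin: "((\<lambda>y. \<sigma> * (z s - y)) has_real_derivative - \<sigma>) (at x)"
      by (auto intro!: derivative_eq_intros)
    have "((\<lambda>y. bump (\<sigma> * (z s - y))) has_real_derivative bump' (\<sigma> * (z s - x)) * - \<sigma>) (at x)"
      by (rule DERIV_chain2[OF DERIV_bump lin])
    then have "((\<lambda>y. bump (\<sigma> * (z s - y)) * (r s * q s)) has_real_derivative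
        (bump' (\<sigma> * (z s - x)) * - \<sigma>) * (r s * q s)) (at x)"
      by (rule DERIV_cmult_right)
    then have "((\<lambda>y. bump (\<sigma> * (z s - y)) * (r s * q s)) has_real_derivative
        - (\<sigma> * bump' (\<sigma> * (z s - x)) * (r s * q s))) (at x)"
      by (simp add: algebra_simps)
    then show "((\<lambda>y. \<zeta> (y, s)) has_real_derivative - (\<sigma> * bump' (\<sigma> * (z s - x)) * (r s * q s))) (at x)"
    proof (rule has_field_derivative_transform_within_open)
      show "open {y. - R - 1 < \<sigma> * y}" by (intro open_Collect_less continuous_intros)
      show "x \<in> {y. - R - 1 < \<sigma> * y}" using that by simp
    qed (simp add: on)
  qed
  have dt_on: "dt \<zeta> (x, s) = \<sigma> * w * bump' (\<sigma> * (z s - x)) * (r s * q s) +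
      bump (\<sigma> * (z s - x)) * (r' s * q s + r s * q' s)" if "- R \<le> \<sigma> * x" for x s
  proof (rule DERIV_unique[OF smooth_expr_partials(5)[OF smooth]])
    have lin: "((\<lambda>s. \<sigma> * (z s - x)) has_real_derivative \<sigma> * w) (at s)"
      unfolding z_def by (auto intro!: derivative_eq_intros)
    have 1: "((\<lambda>s. bump (\<sigma> * (z s - x))) has_real_derivative bump' (\<sigma> * (z s - x)) * (\<sigma> * w)) (at s)"
      by (rule DERIV_chain2[OF DERIV_bump lin])
    have "((\<lambda>s. bump (\<sigma> * (z s - x)) * (r s * q s)) has_real_derivative
      \<sigma> * w * bump' (\<sigma> * (z s - x)) * (r s * q s) +
      bump (\<sigma> * (z s - x)) * (r' s * q s + r s * q' s)) (at s)"
      using DERIV_mult[OF 1 DERIV_mult[OF r_deriv q_deriv]] by (simp add: algebra_simps)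
    moreover have "(\<lambda>s. \<zeta> (x, s)) = (\<lambda>s. bump (\<sigma> * (z s - x)) * (r s * q s))"
      using that by (intro ext on) simp
    ultimately show "((\<lambda>s. \<zeta> (x, s)) has_real_derivative \<sigma> * w * bump' (\<sigma> * (z s - x)) * (r s * q s) +
      bump (\<sigma> * (z s - x)) * (r' s * q s + r s * q' s)) (at s)" by simp
  qed
  \<comment> \<open>While \<open>r\<close> rises, \<open>I\<close> is at most \<epsilon>; while
    \<open>q\<close> falls, it is at least 2 \<epsilon>. The bound is the derivative of \<epsilon> r
    + 2 \<epsilon> q, whose total change is - \<epsilon>, contradicting the entropy
    inequality.\<close>
  let ?b = "\<lambda>s. (\<epsilon> * r' s + 2 * \<epsilon> * q' s) * indicator {ti..t} s"
  have le: "half_entropy \<sigma> n \<zeta> s \<le> ?b s" for s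
  proof (cases "s \<in> {ti..t}")
    case True
    have "half_entropy \<sigma> n \<zeta> s \<le> (r' s * q s + r s * q' s) * I s"
      unfolding I_def
    proof (rule half_entropy_cutoff_le[OF \<sigma> n slope speed _ cut, where \<theta> = "r s * q s"])
      show "\<sigma> * V s x \<le> \<sigma> * v" if "\<sigma> * x < \<sigma> * z s" for x
        using True that unfolding z_def by (intro drift) auto
      show "\<zeta> (x, s) = bump (\<sigma> * (z s - x)) * (r s * q s)" if "- R \<le> \<sigma> * x" for x
        using that by (intro on) simp
    qed (auto simp: nonneg intro: dx_on dt_on)
    also have "\<dots> \<le> ?b s"
      using rise[of s] fall[of s] True by (simp add: distrib_right)
    finally show ?thesis .
  next
    case False
    then have "s \<notin> {ti + \<delta>..t}" using \<delta>(1) by auto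
    then have "\<zeta> (x, s) = 0" "dx \<zeta> (x, s) = 0" "dt \<zeta> (x, s) = 0" for x
      using support[of x s] support_dx[of x s] support_dt[of x s] by blast+
    with False show ?thesis
      by (simp add: half_entropy_def set_lebesgue_integral_def)
  qed
  have cont': "continuous_on UNIV (\<lambda>s. \<epsilon> * r' s + 2 * \<epsilon> * q' s)"
    unfolding r'_def q'_def
    using \<delta>(1) by (intro continuous_intros continuous_on_compose2[OF smooth_step_deriv_continuous]) auto
  have "0 \<le> \<zeta> p" for p
    using \<zeta>[of "fst p" "snd p"] bump_nonneg smooth_step_bounds(1) nonneg(1,2) by simp
  moreover have "0 < ti + \<delta>" using t \<delta>(1) by simp
  ultimately have half: "integrable lborel (half_entropy \<sigma> n \<zeta>)" "0 \<le> (LBINT s. half_entropy \<sigma> n \<zeta> s)"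
    using half_entropy_nonneg[OF \<sigma> n cut] t by blast+
  note half(2)
  also have "\<dots> \<le> (LBINT s. ?b s)"
  proof (rule integral_mono[OF _ _ le])
    show "integrable lborel (half_entropy \<sigma> n \<zeta>)" by (rule half)
    have "set_integrable lborel {ti..t} (\<lambda>s. \<epsilon> * r' s + 2 * \<epsilon> * q' s)"
      by (rule borel_integrable_atLeastAtMost') (rule continuous_on_subset[OF cont'], simp)
    then show "integrable lborel ?b"
      by (simp add: set_integrable_def mult.commute)
  qed
  also have "(LBINT s. ?b s) = (\<epsilon> * r t + 2 * \<epsilon> * q t) - (\<epsilon> * r ti + 2 * \<epsilon> * q ti)"
  proof (rule integral_FTC_Icc_real[where F = "\<lambda>s. \<epsilon> * r s + 2 * \<epsilon> * q s"])
    show "ti \<le> t" using t by simp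
    show "((\<lambda>s. \<epsilon> * r s + 2 * \<epsilon> * q s) has_real_derivative \<epsilon> * r' s + 2 * \<epsilon> * q' s) (at s)" for s
      by (intro DERIV_add DERIV_cmult r_deriv q_deriv)
    show "isCont (\<lambda>s. \<epsilon> * r' s + 2 * \<epsilon> * q' s) s" for s
      using cont' by (simp add: continuous_on_eq_continuous_at)
  qed
  also have "\<dots> = - \<epsilon>" by (simp add: rq)
  finally show False using \<epsilon> by simp
qed

end

section \<open>Lower bound on the gap\<close>

context entropy_flow
begin

text \<open>\<open>\<Lambda>\<close> bounds the slopes of \<open>A\<close>, and
  \<open>\<Psi> (2 * R)\<close> bounds the drift on [-R, R].\<close>

definition "speed_bound = \<Lambda> + \<Psi> (2 * R)"

lemma speed_bound_nonneg: "0 \<le> speed_bound"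
  unfolding speed_bound_def using prof.radius_nonneg by (intro add_nonneg_nonneg Lip_nonneg Phi_nonneg) auto

lemma finite_speed_level:
  assumes \<sigma>: "\<sigma> = 1 \<or> \<sigma> = - 1" and n: "n \<in> J" and t: "0 \<le> ti" "ti \<le> t" "t < T"
    and init: "\<And>x. \<sigma> * x < \<sigma> * zi \<Longrightarrow> \<sigma> * (N ti x - n) \<le> 0"
    and x: "\<sigma> * x < \<sigma> * zi - speed_bound * (t - ti)"
  shows "\<sigma> * (N t x - n) \<le> 0"
proof (cases "t = ti")
  case True
  with init x show ?thesis by simp
next
  case False
  with t have "ti < t" by simp
  have \<sigma>2: "\<sigma> * \<sigma> = 1" using \<sigma> by auto
  show ?thesis
  \<comment> \<open>The drift bound needs \<sigma> x \<le> R along the line. If zi lies beyond,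
    \<open>init\<close> already reaches past the support and forces \<open>n\<close> to be an
    extreme level, where the claim is trivial.\<close>
  proof (cases "\<sigma> * zi \<le> R")
    case True
    show ?thesis
    proof (rule transport[OF \<sigma> n t(1) \<open>ti < t\<close> t(3), where p = "- (\<sigma> * \<Lambda>)" and v = "\<sigma> * \<Psi> (2 * R)"
          and w = "- (\<sigma> * speed_bound)" and zi = zi])
      show "A n + - (\<sigma> * \<Lambda>) * (m - n) \<le> A m" if "m \<in> J" "0 < \<sigma> * (m - n)" for m
      proof -
        have "\<bar>m - n\<bar> = \<sigma> * (m - n)" using \<sigma> that by auto
        with flux_lipschitz[OF n that(1)] show ?thesis
          by (simp add: abs_le_iff abs_minus_commute algebra_simps)
      qed
      have "\<sigma> * - (\<sigma> * speed_bound) = - (\<sigma> * \<sigma>) * speed_bound"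
        "\<sigma> * (- (\<sigma> * \<Lambda>) - \<sigma> * \<Psi> (2 * R)) = - (\<sigma> * \<sigma>) * speed_bound"
        by (simp_all add: speed_bound_def algebra_simps)
      then show "\<sigma> * - (\<sigma> * speed_bound) \<le> \<sigma> * (- (\<sigma> * \<Lambda>) - \<sigma> * \<Psi> (2 * R))" by simp
      show "\<sigma> * V s y \<le> \<sigma> * (\<sigma> * \<Psi> (2 * R))"
        if "ti \<le> s" "s \<le> t" "\<sigma> * y < \<sigma> * (zi + - (\<sigma> * speed_bound) * (s - ti))" for s y
      proof -
        have "\<sigma> * (zi + - (\<sigma> * speed_bound) * (s - ti)) = \<sigma> * zi - (\<sigma> * \<sigma>) * (speed_bound * (s - ti))"
          by (simp add: algebra_simps)
        moreover have "0 \<le> speed_bound * (s - ti)" using that speed_bound_nonneg by simp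
        ultimately have y: "\<sigma> * y \<le> R" using that True by (simp add: \<sigma>2)
        have "\<sigma> * V s y \<le> \<Psi> (2 * R)"
          using \<sigma>
        proof
          assume [simp]: "\<sigma> = 1"
          have "V s y \<le> \<Psi> (y + R)" by (rule prof.drift_bounds)
          also have "\<dots> \<le> \<Psi> (2 * R)" using y by (intro Phi_mono) simp
          finally show ?thesis by simp
        next
          assume [simp]: "\<sigma> = - 1"
          have "- \<Psi> (2 * R) = \<Psi> (- (2 * R))" by (simp only: Phi_minus)
          also have "\<dots> \<le> \<Psi> (y - R)" using y by (intro Phi_mono) simp
          also have "\<dots> \<le> V s y" by (rule prof.drift_bounds)
          finally show ?thesis by simp
        qed
        then show ?thesis by (simp add: \<sigma>2 mult.assoc[symmetric])
      qed
      have "\<sigma> * (zi + - (\<sigma> * speed_bound) * (t - ti)) = \<sigma> * zi - (\<sigma> * \<sigma>) * (speed_bound * (t - ti))"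
        by (simp add: algebra_simps)
      then show "\<sigma> * x < \<sigma> * (zi + - (\<sigma> * speed_bound) * (t - ti))"
        using x by (simp add: \<sigma>2)
    qed (rule init)
  next
    case False
    show ?thesis
      using \<sigma>
    proof
      assume [simp]: "\<sigma> = 1"
      have "1/2 \<le> n" using init[of R] False prof.profile_right[of R ti] by simp
      then show ?thesis using prof.profile_bounds[of t x] by simp
    next
      assume [simp]: "\<sigma> = - 1"
      obtain y where "zi < y" "y < - R" using False dense[of zi "- R"] by auto
      then have "n \<le> - 1/2" using init[of y] prof.profile_left[of y ti] by simp
      then show ?thesis using prof.profile_bounds[of t x] by simp
    qed
  qed
qed

lemma quantile_speed:
  assumes m: "- 1/2 < m" "m \<le> 1/2" and t: "0 \<le> t0" "t0 \<le> t" "t < T"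
  shows "Q t0 m - speed_bound * (t - t0) \<le> Q t m" "Q t m \<le> Q t0 m + speed_bound * (t - t0)"
proof -
  show "Q t0 m - speed_bound * (t - t0) \<le> Q t m"
  proof (rule ccontr)
    assume "\<not> ?thesis"
    then obtain z where z: "Q t m + speed_bound * (t - t0) < z" "z < Q t0 m"
      using dense[of "Q t m + speed_bound * (t - t0)" "Q t0 m"] by auto
    have "N t0 z < m" using z m by (simp add: prof.less_quantile_iff[symmetric])
    \<comment> \<open>Propagation yields only a weak inequality, so it is applied at the level
      \<open>N t0 z\<close>, which is strictly below \<open>m\<close>.\<close>
    moreover have "1 * (N t (Q t m) - N t0 z) \<le> 0"
      by (rule finite_speed_level[OF _ prof.profile_in_J t, where zi = z]) (use z in \<open>auto intro: prof.profile_le\<close>)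
    moreover have "m \<le> N t (Q t m)" using m by (simp add: prof.quantile_le_iff[symmetric])
    ultimately show False by simp
  qed
  show "Q t m \<le> Q t0 m + speed_bound * (t - t0)"
  proof (rule dense_ge)
    fix x assume x: "Q t0 m + speed_bound * (t - t0) < x"
    have "- 1 * (N t x - m) \<le> 0"
    proof (rule finite_speed_level[OF _ _ t, where zi = "Q t0 m"])
      show "- 1 * (N t0 y - m) \<le> 0" if "- 1 * y < - 1 * Q t0 m" for y
        using that m prof.quantile_le_iff[of m t0 y] by simp
    qed (use x m in auto)
    then show "Q t m \<le> x" using m by (simp add: prof.quantile_le_iff)
  qed
qed

text \<open>Each quantile moves by at most \<open>speed_bound * (t - t0)\<close> and
  \<open>\<Psi>\<close> is monotone, so passing from one time to another costs only a shift of the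
  argument.\<close>

lemma drift_shift:
  assumes t: "0 \<le> t0" "t0 \<le> t" "t < T"
  shows "V t x \<le> V t0 (x + speed_bound * (t - t0))" "V t0 (x - speed_bound * (t - t0)) \<le> V t x"
proof -
  have "\<Psi> (x - Q t m) \<le> \<Psi> (x + speed_bound * (t - t0) - Q t0 m)"
    "\<Psi> (x - speed_bound * (t - t0) - Q t0 m) \<le> \<Psi> (x - Q t m)" if "m \<in> {-1/2<..1/2}" for m
    using quantile_speed[OF _ _ t, of m] that by (auto intro!: Phi_mono)
  note le = this
  show "V t x \<le> V t0 (x + speed_bound * (t - t0))"
    unfolding prof.drift_def by (intro set_integral_mono prof.drift_integrable le)
  show "V t0 (x - speed_bound * (t - t0)) \<le> V t x"
    unfolding prof.drift_def by (intro set_integral_mono prof.drift_integrable le)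
qed

text \<open>The right edge of the region \<open>N \<le> n\<close>; junk unless \<open>n < 1/2\<close>. It exceeds \<open>Q t n\<close> when \<open>N t\<close> is flat at level \<open>n\<close>.\<close>
definition right_quantile :: "real \<Rightarrow> real \<Rightarrow> real" where
  "right_quantile t n = Sup {x. N t x \<le> n}"

lemma right_quantile:
  assumes n: "- 1/2 \<le> n" "n < 1/2"
  shows right_quantile_bounds: "- R \<le> right_quantile t n" "right_quantile t n \<le> R"
    and less_right_quantile: "x < right_quantile t n \<Longrightarrow> N t x \<le> n"
    and right_quantile_ge: "(\<And>x. x < z \<Longrightarrow> N t x \<le> n) \<Longrightarrow> z \<le> right_quantile t n"
proof -
  let ?S = "{x. N t x \<le> n}"
  have le_R: "x \<le> R" if "x \<in> ?S" for x
    using that n prof.profile_right[of x t] by force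
  then have bdd: "bdd_above ?S" by (rule bdd_aboveI)
  have "N t (- R - 1) \<le> n" using prof.profile_left[of "- R - 1" t] n by simp
  then have ne: "?S \<noteq> {}" by blast
  show ge: "z \<le> right_quantile t n" if "\<And>x. x < z \<Longrightarrow> N t x \<le> n" for z
    unfolding right_quantile_def
    by (rule dense_le) (use that bdd in \<open>auto intro: cSup_upper\<close>)
  show "- R \<le> right_quantile t n"
    using prof.profile_left n by (intro ge) simp
  show "right_quantile t n \<le> R"
    unfolding right_quantile_def using ne le_R by (rule cSup_least)
  show "N t x \<le> n" if x: "x < right_quantile t n" for x
  proof -
    obtain y where "y \<in> ?S" "x < y"
      using less_cSupD[OF ne] x unfolding right_quantile_def by blast
    then show ?thesis using prof.profile_le[of x y t] by simp
  qed
qed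

lemma quantile_le_right_quantile:
  assumes "- 1/2 < n1" "n1 \<le> n2" "n2 < 1/2"
  shows "Q t n1 \<le> right_quantile t n2"
proof (rule right_quantile_ge)
  show "N t x \<le> n2" if "x < Q t n1" for x
    using that assms prof.less_quantile_iff[of n1 x t] by simp
qed (use assms in auto)

lemma right_quantile_le_quantile:
  assumes "- 1/2 \<le> n" "n < m" "m \<le> 1/2"
  shows "right_quantile t n \<le> Q t m"
proof (rule dense_le)
  fix x assume "x < right_quantile t n"
  then have "N t x \<le> n" using assms by (intro less_right_quantile) auto
  then show "x \<le> Q t m" using assms prof.less_quantile_iff[of m x t] by simp
qed

lemma right_quantile_speed:
  assumes n: "- 1/2 \<le> n" "n < 1/2" and t: "0 \<le> t0" "t0 \<le> t" "t < T"
  shows "right_quantile t0 n - speed_bound * (t - t0) \<le> right_quantile t n"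
proof (rule right_quantile_ge[OF n])
  fix x assume x: "x < right_quantile t0 n - speed_bound * (t - t0)"
  have "1 * (N t x - n) \<le> 0"
    by (rule finite_speed_level[OF _ _ t, where zi = "right_quantile t0 n"])
      (use x n in \<open>auto intro: less_right_quantile\<close>)
  then show "N t x \<le> n" by simp
qed

text \<open>The right edge at \<open>n2\<close> is bounded from below and the left edge at
  \<open>n1\<close> from above, the directions in which transport controls them. For n1 = n2 this is
  the length of the flat piece at that level.\<close>

definition gap :: "real \<Rightarrow> real \<Rightarrow> real \<Rightarrow> real" where
  "gap n1 n2 t = right_quantile t n2 - Q t n1"

section \<open>Growth of the gap in small time steps\<close>

context
  fixes n1 n2 p1 p2 :: real
  assumes n12: "- 1/2 < n1" "n1 \<le> n2" "n2 < 1/2"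
    and slope1: "\<And>m. m \<in> J \<Longrightarrow> A n1 + p1 * (m - n1) \<le> A m"
    and slope2: "\<And>m. m \<in> J \<Longrightarrow> A n2 + p2 * (m - n2) \<le> A m"
begin

lemma gap_nonneg: "0 \<le> gap n1 n2 t"
  using quantile_le_right_quantile[OF n12, of t] by (simp add: gap_def)

lemma gap_speed:
  assumes "0 \<le> t0" "t0 \<le> t" "t < T"
  shows "gap n1 n2 t0 - 2 * speed_bound * (t - t0) \<le> gap n1 n2 t"
  using right_quantile_speed[OF _ _ assms, of n2] quantile_speed(2)[OF _ _ assms, of n1] n12
  by (simp add: gap_def)

text \<open>One Euler step: each edge is compared with a line of velocity slope minus frozen drift.
  The condition 2 K h \<le> 1 keeps the sampling points within distance 1 of [-R, R], where
  \<open>\<Psi> (2 * R + 1)\<close> bounds the drift.\<close>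

lemma gap_step:
  assumes t: "0 \<le> t" "0 < h" "t + h < T"
    and K: "speed_bound \<le> K" "\<bar>p1\<bar> + \<Psi> (2 * R + 1) \<le> K" "\<bar>p2\<bar> + \<Psi> (2 * R + 1) \<le> K" "2 * K * h \<le> 1"
  shows "gap n1 n2 t + h * (p2 - p1 - 2 * \<Psi> (gap n1 n2 t + 4 * K * h)) \<le> gap n1 n2 (t + h)"
proof -
  define z where "z = right_quantile t n2"
  define y where "y = Q t n1"
  have z: "- R \<le> z" "z \<le> R" unfolding z_def using n12 by (auto intro!: right_quantile_bounds)
  have y: "- R \<le> y" "y \<le> R" unfolding y_def using n12 by (auto intro!: prof.quantile_bounds)
  have K0: "0 \<le> K" using speed_bound_nonneg K(1) by simp
  then have Kh: "0 \<le> K * h" "2 * (K * h) \<le> 1" using t K(4) by simp_all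
  have V_bound: "\<bar>V t x\<bar> \<le> \<Psi> (2 * R + 1)" if "\<bar>x\<bar> \<le> R + 1" for x
  proof -
    have x: "x + R \<le> 2 * R + 1" "- (2 * R + 1) \<le> x - R" using that by auto
    have "V t x \<le> \<Psi> (2 * R + 1)"
      using prof.drift_bounds(1)[where t = t and x = x] Phi_mono[OF x(1)] by simp
    moreover have "\<Psi> (- (2 * R + 1)) \<le> V t x"
      using prof.drift_bounds(2)[where t = t and x = x] Phi_mono[OF x(2)] by simp
    ultimately show ?thesis by (simp only: Phi_minus)
  qed
  \<comment> \<open>The worst drift over the step, sampled outwards by 2 K h: one K h for the motion
    of the line, one for the shift in \<open>drift_shift\<close>. Both edges together produce the 4
    K h in the claim.\<close>
  define v2 where "v2 = V t (z + 2 * (K * h))"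
  define v1 where "v1 = V t (y - 2 * (K * h))"
  have w2: "\<bar>p2 - v2\<bar> \<le> K" and w1: "\<bar>p1 - v1\<bar> \<le> K"
    using V_bound[of "z + 2 * (K * h)"] V_bound[of "y - 2 * (K * h)"] z y Kh K(2,3) unfolding v1_def v2_def by linarith+
  have lin: "\<bar>w * (s - t)\<bar> \<le> K * h" if "\<bar>w\<bar> \<le> K" "t \<le> s" "s \<le> t + h" for w s
    unfolding abs_mult using that K0 by (intro mult_mono) auto
  have sp: "speed_bound * (s - t) \<le> K * h" if "t \<le> s" "s \<le> t + h" for s
    using that K(1) K0 by (intro mult_mono) auto
  have "z + (p2 - v2) * h \<le> right_quantile (t + h) n2"
  proof (rule right_quantile_ge)
    fix x assume x: "x < z + (p2 - v2) * h"
    have "1 * (N (t + h) x - n2) \<le> 0"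
    proof (rule transport[where p = p2 and v = v2 and w = "p2 - v2" and ti = t and zi = z])
      show "1 * V s u \<le> 1 * v2" if s: "t \<le> s" "s \<le> t + h" and u: "1 * u < 1 * (z + (p2 - v2) * (s - t))" for s u
      proof -
        have "V s u \<le> V t (u + speed_bound * (s - t))"
          using s t by (intro drift_shift) auto
        also have "\<dots> \<le> v2"
          unfolding v2_def using u lin[OF w2 s] sp[OF s] by (intro prof.drift_mono) (simp add: abs_le_iff)
        finally show ?thesis by simp
      qed
      show "1 * (N t u - n2) \<le> 0" if "1 * u < 1 * z" for u
        using that n12 less_right_quantile[of n2 u t] by (simp add: z_def)
    qed (use n12 t x slope2 in auto)
    then show "N (t + h) x \<le> n2" by simp
  qed (use n12 in auto)
  moreover have "Q (t + h) n1 \<le> y + (p1 - v1) * h"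
  proof (rule dense_ge)
    fix x assume x: "y + (p1 - v1) * h < x"
    have "- 1 * (N (t + h) x - n1) \<le> 0"
    proof (rule transport[where p = p1 and v = v1 and w = "p1 - v1" and ti = t and zi = y])
      show "- 1 * V s u \<le> - 1 * v1" if s: "t \<le> s" "s \<le> t + h" and u: "- 1 * u < - 1 * (y + (p1 - v1) * (s - t))" for s u
      proof -
        have "v1 \<le> V t (u - speed_bound * (s - t))"
          unfolding v1_def using u lin[OF w1 s] sp[OF s] by (intro prof.drift_mono) (simp add: abs_le_iff)
        also have "\<dots> \<le> V s u"
          using s t by (intro drift_shift) auto
        finally show ?thesis by simp
      qed
      show "- 1 * (N t u - n1) \<le> 0" if "- 1 * u < - 1 * y" for u
        using that n12 prof.quantile_le_iff[of n1 t u] by (simp add: y_def)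
    qed (use n12 t x slope1 in auto)
    then show "Q (t + h) n1 \<le> x" using n12 by (simp add: prof.quantile_le_iff)
  qed
  moreover have "v2 - v1 \<le> 2 * \<Psi> (gap n1 n2 t + 4 * K * h)"
  proof -
    have "0 \<le> z - y" using gap_nonneg[of t] by (simp add: gap_def z_def y_def)
    then have "v2 - v1 \<le> 2 * \<Psi> (z + 2 * (K * h) - (y - 2 * (K * h)))"
      unfolding v1_def v2_def using Kh by (intro prof.drift_diff_le) simp
    also have "z + 2 * (K * h) - (y - 2 * (K * h)) = gap n1 n2 t + 4 * K * h"
      by (simp add: gap_def z_def y_def)
    finally show ?thesis .
  qed
  then have "h * (p2 - p1 - 2 * \<Psi> (gap n1 n2 t + 4 * K * h)) \<le> h * (p2 - p1 - (v2 - v1))"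
    using t by (intro mult_left_mono) auto
  ultimately show ?thesis
    by (simp add: gap_def z_def y_def algebra_simps)
qed

lemma gap_lower_bound:
  assumes p: "p1 < p2" and c: "0 < c" "\<Psi> (2 * c) \<le> (p2 - p1) / 4" and t: "0 \<le> t" "t < T"
  shows "min ((p2 - p1) / 2 * t) c \<le> gap n1 n2 t"
proof (cases "t = 0")
  case True
  then show ?thesis using gap_nonneg[of t] c by simp
next
  case False
  define K where "K = speed_bound + \<bar>p1\<bar> + \<bar>p2\<bar> + \<Psi> (2 * R + 1)"
  have nn: "0 \<le> \<Psi> (2 * R + 1)" using prof.radius_nonneg by (intro Phi_nonneg) simp
  then have K: "speed_bound \<le> K" "\<bar>p1\<bar> + \<Psi> (2 * R + 1) \<le> K" "\<bar>p2\<bar> + \<Psi> (2 * R + 1) \<le> K" "0 \<le> K"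
    using speed_bound_nonneg by (auto simp: K_def)
  \<comment> \<open>So many steps that 2 K h \<le> 1, as \<open>gap_step\<close> requires, and 6 K h
    \<le> c.\<close>
  obtain k0 :: nat where k0: "2 * K * t + 6 * K * t / c < real k0"
    using reals_Archimedean2 by blast
  have "0 \<le> 2 * K * t" "0 \<le> 6 * K * t / c" using K t c by simp_all
  with k0 have k0': "0 < real k0" "2 * K * t \<le> real k0" "6 * K * t / c \<le> real k0" by linarith+
  define h where "h = t / real k0"
  have h: "0 < h" "2 * K * h \<le> 1" "6 * K * h \<le> c" "real k0 * h = t"
    using k0' False t c by (auto simp: h_def field_simps)
  have "min ((p2 - p1) / 2 * (real k * h)) c \<le> gap n1 n2 (real k * h)" if "k \<le> k0" for k
    using that
  proof (induction k)
    case 0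
    then show ?case using gap_nonneg[of 0] c by simp
  next
    case (Suc k)
    have "real (Suc k) * h \<le> real k0 * h" using Suc.prems h(1) by (intro mult_right_mono) auto
    then have kh: "0 \<le> real k * h" "real k * h + h < T" "real (Suc k) * h = real k * h + h"
      using h t by (simp_all add: algebra_simps)
    have IH: "min ((p2 - p1) / 2 * (real k * h)) c \<le> gap n1 n2 (real k * h)" using Suc by simp
    show ?case
    \<comment> \<open>Above this threshold one step cannot bring the gap below \<open>c\<close>.
      Otherwise the argument of \<open>\<Psi>\<close> is at most c + 6 K h \<le> 2 c, the drifts
      consume at most half of p2 - p1, and the gap grows at least at the rate (p2 - p1) / 2.\<close>
    proof (cases "c + 2 * K * h \<le> gap n1 n2 (real k * h)")
      case True
      have "2 * speed_bound * h \<le> 2 * K * h" using K h by simp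
      moreover have "gap n1 n2 (real k * h) - 2 * speed_bound * ((real k * h + h) - real k * h) \<le>
          gap n1 n2 (real k * h + h)"
        using kh h(1) by (intro gap_speed) auto
      ultimately have "c \<le> gap n1 n2 (real k * h + h)" using True by (simp del: mult_le_cancel_right)
      then show ?thesis unfolding kh(3) by simp
    next
      case False
      then have "gap n1 n2 (real k * h) + 4 * K * h \<le> 2 * c" using h(3) by simp
      then have "\<Psi> (gap n1 n2 (real k * h) + 4 * K * h) \<le> (p2 - p1) / 4"
        using Phi_mono c(2) by (meson order_trans)
      then have "h * ((p2 - p1) / 2) \<le> h * (p2 - p1 - 2 * \<Psi> (gap n1 n2 (real k * h) + 4 * K * h))"
        using h(1) by (intro mult_left_mono) auto
      also have "gap n1 n2 (real k * h) + \<dots> \<le> gap n1 n2 (real k * h + h)"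
        by (rule gap_step[OF kh(1) h(1) kh(2) K(1-3) h(2)])
      finally have "gap n1 n2 (real k * h) + h * ((p2 - p1) / 2) \<le> gap n1 n2 (real k * h + h)" by simp
      moreover have "0 \<le> h * ((p2 - p1) / 2)" using h p by simp
      moreover have "(p2 - p1) / 2 * (real k * h + h) = (p2 - p1) / 2 * (real k * h) + h * ((p2 - p1) / 2)"
        by (simp only: distrib_left mult.commute[of h])
      ultimately show ?thesis using IH unfolding kh(3) by linarith
    qed
  qed
  from this[of k0] show ?thesis by (simp add: h(4))
qed

end

text \<open>The bound is free of \<open>\<Lambda>\<close>, \<open>R\<close> and \<open>T\<close>, so
  it can be applied with a different horizon for each time.\<close>

lemma quantile_gap_lower_bound:
  assumes m: "- 1/2 < m'" "m' \<le> n1" "n2 < m''" "m'' \<le> 1/2" and n: "n1 \<le> n2"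
    and slope1: "\<And>m. m \<in> J \<Longrightarrow> A n1 + p1 * (m - n1) \<le> A m"
    and slope2: "\<And>m. m \<in> J \<Longrightarrow> A n2 + p2 * (m - n2) \<le> A m"
    and p: "p1 < p2" and c: "0 < c" "\<Psi> (2 * c) \<le> (p2 - p1) / 4" and t: "0 \<le> t" "t < T"
  shows "min ((p2 - p1) / 2 * t) c \<le> Q t m'' - Q t m'"
proof -
  have "min ((p2 - p1) / 2 * t) c \<le> right_quantile t n2 - Q t n1"
    using gap_lower_bound[OF _ n _ slope1 slope2 p c t] m n
    unfolding gap_def by simp
  moreover have "Q t m' \<le> Q t n1" using m n by (intro prof.quantile_mono) auto
  moreover have "right_quantile t n2 \<le> Q t m''" using m n by (intro right_quantile_le_quantile) auto
  ultimately show ?thesis by linarith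
qed

end

section \<open>The separation theorem\<close>

lemma entropy_flow_if_entropy_solution:
  assumes "alignment_kernel \<phi>" and "lipschitz_flux A \<Lambda>" and sol: "entropy_solution \<phi> A M0 M" and T: "0 < T"
  obtains R where "entropy_flow \<phi> A \<Lambda> (\<lambda>t x. M x (max 0 (min T t))) R T"
proof -
  obtain \<rho> where "\<forall>t\<ge>0. borel_prob (\<rho> t) \<and> (\<forall>x. M x t = shifted_cdf (\<rho> t) x)"
    and supp: "\<forall>T\<ge>0. \<exists>R. \<forall>t\<in>{0..T}. emeasure (\<rho> t) (- {-R..R}) = 0"
    and L1: "\<forall>t\<ge>0. ((\<lambda>s. LBINT x. \<bar>(M x s - M0 x) - (M x t - M0 x)\<bar>) \<longlongrightarrow> 0) (at t within {0..})"
    and ineq: "\<forall>\<alpha>\<in>J. entropy_inequality \<phi> A \<rho> M \<alpha>"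
    using sol unfolding entropy_solution_def by (elim exE conjE) (rule that)
  then have \<rho>: "\<And>t. 0 \<le> t \<Longrightarrow> borel_prob (\<rho> t)" "\<And>t x. 0 \<le> t \<Longrightarrow> M x t = shifted_cdf (\<rho> t) x"
    by auto
  obtain R where R0: "\<forall>t\<in>{0..T}. emeasure (\<rho> t) (- {-R..R}) = 0"
    using supp T by (meson less_imp_le)
  have R: "emeasure (\<rho> t) (- {-R..R}) = 0" if "0 \<le> t" "t \<le> T" for t
    using that by (intro R0[rule_format]) simp
  interpret alignment_potential \<phi> by standard fact
  interpret lipschitz_flux A \<Lambda> by fact
  \<comment> \<open>Freezing the solution before 0 and after \<open>T\<close> turns continuity
    relative to {0..} into two-sided continuity. On the time support of an admissible cut-off,
    \<open>\<tau>\<close> is the identity.\<close>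
  define \<tau> where "\<tau> t = max 0 (min T t)" for t
  have \<tau>: "0 \<le> \<tau> t" "\<tau> t \<le> T" for t using T by (auto simp: \<tau>_def)
  have prof: "distribution_profile (\<lambda>x. M x (\<tau> t)) R" for t
    by (rule distribution_profile_shifted_cdf[OF \<rho>(1)[OF \<tau>(1)] R[OF \<tau>]]) (simp add: \<rho>(2) \<tau>)
  have "entropy_flow \<phi> A \<Lambda> (\<lambda>t x. M x (\<tau> t)) R T"
  proof (intro entropy_flow.intro entropy_flow_axioms.intro)
    show "alignment_potential \<phi>" "lipschitz_flux A \<Lambda>" by unfold_locales
    show "distribution_profile (\<lambda>x. M x (\<tau> t)) R" for t by (rule prof)
    show "((\<lambda>s. LBINT x. \<bar>M x (\<tau> s) - M x (\<tau> t)\<bar>) \<longlongrightarrow> 0) (at t)" for t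
    proof -
      let ?f = "\<lambda>s. LBINT x. \<bar>M x s - M x (\<tau> t)\<bar>"
      have "continuous (at (\<tau> t) within {0..}) ?f"
        using L1[rule_format, OF \<tau>(1)[of t]] by (simp add: continuous_within)
      moreover have "eventually (\<lambda>s. \<tau> s \<in> {0..}) (at t)"
        by (intro always_eventually) (simp add: \<tau>)
      moreover have "(\<tau> \<longlongrightarrow> \<tau> t) (at t)"
        unfolding \<tau>_def by (intro tendsto_intros)
      ultimately have "((\<lambda>s. ?f (\<tau> s)) \<longlongrightarrow> ?f (\<tau> t)) (at t)"
        by (rule continuous_within_tendsto_compose)
      then show ?thesis by simp
    qed
    fix \<alpha> \<zeta> and a t1 t2 :: real
    assume \<alpha>: "\<alpha> \<in> J" and cut: "cutoff \<zeta> a t1 t2" and t12: "0 < t1" "t2 < T" and nonneg: "\<And>z. 0 \<le> \<zeta> z"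
    interpret cutoff \<zeta> a t1 t2 by fact
    let ?V = "\<lambda>t. aligned_profile.drift \<phi> (\<lambda>x. M x (\<tau> t))"
    let ?Q = "\<lambda>t. quantile (\<lambda>x. M x (\<tau> t))"
    have "0 \<le> (LBINT t:{0<..}.
               (LBINT x. \<bar>M x t - \<alpha>\<bar> * dt \<zeta> (x, t) + sgn (M x t - \<alpha>) * (A (M x t) - A \<alpha>) * dx \<zeta> (x, t)) +
               integral_deriv_abs (\<lambda>x. M x t) \<alpha> (\<lambda>x. \<zeta> (x, t) * conv_measure \<Psi> (\<rho> t) x))"
      using bspec[OF ineq \<alpha>] test_function[OF t12(1)] nonneg unfolding entropy_inequality_def by blast
    also have "\<dots> = (LBINT t.
        (LBINT x. \<bar>M x (\<tau> t) - \<alpha>\<bar> * dt \<zeta> (x, t) + sgn (M x (\<tau> t) - \<alpha>) * (A (M x (\<tau> t)) - A \<alpha>) * dx \<zeta> (x, t)) +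
        ((LBINT m:{\<alpha><..1/2}. \<zeta> (?Q t m, t) * ?V t (?Q t m)) - (LBINT m:{-1/2<..\<alpha>}. \<zeta> (?Q t m, t) * ?V t (?Q t m))))"
      unfolding set_lebesgue_integral_def[of lborel "{0<..}"]
    proof (intro Bochner_Integration.integral_cong refl)
      fix t :: real
      show "indicator {0<..} t *\<^sub>R ((LBINT x. \<bar>M x t - \<alpha>\<bar> * dt \<zeta> (x, t) + sgn (M x t - \<alpha>) * (A (M x t) - A \<alpha>) * dx \<zeta> (x, t)) +
          integral_deriv_abs (\<lambda>x. M x t) \<alpha> (\<lambda>x. \<zeta> (x, t) * conv_measure \<Psi> (\<rho> t) x)) =
        (LBINT x. \<bar>M x (\<tau> t) - \<alpha>\<bar> * dt \<zeta> (x, t) + sgn (M x (\<tau> t) - \<alpha>) * (A (M x (\<tau> t)) - A \<alpha>) * dx \<zeta> (x, t)) +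
        ((LBINT m:{\<alpha><..1/2}. \<zeta> (?Q t m, t) * ?V t (?Q t m)) - (LBINT m:{-1/2<..\<alpha>}. \<zeta> (?Q t m, t) * ?V t (?Q t m)))"
      proof (cases "t \<in> {t1..t2}")
        case True
        with t12 have t: "0 < t" "\<tau> t = t" by (auto simp: \<tau>_def)
        interpret aligned_profile \<phi> "\<lambda>x. M x t" R
          using prof[of t] unfolding t(2) by (intro aligned_profile.intro alignment_potential_axioms)
        have "conv_measure \<Psi> (\<rho> t) = drift"
          using t by (intro ext conv_measure_eq_drift \<rho>) auto
        moreover have "(\<lambda>x. \<zeta> (x, t) * drift x) \<in> borel_measurable borel"
        proof -
          have [measurable]: "drift \<in> borel_measurable borel"
            by (intro borel_measurable_mono monoI drift_mono)
          show ?thesis by measurable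
        qed
        ultimately show ?thesis
          using t by (simp add: integral_deriv_abs_quantile[OF \<alpha>])
      next
        case False
        then have "\<zeta> (x, t) = 0" "dx \<zeta> (x, t) = 0" "dt \<zeta> (x, t) = 0" for x
          using support[of x t] support_dx[of x t] support_dt[of x t] by blast+
        then show ?thesis
          by (simp add: integral_deriv_abs_def set_lebesgue_integral_def)
      qed
    qed
    finally show "0 \<le> (LBINT t.
        (LBINT x. \<bar>M x (\<tau> t) - \<alpha>\<bar> * dt \<zeta> (x, t) + sgn (M x (\<tau> t) - \<alpha>) * (A (M x (\<tau> t)) - A \<alpha>) * dx \<zeta> (x, t)) +
        ((LBINT m:{\<alpha><..1/2}. \<zeta> (?Q t m, t) * ?V t (?Q t m)) - (LBINT m:{-1/2<..\<alpha>}. \<zeta> (?Q t m, t) * ?V t (?Q t m))))" .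
  qed
  then show ?thesis unfolding \<tau>_def by (rule that)
qed

theorem theorem3p6:
  fixes \<phi> u0 :: "real \<Rightarrow> real" and \<rho>0 :: "real measure"
    and M :: "real \<Rightarrow> real \<Rightarrow> real" and m' m'' :: real
  assumes "alignment_kernel \<phi>"
    and "borel_prob \<rho>0" and "compactly_supported \<rho>0"
    and "ess_bounded \<rho>0 u0"
    and "entropy_solution \<phi> (flux \<phi> \<rho>0 u0) (shifted_cdf \<rho>0) M"
    and "convex_near_frontier (flux \<phi> \<rho>0 u0)"
    and "m'' \<in> {-1/2<..1/2}" and "m' \<in> {-1/2<..1/2}"
    and "m' < Inf (linear_piece (flux \<phi> \<rho>0 u0) m'')"
  shows "\<exists>c>0. \<forall>t\<ge>0. quantile (\<lambda>x. M x t) m'' - quantile (\<lambda>x. M x t) m' \<ge> c"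
proof -
  let ?A = "flux \<phi> \<rho>0 u0" and ?X = "\<lambda>t. quantile (\<lambda>x. M x t)"
  have m: "- 1/2 < m'" "m' \<le> 1/2" "- 1/2 < m''" "m'' \<le> 1/2" using assms(7,8) by auto
  interpret alignment_potential \<phi> by standard fact
  obtain S where S: "compact S" "emeasure \<rho>0 (- S) = 0"
    using \<open>compactly_supported \<rho>0\<close> by (auto simp: compactly_supported_def)
  obtain R0 where "S \<subseteq> {- R0..R0}"
    using compact_imp_bounded[OF S(1)] by (auto simp: bounded_iff abs_le_iff minus_le_iff subset_iff)
  then have "- {- R0..R0} \<subseteq> - S" by auto
  then have "emeasure \<rho>0 (- {- R0..R0}) \<le> emeasure \<rho>0 (- S)"
    using S(1) \<open>borel_prob \<rho>0\<close> by (intro emeasure_mono) (auto simp: borel_prob_def dest: compact_imp_closed)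
  then have "distribution_profile (shifted_cdf \<rho>0) R0"
    using S(2) \<open>borel_prob \<rho>0\<close> by (intro distribution_profile_shifted_cdf[of \<rho>0]) auto
  then interpret initial_data \<phi> \<rho>0 R0 u0
    by (intro initial_data.intro aligned_profile.intro alignment_potential_axioms initial_data_axioms.intro assms)
  obtain n1 n2 p1 p2 where n: "m' < n1" "n1 \<le> n2" "n2 < m''" and p: "p1 < p2"
    and slope1: "\<And>m. m \<in> J \<Longrightarrow> ?A n1 + p1 * (m - n1) \<le> ?A m"
    and slope2: "\<And>m. m \<in> J \<Longrightarrow> ?A n2 + p2 * (m - n2) \<le> ?A m"
    and gap0: "quantile (shifted_cdf \<rho>0) m' < quantile (shifted_cdf \<rho>0) m''"
    using positive_gap_and_slopes[OF m \<open>m' < Inf _\<close>] by blast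
  obtain \<Lambda> where Lip: "lipschitz_flux ?A \<Lambda>" using lipschitz_flux ..
  have M0: "(\<lambda>x. M x 0) = shifted_cdf \<rho>0"
    using assms(5) by (auto simp: entropy_solution_def)
  define g where "g = ?X 0 m'' - ?X 0 m'"
  have g: "0 < g" using gap0 by (simp add: g_def M0)
  obtain c0 where c0: "0 < c0" "\<Psi> c0 < (p2 - p1) / 4"
    using Phi_small[of "(p2 - p1) / 4"] p by auto
  \<comment> \<open>Halved because the gap estimate evaluates \<open>\<Psi>\<close> at twice the
    threshold.\<close>
  define c1 where "c1 = c0 / 2"
  have c1: "0 < c1" "\<Psi> (2 * c1) \<le> (p2 - p1) / 4" using c0 by (auto simp: c1_def)
  obtain R where flow: "entropy_flow \<phi> ?A \<Lambda> (\<lambda>t x. M x (max 0 (min 2 t))) R 2"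
    using entropy_flow_if_entropy_solution[OF assms(1) Lip assms(5)] by (meson zero_less_numeral)
  define C where "C = entropy_flow.speed_bound \<phi> \<Lambda> R"
  have C: "0 \<le> C"
    unfolding C_def by (rule entropy_flow.speed_bound_nonneg[OF flow])
  \<comment> \<open>Both quantiles move at speed at most \<open>C\<close>, so up to this time at
    most half of the initial distance \<open>g\<close> is lost. \<open>C + 1\<close> guards against
    C = 0, and ts \<le> 1 stays within the horizon 2.\<close>
  define ts where "ts = min 1 (g / (4 * (C + 1)))"
  have ts: "0 < ts" "ts \<le> 1" "2 * C * ts \<le> g / 2"
  proof -
    show "0 < ts" "ts \<le> 1" using g C by (auto simp: ts_def)
    have "2 * C * ts \<le> 2 * C * (g / (4 * (C + 1)))"
      using C by (intro mult_left_mono) (auto simp: ts_def)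
    also have "\<dots> \<le> g / 2" using C g by (simp add: field_simps)
    finally show "2 * C * ts \<le> g / 2" .
  qed
  define c where "c = min (g / 2) (min ((p2 - p1) / 2 * ts) c1)"
  have "0 < c" using g p ts c1 by (simp add: c_def)
  moreover have "c \<le> ?X t m'' - ?X t m'" if t: "0 \<le> t" for t
  proof (cases "t \<le> ts")
    case True
    then have t2: "t < 2" using ts by simp
    have "2 * C * t \<le> 2 * C * ts" using True C by (intro mult_left_mono) auto
    moreover have "?X 0 m'' - C * (t - 0) \<le> ?X t m''"
      using entropy_flow.quantile_speed(1)[OF flow m(3,4) order_refl t t2] t t2 by (simp add: C_def)
    moreover have "?X t m' \<le> ?X 0 m' + C * (t - 0)"
      using entropy_flow.quantile_speed(2)[OF flow m(1,2) order_refl t t2] t t2 by (simp add: C_def)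
    ultimately have "g / 2 \<le> ?X t m'' - ?X t m'"
      using ts(3) unfolding g_def by simp
    then show ?thesis by (simp add: c_def)
  next
    case False
    \<comment> \<open>A fresh horizon for each \<open>t\<close>; the radius may grow with
      \<open>t\<close>, but the constants below do not depend on it.\<close>
    obtain R' where flow': "entropy_flow \<phi> ?A \<Lambda> (\<lambda>s x. M x (max 0 (min (t + 1) s))) R' (t + 1)"
      using entropy_flow_if_entropy_solution[OF assms(1) Lip assms(5), of "t + 1"] t by auto
    have "min ((p2 - p1) / 2 * t) c1 \<le> ?X t m'' - ?X t m'"
      using entropy_flow.quantile_gap_lower_bound[OF flow' m(1) less_imp_le[OF n(1)] n(3) m(4) n(2) slope1 slope2 p c1 t] t
      by simp
    moreover have "(p2 - p1) / 2 * ts \<le> (p2 - p1) / 2 * t"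
      using False p by (intro mult_left_mono) auto
    ultimately show ?thesis unfolding c_def by linarith
  qed
  ultimately show ?thesis by blast
qed

end
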